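(* Let $H:[0,T]\times\mathbb{R}^n\times\mathbb{R}^n\to\mathbb{R}$ satisfy (H1)–(H4) and (HLC), where $c(\cdot)$, each $k_R(\cdot)$ and $t\mapsto H(t,0,0)$ are integrable on $[0,T]$. Let $(\mathbb{R}^{n+1},f,l)$ be the Steiner representation of $H$. Let $t_0\in[0,T]$, let $\phi:\mathbb{R}^n\times\mathbb{R}^n\to\mathbb{R}\cup\{+\infty\}$ be proper and lower semicontinuous, and assume there is $M\ge0$ with $\min\{|z|,|x|\}\le M$ for all $(z,x)\in\mathrm{dom}\,\phi$. Consider $$\Gamma[x(\cdot)]=\phi(x(t_0),x(T))+\int_{t_0}^T H^*(t,x(t),\dot x(t))\,dt,\quad x(\cdot)\in\mathcal{A}([t_0,T],\mathbb{R}^n),$$ $$\Lambda[(x,a)(\cdot)]=\phi(x(t_0),x(T))+\int_{t_0}^T l(t,x(t),a(t))\,dt$$ over pairs $x(\cdot)\in\mathcal{A}([t_0,T],\mathbb{R}^n)$, $a(\cdot)\in L^1([t_0,T],\mathbb{R}^{n+1})$ with $\dot x(t)=f(t,x(t),a(t))$ for a.e. $t\in[t_0,T]$. Then both minima are attained and $$\min\Gamma[x(\cdot)]=\min\Lambda[(x,a)(\cdot)].$$ Moreover, if $\bar x(\cdot)$ is a minimizer of $\Gamma$ with $\Gamma[\bar x(\cdot)]<+\infty$, then $(\bar x,\bar a)(\cdot)$ with $\bar a(\cdot)=(\dot{\bar x}(\cdot),H^*(\cdot,\bar x(\cdot),\dot{\bar x}(\cdot)))$ is a minimizer of $\Lambda$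 with $\Lambda[(\bar x,\bar a)(\cdot)]<+\infty$. Conversely, if $(\bar x,\bar a)(\cdot)$ is a minimizer of $\Lambda$, then $\bar x(\cdot)$ is a minimizer of $\Gamma$.
   Context: Hypotheses: (H1) $H(\cdot,x,p)$ Lebesgue measurable; (H2) $H(t,\cdot,\cdot)$ continuous; (H3) $H(t,x,\cdot)$ convex; (H4) there is measurable $c\ge0$ with $|H(t,x,p)-H(t,x,q)|\le c(t)(1+|x|)|p-q|$; (HLC) for each $R>0$ there is measurable $k_R\ge0$ with $|H(t,x,p)-H(t,y,p)|\le k_R(t)(1+|p|)|x-y|$ for $x,y\in\bar B_R$ (closed ball radius $R$ about $0$), all $p$. $H^*(t,x,v)=\sup_p\{\langle v,p\rangle-H(t,x,p)\}$. $\mathcal{A}([t_0,T],\mathbb{R}^n)$ = absolutely continuous functions. A function is proper if it never takes $-\infty$ and is not identically $+\infty$; $\mathrm{dom}\,\phi=\{\phi<+\infty\}$. Steiner representation: $E(t,x)=\mathrm{epi}\,H^*(t,x,\cdot)=\{(v,\eta):H^*(t,x,v)\le\eta\}$; for $a\in\mathbb{R}^{n+1}$, $\Phi(t,x,a)=E(t,x)\cap\bar B(a,2d(a,E(t,x)))$; Steiner point of a nonempty compact convex $K\subset\mathbb{R}^m$: $s_m(K)=m\int_{S^{m-1}}p\max_{y\in K}\langle p,y\rangle\,\mu(dp)$ with $\mu$ normalized rotation-invariant measure on the unit sphere; $(f(t,x,a),l(t,x,a))=s_{n+1}(\Phi(t,x,a))$, $f\in\mathbb{R}^n$, $l\in\mathbb{R}$.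 *)

theory Defs
  imports "HOL-Analysis.Analysis"
begin

definition conj_H :: "(real \<Rightarrow> 'a::euclidean_space \<Rightarrow> 'a \<Rightarrow> real) \<Rightarrow> real \<Rightarrow> 'a \<Rightarrow> 'a \<Rightarrow> ereal" where
  "conj_H H t x v = (SUP p. ereal (v \<bullet> p - H t x p))"

definition epi_conj :: "(real \<Rightarrow> 'a::euclidean_space \<Rightarrow> 'a \<Rightarrow> real) \<Rightarrow> real \<Rightarrow> 'a \<Rightarrow> ('a \<times> real) set" where
  "epi_conj H t x = {(v, \<eta>). conj_H H t x v \<le> ereal \<eta>}"

definition steiner_Phi :: "(real \<Rightarrow> 'a::euclidean_space \<Rightarrow> 'a \<Rightarrow> real) \<Rightarrow> real \<Rightarrow> 'a \<Rightarrow> 'a \<times> real \<Rightarrow> ('a \<times> real) set" where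
  "steiner_Phi H t x a = epi_conj H t x \<inter> cball a (2 * infdist a (epi_conj H t x))"

text \<open>Normalized rotation-invariant measure on the unit sphere S^(m-1) of 'b
 (realised as the cone measure: push-forward of normalized Lebesgue measure on the
 unit ball under radial projection; it is concentrated on the sphere).\<close>

definition sphere_measure :: "'b::euclidean_space measure" where
  "sphere_measure = distr (uniform_measure lborel (ball 0 1)) borel (\<lambda>x. x /\<^sub>R norm x)"

definition steiner_point :: "'b::euclidean_space set \<Rightarrow> 'b" where
  "steiner_point K = real DIM('b) *\<^sub>R
     (\<integral>p. (SUP y\<in>K. p \<bullet> y) *\<^sub>R p \<partial>sphere_measure)"

definition steiner_f :: "(real \<Rightarrow> 'a::euclidean_space \<Rightarrow> 'a \<Rightarrow> real) \<Rightarrow> real \<Rightarrow> 'a \<Rightarrow> 'a \<times> real \<Rightarrow> 'a" where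
  "steiner_f H t x a = fst (steiner_point (steiner_Phi H t x a))"

definition steiner_l :: "(real \<Rightarrow> 'a::euclidean_space \<Rightarrow> 'a \<Rightarrow> real) \<Rightarrow> real \<Rightarrow> 'a \<Rightarrow> 'a \<times> real \<Rightarrow> real" where
  "steiner_l H t x a = snd (steiner_point (steiner_Phi H t x a))"

definition abs_cont_on :: "real \<Rightarrow> real \<Rightarrow> (real \<Rightarrow> 'a::real_normed_vector) \<Rightarrow> bool" where
  "abs_cont_on a b x \<longleftrightarrow>
     (\<forall>\<epsilon>>0. \<exists>\<delta>>0. \<forall>n (u::nat\<Rightarrow>real) v.
        (\<forall>i<n. a \<le> u i \<and> u i \<le> v i \<and> v i \<le> b) \<and>
        (\<forall>i<n. \<forall>j<n. i \<noteq> j \<longrightarrow> v i \<le> u j \<or> v j \<le> u i) \<and>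
        (\<Sum>i<n. v i - u i) < \<delta>
        \<longrightarrow> (\<Sum>i<n. norm (x (v i) - x (u i))) < \<epsilon>)"

definition lsc :: "('b::topological_space \<Rightarrow> ereal) \<Rightarrow> bool" where
  "lsc g \<longleftrightarrow> (\<forall>z. g z \<le> Liminf (at z) g)"

definition proper_fun :: "('b \<Rightarrow> ereal) \<Rightarrow> bool" where
  "proper_fun g \<longleftrightarrow> (\<forall>z. g z \<noteq> -\<infinity>) \<and> (\<exists>z. g z \<noteq> \<infinity>)"

definition ext_integral :: "real set \<Rightarrow> (real \<Rightarrow> ereal) \<Rightarrow> ereal" where
  "ext_integral S g =
    (let P = (\<integral>\<^sup>+ t. e2ennreal (max 0 (g t)) \<partial>lebesgue_on S);
         N = (\<integral>\<^sup>+ t. e2ennreal (max 0 (- g t)) \<partial>lebesgue_on S)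
     in if N = \<infinity> then \<infinity> else enn2ereal P - enn2ereal N)"

definition Gamma_fun :: "(real \<Rightarrow> 'a::euclidean_space \<Rightarrow> 'a \<Rightarrow> real) \<Rightarrow> ('a \<times> 'a \<Rightarrow> ereal) \<Rightarrow> real \<Rightarrow> real
    \<Rightarrow> (real \<Rightarrow> 'a) \<Rightarrow> ereal" where
  "Gamma_fun H \<phi> t0 T x = \<phi> (x t0, x T) +
     ext_integral {t0..T} (\<lambda>t. conj_H H t (x t) (vector_derivative x (at t within {t0..T})))"

definition Lambda_fun :: "(real \<Rightarrow> 'a::euclidean_space \<Rightarrow> 'a \<Rightarrow> real) \<Rightarrow> ('a \<times> 'a \<Rightarrow> ereal) \<Rightarrow> real \<Rightarrow> real
    \<Rightarrow> (real \<Rightarrow> 'a) \<times> (real \<Rightarrow> 'a \<times> real) \<Rightarrow> ereal" where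
  "Lambda_fun H \<phi> t0 T xa = \<phi> (fst xa t0, fst xa T) +
     ext_integral {t0..T} (\<lambda>t. ereal (steiner_l H t (fst xa t) (snd xa t)))"

definition AC_set :: "real \<Rightarrow> real \<Rightarrow> (real \<Rightarrow> 'a::euclidean_space) set" where
  "AC_set t0 T = {x. abs_cont_on t0 T x}"

definition Lambda_adm :: "(real \<Rightarrow> 'a::euclidean_space \<Rightarrow> 'a \<Rightarrow> real) \<Rightarrow> real \<Rightarrow> real
    \<Rightarrow> ((real \<Rightarrow> 'a) \<times> (real \<Rightarrow> 'a \<times> real)) set" where
  "Lambda_adm H t0 T = {(x, a). abs_cont_on t0 T x \<and> integrable (lebesgue_on {t0..T}) a \<and>
      (AE t in lebesgue_on {t0..T}. vector_derivative x (at t within {t0..T}) = steiner_f H t (x t) (a t))}"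

end

theory Submission
  imports Defs "HOL-Complex_Analysis.Great_Picard"
begin

text \<open>
  The Steiner point of a convex body \<open>K\<close> lies in \<open>K\<close>, so \<open>(f, l)(t, x, w)\<close> belongs to the epigraph of
  \<open>H\<^sup>*(t, x, \<cdot>)\<close>; hence \<open>H\<^sup>*(t, x, x') \<le> l\<close> along admissible pairs and \<open>\<Gamma> \<le> \<Lambda>\<close>. If \<open>w\<close> is already in the
  epigraph, the set \<open>\<Phi>(t, x, w)\<close> is the singleton \<open>{w}\<close>, so the control \<open>(x', H\<^sup>*(t, x, x'))\<close> reproduces \<open>x\<close> at equal
  cost. What remains is that \<open>\<Gamma>\<close> attains its minimum (Tonelli: Gronwall, Arzela--Ascoli, lower
  semicontinuity) and that \<open>\<Lambda>\<close> has an admissible pair at all.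

  Lower semicontinuity uses no weak compactness: \<open>H\<^sup>*\<close> is a countable supremum of the integrands
  \<open>v \<bullet> p - H t x p\<close>, and integrals of finitely many of these over measurable pieces converge.
  Membership of the Steiner point comes from a translation argument: for the bump
  \<open>w(z) = max 0 (1 - z \<bullet> z)\<close> and a convex \<open>h\<close>, the derivative at \<open>s = 0\<close> of the bump average of \<open>h(z + s p)\<close> is
  a multiple of the integral of \<open>h(z) (z \<bullet> p)\<close> over the ball, and convexity bounds it by the average
  of \<open>h(z + p) - h(z)\<close>. With \<open>h\<close> the support function of \<open>K\<close> this is the Steiner point; with
  \<open>h = H t x\<close> it is an approximate subgradient that depends measurably on \<open>t\<close> and Lipschitz
  continuously on \<open>x\<close>, so that Picard iteration produces an admissible trajectory.
\<close>

subsection \<open>Absolutely continuous functions\<close>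


text \<open>No superlinear growth of \<open>conj_H\<close> is assumed; (H4) replaces it. A finite
  value of \<open>conj_H H t x v\<close> forces norm v \<le> c t * (1 + norm x), so bounded
  trajectories of finite cost have derivatives dominated by one integrable function. They are
  bounded uniformly because the condition on \<phi> controls one endpoint, from which the Gronwall
  estimate runs forward or backward. Domination in turn reduces weak convergence of the derivatives
  to pointwise convergence of the trajectories. The cost has no global lower bound, only one by an
  integrable \<kappa> depending on a radius; adding \<kappa> turns costs into nonnegative integrals.
  \<open>vector_derivative\<close> is a choice operator, so its measurability and the fundamental
  theorem for \<open>abs_cont_on\<close> functions have to come from a density, built by Jordan
  decomposition and Radon-Nikodym. The bump is quadratic because its gradient - 2 z inside the ball
  reproduces the factor p in Steiner's integrand; a homogeneity argument then passes from the sphere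
  to the ball.\<close>

definition nonoverlap :: "real \<Rightarrow> real \<Rightarrow> 'i set \<Rightarrow> ('i \<Rightarrow> real) \<Rightarrow> ('i \<Rightarrow> real) \<Rightarrow> bool" where
  "nonoverlap a b I u v \<longleftrightarrow> finite I \<and> (\<forall>i\<in>I. a \<le> u i \<and> u i \<le> v i \<and> v i \<le> b) \<and>
     (\<forall>i\<in>I. \<forall>j\<in>I. i \<noteq> j \<longrightarrow> v i \<le> u j \<or> v j \<le> u i)"

text \<open>\<open>nonoverlap\<close> admits any finite index set, so that subfamilies of a grid and
  families of families are again families; this leads back to the initial segments used in
  \<open>abs_cont_on\<close>. The conclusion ranges over all \<open>g\<close> because lengths and
  increments must be moved by the same enumeration.\<close>

lemma nonoverlap_reindex_nat:
  assumes "nonoverlap a b I u v"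
  obtains n and u' v' :: "nat \<Rightarrow> real" where "nonoverlap a b {..<n} u' v'"
    "\<And>g :: real \<Rightarrow> real \<Rightarrow> real. (\<Sum>i<n. g (u' i) (v' i)) = (\<Sum>i\<in>I. g (u i) (v i))"
proof -
  have fin: "finite I" using assms by (simp add: nonoverlap_def)
  then obtain h where h: "bij_betw h {..<card I} I"
    using ex_bij_betw_nat_finite[OF fin] by (auto simp: atLeast0LessThan)
  have inI: "h i \<in> I" if "i < card I" for i using h that by (auto simp: bij_betw_def)
  have inj: "h i \<noteq> h j" if "i < card I" "j < card I" "i \<noteq> j" for i j
    using h that by (auto simp: bij_betw_def inj_on_def)
  show thesis
  proof
    show "nonoverlap a b {..<card I} (u \<circ> h) (v \<circ> h)"
      using assms inI inj unfolding nonoverlap_def by simp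
    show "(\<Sum>i<card I. g ((u \<circ> h) i) ((v \<circ> h) i)) = (\<Sum>i\<in>I. g (u i) (v i))" for g :: "real \<Rightarrow> real \<Rightarrow> real"
      using sum.reindex_bij_betw[OF h, of "\<lambda>i. g (u i) (v i)"] by simp
  qed
qed

definition ac_modulus :: "(real \<Rightarrow> 'a::real_normed_vector) \<Rightarrow> real \<Rightarrow> real \<Rightarrow> real \<Rightarrow> real \<Rightarrow> bool" where
  "ac_modulus f a b \<epsilon> \<delta> \<longleftrightarrow> (\<forall>n u v. nonoverlap a b {..<n::nat} u v \<longrightarrow> (\<Sum>i<n. v i - u i) < \<delta> \<longrightarrow>
     (\<Sum>i<n. norm (f (v i) - f (u i))) < \<epsilon>)"

lemma ac_modulusI:
  assumes "\<And>n u v. nonoverlap a b {..<n::nat} u v \<Longrightarrow> (\<Sum>i<n. v i - u i) < \<delta> \<Longrightarrow>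
     (\<Sum>i<n. norm (f (v i) - f (u i))) < \<epsilon>"
  shows "ac_modulus f a b \<epsilon> \<delta>"
  using assms by (simp add: ac_modulus_def)

lemma ac_modulusD:
  assumes "ac_modulus f a b \<epsilon> \<delta>" "nonoverlap a b {..<n::nat} u v" "(\<Sum>i<n. v i - u i) < \<delta>"
  shows "(\<Sum>i<n. norm (f (v i) - f (u i))) < \<epsilon>"
  using assms by (simp add: ac_modulus_def)

lemma abs_cont_on_iff_modulus: "abs_cont_on a b f \<longleftrightarrow> (\<forall>\<epsilon>>0. \<exists>\<delta>>0. ac_modulus f a b \<epsilon> \<delta>)"
proof -
  have "nonoverlap a b {..<n} u v \<longleftrightarrow> (\<forall>i<n. a \<le> u i \<and> u i \<le> v i \<and> v i \<le> b) \<and>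
      (\<forall>i<n. \<forall>j<n. i \<noteq> j \<longrightarrow> v i \<le> u j \<or> v j \<le> u i)" for n :: nat and u v
    by (simp add: nonoverlap_def Ball_def)
  then show ?thesis unfolding abs_cont_on_def ac_modulus_def by (simp only: conj_assoc imp_conjL)
qed

lemma abs_cont_on_modulus:
  assumes "abs_cont_on a b f" "0 < \<epsilon>"
  obtains \<delta> where "0 < \<delta>" "ac_modulus f a b \<epsilon> \<delta>"
  using assms abs_cont_on_iff_modulus by blast

lemma abs_cont_onI:
  assumes "\<And>\<epsilon>. 0 < \<epsilon> \<Longrightarrow> \<exists>\<delta>>0. ac_modulus f a b \<epsilon> \<delta>"
  shows "abs_cont_on a b f"
  using assms abs_cont_on_iff_modulus by blast

lemma abs_cont_on_close:
  assumes "abs_cont_on a b f" "0 < \<epsilon>"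
  obtains \<delta> where "0 < \<delta>"
    "\<And>s t. a \<le> s \<Longrightarrow> s \<le> t \<Longrightarrow> t \<le> b \<Longrightarrow> t - s < \<delta> \<Longrightarrow> norm (f t - f s) < \<epsilon>"
proof -
  obtain \<delta> where d: "0 < \<delta>" and *: "ac_modulus f a b \<epsilon> \<delta>"
    using abs_cont_on_modulus[OF assms] by blast
  show thesis
  proof (rule that[OF d])
    fix s t assume "a \<le> s" "s \<le> t" "t \<le> b" "t - s < \<delta>"
    then show "norm (f t - f s) < \<epsilon>"
      using ac_modulusD[OF *, of 1 "\<lambda>_. s" "\<lambda>_. t"] by (auto simp: nonoverlap_def)
  qed
qed

lemma abs_cont_on_imp_continuous:
  assumes "abs_cont_on a b f"
  shows "continuous_on {a..b} f"
  unfolding continuous_on_iff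
proof (intro ballI allI impI)
  fix x e :: real assume x: "x \<in> {a..b}" and "0 < e"
  obtain \<delta> where d: "0 < \<delta>"
    "\<And>s t. a \<le> s \<Longrightarrow> s \<le> t \<Longrightarrow> t \<le> b \<Longrightarrow> t - s < \<delta> \<Longrightarrow> norm (f t - f s) < e"
    using abs_cont_on_close[OF assms \<open>0 < e\<close>] by metis
  have "dist (f y) (f x) < e" if "y \<in> {a..b}" "dist y x < \<delta>" for y
    using d(2)[of x y] d(2)[of y x] x that
    by (cases "x \<le> y") (auto simp: dist_norm norm_minus_commute abs_if split: if_splits)
  then show "\<exists>d>0. \<forall>x'\<in>{a..b}. dist x' x < d \<longrightarrow> dist (f x') (f x) < e"
    using d(1) by blast
qed

text \<open>Only increments inside {a..b} are compared. This covers coordinates, Lipschitz images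
  such as the exponential of an indefinite integral, and, with \<open>L = 1\<close>, functions that
  agree with \<open>f\<close> on the interval alone.\<close>

lemma abs_cont_on_compose_le:
  assumes "abs_cont_on a b f" "0 \<le> L"
    and "\<And>s t. a \<le> s \<Longrightarrow> s \<le> t \<Longrightarrow> t \<le> b \<Longrightarrow> norm (g t - g s) \<le> L * norm (f t - f s)"
  shows "abs_cont_on a b g"
proof (rule abs_cont_onI)
  fix \<epsilon> :: real assume e: "0 < \<epsilon>"
  then have e': "0 < \<epsilon> / (L + 1)" using assms(2) by simp
  obtain \<delta> where d: "0 < \<delta>" and *: "ac_modulus f a b (\<epsilon> / (L + 1)) \<delta>"
    using abs_cont_on_modulus[OF assms(1) e'] by blast
  have "(\<Sum>i<n. norm (g (v i) - g (u i))) < \<epsilon>"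
    if "nonoverlap a b {..<n} u v" "(\<Sum>i<n. v i - u i) < \<delta>" for n and u v :: "nat \<Rightarrow> real"
  proof -
    have "(\<Sum>i<n. norm (g (v i) - g (u i))) \<le> (\<Sum>i<n. L * norm (f (v i) - f (u i)))"
      using that(1) by (intro sum_mono assms(3)) (auto simp: nonoverlap_def)
    also have "\<dots> = L * (\<Sum>i<n. norm (f (v i) - f (u i)))" by (simp add: sum_distrib_left)
    also have "\<dots> \<le> L * (\<epsilon> / (L + 1))"
      using less_imp_le[OF ac_modulusD[OF * that]] assms(2) by (intro mult_left_mono)
    also have "\<dots> < \<epsilon>" using mult_strict_right_mono[of L "L + 1", OF _ e'] assms(2) by simp
    finally show ?thesis .
  qed
  then have "ac_modulus g a b \<epsilon> \<delta>" by (rule ac_modulusI)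
  then show "\<exists>\<delta>>0. ac_modulus g a b \<epsilon> \<delta>" using d by blast
qed

lemma abs_cont_on_diff:
  assumes "abs_cont_on a b f" "abs_cont_on a b g"
  shows "abs_cont_on a b (\<lambda>t. f t - g t)"
proof (rule abs_cont_onI)
  fix \<epsilon> :: real assume e: "0 < \<epsilon>"
  obtain \<delta> where d: "0 < \<delta>" and 1: "ac_modulus f a b (\<epsilon> / 2) \<delta>"
    using abs_cont_on_modulus[OF assms(1) half_gt_zero[OF e]] by blast
  obtain \<delta>' where d': "0 < \<delta>'" and 2: "ac_modulus g a b (\<epsilon> / 2) \<delta>'"
    using abs_cont_on_modulus[OF assms(2) half_gt_zero[OF e]] by blast
  have "(\<Sum>i<n. norm ((f (v i) - g (v i)) - (f (u i) - g (u i)))) < \<epsilon>"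
    if "nonoverlap a b {..<n} u v" "(\<Sum>i<n. v i - u i) < min \<delta> \<delta>'" for n and u v :: "nat \<Rightarrow> real"
  proof -
    have "(\<Sum>i<n. norm ((f (v i) - g (v i)) - (f (u i) - g (u i))))
        \<le> (\<Sum>i<n. norm (f (v i) - f (u i)) + norm (g (v i) - g (u i)))"
    proof (rule sum_mono)
      fix i
      show "norm ((f (v i) - g (v i)) - (f (u i) - g (u i))) \<le> norm (f (v i) - f (u i)) + norm (g (v i) - g (u i))"
        using norm_triangle_ineq4[of "f (v i) - f (u i)" "g (v i) - g (u i)"] by (simp add: algebra_simps)
    qed
    also have "\<dots> < \<epsilon>" using ac_modulusD[OF 1 that(1)] ac_modulusD[OF 2 that(1)] that(2) by (simp add: sum.distrib)
    finally show ?thesis .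
  qed
  then have "ac_modulus (\<lambda>t. f t - g t) a b \<epsilon> (min \<delta> \<delta>')" by (rule ac_modulusI)
  then show "\<exists>\<delta>>0. ac_modulus (\<lambda>t. f t - g t) a b \<epsilon> \<delta>" using d d' min_less_iff_conj by blast
qed

text \<open>Members of a family may share endpoints; the half-open intervals {u i<..v i} are
  disjoint all the same, so the lengths add up to the measure of a subset of
  \<open>U\<close>.\<close>

lemma nonoverlap_sum_le_measure:
  assumes "nonoverlap a b I u v" and sub: "\<And>i. i \<in> I \<Longrightarrow> {u i<..v i} \<subseteq> U"
    and U: "U \<in> fmeasurable lborel"
  shows "(\<Sum>i\<in>I. v i - u i) \<le> measure lborel U"
proof -
  have fin: "finite I" using assms by (simp add: nonoverlap_def)
  have disj: "disjoint_family_on (\<lambda>i. {u i<..v i}) I"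
    unfolding disjoint_family_on_def
  proof (intro ballI impI)
    fix i j assume "i \<in> I" "j \<in> I" "i \<noteq> j"
    then have "v i \<le> u j \<or> v j \<le> u i" using assms(1) by (simp add: nonoverlap_def)
    then show "{u i<..v i} \<inter> {u j<..v j} = {}" by auto
  qed
  have le: "u i \<le> v i" if "i \<in> I" for i using assms(1) that by (simp add: nonoverlap_def)
  have "(\<Sum>i\<in>I. v i - u i) = (\<Sum>i\<in>I. measure lborel {u i<..v i})"
    by (rule sum.cong) (simp_all add: le)
  also have "\<dots> = measure lborel (\<Union>i\<in>I. {u i<..v i})"
    by (rule measure_finite_Union[symmetric]) (use fin disj in \<open>auto simp: le\<close>)
  also have "\<dots> \<le> measure lborel U"
  proof (rule measure_mono_fmeasurable)
    show "(\<Union>i\<in>I. {u i<..v i}) \<subseteq> U" using sub by blast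
  qed (use U fin in auto)
  finally show ?thesis .
qed

section \<open>Positive variation and the Jordan decomposition\<close>

definition incr_sums :: "(real \<Rightarrow> real) \<Rightarrow> real \<Rightarrow> real \<Rightarrow> real set" where
  "incr_sums f s t = {(\<Sum>i<n. f (v i) - f (u i)) |n u v. nonoverlap s t {..<n::nat} u v}"

text \<open>The families in \<open>incr_sums\<close> need not cover {s..t}, so intervals with a
  negative increment can be left out: this is the positive variation. The empty family makes 0 one
  of the sums.\<close>

definition pos_var :: "(real \<Rightarrow> real) \<Rightarrow> real \<Rightarrow> real \<Rightarrow> real" where
  "pos_var f s t = Sup (incr_sums f s t)"

lemma incr_sums_I:
  assumes "nonoverlap s t I u v"
  shows "(\<Sum>i\<in>I. f (v i) - f (u i)) \<in> incr_sums f s t"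
proof -
  obtain n and u' v' :: "nat \<Rightarrow> real" where 1: "nonoverlap s t {..<n} u' v'"
    and 2: "\<And>g :: real \<Rightarrow> real \<Rightarrow> real. (\<Sum>i<n. g (u' i) (v' i)) = (\<Sum>i\<in>I. g (u i) (v i))"
    using nonoverlap_reindex_nat[OF assms] by metis
  show ?thesis unfolding incr_sums_def mem_Collect_eq
    by (rule exI[of _ n], rule exI[of _ u'], rule exI[of _ v'])
       (simp only: 1 2[of "\<lambda>x y. f y - f x"] simp_thms)
qed

lemma incr_sums_zero: "0 \<in> incr_sums f s t"
  using incr_sums_I[of s t "{} :: nat set" id id f] by (simp add: nonoverlap_def)

lemma incr_sums_single: "s \<le> t \<Longrightarrow> f t - f s \<in> incr_sums f s t"
  using incr_sums_I[of s t "{0} :: nat set" "\<lambda>_. s" "\<lambda>_. t" f] by (simp add: nonoverlap_def)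

lemma incr_sums_mono:
  assumes "a \<le> s" "t \<le> b"
  shows "incr_sums f s t \<subseteq> incr_sums f a b"
proof
  fix x assume "x \<in> incr_sums f s t"
  then obtain n u v where uv: "nonoverlap s t {..<n::nat} u v" and x: "x = (\<Sum>i<n. f (v i) - f (u i))"
    unfolding incr_sums_def by blast
  have "nonoverlap a b {..<n} u v" using uv assms by (simp add: nonoverlap_def) (meson order_trans)
  then show "x \<in> incr_sums f a b" unfolding x by (rule incr_sums_I)
qed

text \<open>Truncating both endpoints by min and max with \<open>s\<close> cuts every interval at
  \<open>s\<close>. An interval on one side leaves a degenerate interval on the other, which
  contributes nothing.\<close>

lemma incr_sums_cut:
  assumes "x \<in> incr_sums f a t" "a \<le> s" "s \<le> t"
  shows "\<exists>y\<in>incr_sums f a s. \<exists>z\<in>incr_sums f s t. x = y + z"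
proof -
  obtain n u v where uv: "nonoverlap a t {..<n::nat} u v" and x: "x = (\<Sum>i<n. f (v i) - f (u i))"
    using assms(1) unfolding incr_sums_def by blast
  have no: "v i \<le> u j \<or> v j \<le> u i" if "i < n" "j < n" "i \<noteq> j" for i j
    using uv that by (simp add: nonoverlap_def)
  have bd: "a \<le> u i" "u i \<le> v i" "v i \<le> t" if "i < n" for i
    using uv that by (simp_all add: nonoverlap_def)
  have "min (v i) s \<le> min (u j) s \<or> min (v j) s \<le> min (u i) s" if "i < n" "j < n" "i \<noteq> j" for i j
    using no[OF that] by linarith
  then have 1: "nonoverlap a s {..<n} (\<lambda>i. min (u i) s) (\<lambda>i. min (v i) s)"
    using bd assms(2,3) unfolding nonoverlap_def by (simp add: min.coboundedI1)
  have "max (v i) s \<le> max (u j) s \<or> max (v j) s \<le> max (u i) s" if "i < n" "j < n" "i \<noteq> j" for i j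
    using no[OF that] by linarith
  then have 2: "nonoverlap s t {..<n} (\<lambda>i. max (u i) s) (\<lambda>i. max (v i) s)"
    using bd assms(2,3) unfolding nonoverlap_def by (simp add: max.coboundedI1)
  have "x = (\<Sum>i<n. f (min (v i) s) - f (min (u i) s)) + (\<Sum>i<n. f (max (v i) s) - f (max (u i) s))"
    unfolding x sum.distrib[symmetric] by (intro sum.cong) (auto simp: min_def max_def)
  then show ?thesis using incr_sums_I[OF 1] incr_sums_I[OF 2] by blast
qed

text \<open>Pairs (i, k), for the k-th interval chosen inside {s i..t i}, index one large family.
  The length bound lets the modulus of absolute continuity of \<open>f\<close> act on a union of
  near-optimal families.\<close>

lemma incr_sums_join:
  assumes st: "nonoverlap a b I s t" and y: "\<And>i. i \<in> I \<Longrightarrow> y i \<in> incr_sums f (s i) (t i)"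
  obtains n and u v :: "nat \<Rightarrow> real" where "nonoverlap a b {..<n} u v"
    "(\<Sum>i<n. v i - u i) \<le> (\<Sum>i\<in>I. t i - s i)"
    "(\<Sum>i<n. f (v i) - f (u i)) = (\<Sum>i\<in>I. y i)"
proof -
  have "\<forall>i\<in>I. \<exists>n u v. nonoverlap (s i) (t i) {..<n::nat} u v \<and> y i = (\<Sum>k<n. f (v k) - f (u k))"
    using y unfolding incr_sums_def by blast
  then obtain n u v where uv: "\<And>i. i \<in> I \<Longrightarrow> nonoverlap (s i) (t i) {..<n i::nat} (u i) (v i)"
    and yi: "\<And>i. i \<in> I \<Longrightarrow> y i = (\<Sum>k<n i. f (v i k) - f (u i k))"
    by metis
  have fin: "finite I" using st by (simp add: nonoverlap_def)
  let ?J = "SIGMA i:I. {..<n i}"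
  have no: "nonoverlap a b ?J (\<lambda>(i,k). u i k) (\<lambda>(i,k). v i k)"
    unfolding nonoverlap_def
  proof (intro conjI ballI impI)
    show "finite ?J" using fin by auto
  next
    fix p assume "p \<in> ?J"
    then obtain i k where p: "p = (i,k)" "i \<in> I" "k < n i" by auto
    have "s i \<le> u i k" "u i k \<le> v i k" "v i k \<le> t i" "a \<le> s i" "t i \<le> b"
      using uv[OF p(2)] p st unfolding nonoverlap_def by auto
    then show "a \<le> (case p of (i,k) \<Rightarrow> u i k)" "(case p of (i,k) \<Rightarrow> u i k) \<le> (case p of (i,k) \<Rightarrow> v i k)"
       "(case p of (i,k) \<Rightarrow> v i k) \<le> b" by (auto simp: p)
  next
    fix p q assume "p \<in> ?J" "q \<in> ?J" "p \<noteq> q"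
    then obtain i k j l where p: "p = (i,k)" "i \<in> I" "k < n i" and q: "q = (j,l)" "j \<in> I" "l < n j" by auto
    have P: "s i \<le> u i k" "v i k \<le> t i" using uv[OF p(2)] p unfolding nonoverlap_def by auto
    have Q: "s j \<le> u j l" "v j l \<le> t j" using uv[OF q(2)] q unfolding nonoverlap_def by auto
    have "v i k \<le> u j l \<or> v j l \<le> u i k"
    proof (cases "i = j")
      case True
      then show ?thesis using uv[OF p(2)] p q \<open>p \<noteq> q\<close> unfolding nonoverlap_def by auto
    next
      case False
      then have "t i \<le> s j \<or> t j \<le> s i" using st p q unfolding nonoverlap_def by auto
      then show ?thesis using P Q by linarith
    qed
    then show "(case p of (i,k) \<Rightarrow> v i k) \<le> (case q of (i,k) \<Rightarrow> u i k) \<or>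
        (case q of (i,k) \<Rightarrow> v i k) \<le> (case p of (i,k) \<Rightarrow> u i k)"
      by (auto simp: p q)
  qed
  obtain m and u' v' :: "nat \<Rightarrow> real" where 1: "nonoverlap a b {..<m} u' v'"
    and 2: "\<And>g :: real \<Rightarrow> real \<Rightarrow> real. (\<Sum>i<m. g (u' i) (v' i)) = (\<Sum>p\<in>?J. g (case p of (i,k) \<Rightarrow> u i k) (case p of (i,k) \<Rightarrow> v i k))"
    using nonoverlap_reindex_nat[OF no] by metis
  have 3: "(\<Sum>i<m. g (u' i) (v' i)) = (\<Sum>i\<in>I. \<Sum>k<n i. g (u i k) (v i k))" for g :: "real \<Rightarrow> real \<Rightarrow> real"
    unfolding 2 by (subst sum.Sigma) (auto simp: fin intro!: sum.cong)
  show thesis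
  proof (rule that[OF 1])
    have len: "(\<Sum>k<n i. v i k - u i k) \<le> t i - s i" if "i \<in> I" for i
    proof -
      have "{u i k<..v i k} \<subseteq> {s i<..t i}" if "k < n i" for k
        using uv[OF \<open>i \<in> I\<close>] that unfolding nonoverlap_def by force
      then have "(\<Sum>k<n i. v i k - u i k) \<le> measure lborel {s i<..t i}"
        by (intro nonoverlap_sum_le_measure[OF uv[OF that]])
           (use st \<open>i \<in> I\<close> in \<open>simp_all add: nonoverlap_def fmeasurable_def\<close>)
      then show ?thesis using that st by (simp add: nonoverlap_def)
    qed
    show "(\<Sum>i<m. v' i - u' i) \<le> (\<Sum>i\<in>I. t i - s i)"
      unfolding 3[of "\<lambda>x y. y - x"] by (intro sum_mono len)
    show "(\<Sum>i<m. f (v' i) - f (u' i)) = (\<Sum>i\<in>I. y i)"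
      unfolding 3[of "\<lambda>x y. f y - f x"] by (intro sum.cong) (auto simp: yi)
  qed
qed

lemma incr_sums_add:
  assumes "y \<in> incr_sums f a s" "z \<in> incr_sums f s t" "a \<le> s" "s \<le> t"
  shows "y + z \<in> incr_sums f a t"
proof -
  have "nonoverlap a t (UNIV :: bool set) (\<lambda>i. if i then a else s) (\<lambda>i. if i then s else t)"
    using assms by (auto simp: nonoverlap_def)
  then obtain n and u v :: "nat \<Rightarrow> real" where "nonoverlap a t {..<n} u v"
      "(\<Sum>i<n. f (v i) - f (u i)) = (\<Sum>i\<in>UNIV. (if i then y else z))"
    by (rule incr_sums_join[where y = "\<lambda>i. if i then y else z"]) (use assms in auto)
  then show ?thesis using incr_sums_I[of a t "{..<n}" u v f] by (simp add: UNIV_bool add.commute)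
qed

text \<open>The modulus for \<epsilon> = 1 bounds the sums over any interval shorter than \<delta>
  by 1, and finitely many such intervals cover {a..b}.\<close>

lemma incr_sums_bdd:
  assumes ac: "abs_cont_on a b f" and "a \<le> b"
  shows "bdd_above (incr_sums f a b)"
proof -
  obtain \<delta> where d: "0 < \<delta>" and *: "ac_modulus f a b 1 \<delta>"
    using abs_cont_on_modulus[OF ac zero_less_one] by blast
  have small: "x \<le> 1" if A: "x \<in> incr_sums f s t" "a \<le> s" "s \<le> t" "t \<le> b" "t - s < \<delta>" for x s t
  proof -
    have "nonoverlap a b {0::nat} (\<lambda>_. s) (\<lambda>_. t)" using that by (auto simp: nonoverlap_def)
    then obtain n and u v :: "nat \<Rightarrow> real" where "nonoverlap a b {..<n} u v"
      "(\<Sum>i<n. v i - u i) \<le> (\<Sum>i\<in>{0::nat}. t - s)"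
      "(\<Sum>i<n. f (v i) - f (u i)) = (\<Sum>i\<in>{0::nat}. x)"
      by (rule incr_sums_join[where y = "\<lambda>_. x"]) (use A in auto)
    moreover from this have "(\<Sum>i<n. norm (f (v i) - f (u i))) < 1" using ac_modulusD[OF *] A by auto
    moreover have "(\<Sum>i<n. f (v i) - f (u i)) \<le> (\<Sum>i<n. norm (f (v i) - f (u i)))"
      by (intro sum_mono) auto
    ultimately show ?thesis by simp
  qed
  \<comment> \<open>Steps of length \<delta>/2 and not \<delta>, since \<open>small\<close> needs a
    length strictly below \<delta>. For k = 0 the interval is {a..a}, hence the bound k + 1.\<close>
  have "\<forall>t. a \<le> t \<and> t \<le> b \<and> t \<le> a + real k * (\<delta>/2) \<longrightarrow> (\<forall>x\<in>incr_sums f a t. x \<le> real k + 1)" for k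
  proof (induction k)
    case 0
    then show ?case using small[of _ a a] d by auto
  next
    case (Suc k)
    show ?case
    proof (intro allI impI ballI)
      fix t x assume t: "a \<le> t \<and> t \<le> b \<and> t \<le> a + real (Suc k) * (\<delta>/2)" and x: "x \<in> incr_sums f a t"
      define s where "s = max a (t - \<delta>/2)"
      have s: "a \<le> s" "s \<le> t" "t - s < \<delta>" using t d by (auto simp: s_def)
      have "t - \<delta>/2 \<le> a + real k * (\<delta>/2)" using t d by (auto simp: field_simps)
      then have s2: "s \<le> a + real k * (\<delta>/2)" using d by (auto simp: s_def)
      obtain y z where yz: "y \<in> incr_sums f a s" "z \<in> incr_sums f s t" "x = y + z"
        using incr_sums_cut[OF x s(1,2)] by blast
      have "y \<le> real k + 1" using Suc s s2 t yz by auto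
      moreover have "z \<le> 1" using small[OF yz(2)] s t by auto
      ultimately show "x \<le> real (Suc k) + 1" using yz by simp
    qed
  qed
  note * = this
  obtain k where "(b - a) / (\<delta>/2) \<le> real k" using real_arch_simple by blast
  then have "b \<le> a + real k * (\<delta>/2)" using d by (simp add: field_simps)
  then have "\<forall>x\<in>incr_sums f a b. x \<le> real k + 1" using *[of k] \<open>a \<le> b\<close> by auto
  then show ?thesis by (auto simp: bdd_above_def)
qed

context
  fixes f :: "real \<Rightarrow> real" and a b :: real
  assumes ac: "abs_cont_on a b f" and ab: "a \<le> b"
begin

lemma incr_sums_bdd_sub: "a \<le> s \<Longrightarrow> t \<le> b \<Longrightarrow> bdd_above (incr_sums f s t)"
  using incr_sums_bdd[OF ac ab] incr_sums_mono by (metis bdd_above_mono)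

lemma incr_sums_le_pos_var: "a \<le> s \<Longrightarrow> t \<le> b \<Longrightarrow> x \<in> incr_sums f s t \<Longrightarrow> x \<le> pos_var f s t"
  unfolding pos_var_def by (rule cSup_upper) (auto intro: incr_sums_bdd_sub)

text \<open>One half of the additivity of the positive variation over adjacent intervals. The other
  half, \<open>pos_var_diff_ge\<close>, speaks of single sums, because it is applied to 0 and to f t
  - f s as well.\<close>

lemma pos_var_diff_le:
  assumes "a \<le> s" "s \<le> t" "t \<le> b"
  shows "pos_var f a t - pos_var f a s \<le> pos_var f s t"
proof -
  have "x \<le> pos_var f a s + pos_var f s t" if x: "x \<in> incr_sums f a t" for x
  proof -
    obtain y z where "y \<in> incr_sums f a s" "z \<in> incr_sums f s t" "x = y + z"
      using incr_sums_cut[OF x assms(1,2)] by blast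
    then show ?thesis using incr_sums_le_pos_var[of a s y] incr_sums_le_pos_var[of s t z] assms by auto
  qed
  then have "pos_var f a t \<le> pos_var f a s + pos_var f s t"
    unfolding pos_var_def[of f a t] using incr_sums_zero[of f a t] by (intro cSup_least) auto
  then show ?thesis by simp
qed

lemma pos_var_diff_ge:
  assumes "a \<le> s" "s \<le> t" "t \<le> b" "z \<in> incr_sums f s t"
  shows "z \<le> pos_var f a t - pos_var f a s"
proof -
  have "y \<le> pos_var f a t - z" if "y \<in> incr_sums f a s" for y
    using incr_sums_le_pos_var[OF order_refl assms(3) incr_sums_add[OF that assms(4,1,2)]] by simp
  then have "pos_var f a s \<le> pos_var f a t - z"
    unfolding pos_var_def[of f a s] using incr_sums_zero[of f a s] by (intro cSup_least) auto
  then show ?thesis by simp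
qed

lemma abs_cont_on_pos_var: "abs_cont_on a b (pos_var f a)"
proof (rule abs_cont_onI)
  fix \<epsilon> :: real assume e: "0 < \<epsilon>"
  obtain \<delta> where d: "0 < \<delta>" and *: "ac_modulus f a b (\<epsilon> / 2) \<delta>"
    using abs_cont_on_modulus[OF ac half_gt_zero[OF e]] by blast
  have "(\<Sum>i<n. norm (pos_var f a (t i) - pos_var f a (s i))) < \<epsilon>"
    if no: "nonoverlap a b {..<n} s t" and len: "(\<Sum>i<n. t i - s i) < \<delta>" for n and s t :: "nat \<Rightarrow> real"
  proof -
    \<comment> \<open>The loss allowed on each interval when its positive variation is replaced by a
      sum y i: n losses stay within \<epsilon>/2, and the joined families, of total length below
      \<delta>, contribute the other \<epsilon>/2.\<close>
    define \<eta> where "\<eta> = \<epsilon> / (2 * (real n + 1))"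
    have eta: "0 < \<eta>" using e by (simp add: \<eta>_def)
    have st: "a \<le> s i" "s i \<le> t i" "t i \<le> b" if "i < n" for i using no that by (auto simp: nonoverlap_def)
    have "\<exists>y\<in>incr_sums f (s i) (t i). pos_var f (s i) (t i) - \<eta> < y" for i
      unfolding pos_var_def
      using less_cSupD[of "incr_sums f (s i) (t i)"] incr_sums_zero[of f "s i" "t i"] eta by fastforce
    then obtain y where y: "\<And>i. y i \<in> incr_sums f (s i) (t i)" "\<And>i. pos_var f (s i) (t i) - \<eta> < y i"
      by metis
    obtain m and u v :: "nat \<Rightarrow> real" where uv: "nonoverlap a b {..<m} u v"
      "(\<Sum>i<m. v i - u i) \<le> (\<Sum>i<n. t i - s i)"
      "(\<Sum>i<m. f (v i) - f (u i)) = (\<Sum>i<n. y i)"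
      by (rule incr_sums_join[OF no]) (use y in auto)
    have "norm (pos_var f a (t i) - pos_var f a (s i)) \<le> y i + \<eta>" if "i < n" for i
      using pos_var_diff_le[OF st[OF that]] pos_var_diff_ge[OF st[OF that] incr_sums_zero] y(2)[of i] by auto
    then have "(\<Sum>i<n. norm (pos_var f a (t i) - pos_var f a (s i))) \<le> (\<Sum>i<n. y i + \<eta>)"
      by (intro sum_mono) auto
    also have "\<dots> = (\<Sum>i<m. f (v i) - f (u i)) + real n * \<eta>" by (simp add: sum.distrib uv)
    also have "(\<Sum>i<m. f (v i) - f (u i)) \<le> (\<Sum>i<m. norm (f (v i) - f (u i)))" by (intro sum_mono) auto
    also have "\<dots> < \<epsilon> / 2" using ac_modulusD[OF * uv(1)] uv(2) len by auto
    also have "real n * \<eta> \<le> \<epsilon> / 2" using e by (simp add: \<eta>_def field_simps)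
    finally show ?thesis by simp
  qed
  then have "ac_modulus (pos_var f a) a b \<epsilon> \<delta>" by (rule ac_modulusI)
  then show "\<exists>\<delta>>0. ac_modulus (pos_var f a) a b \<epsilon> \<delta>" using d by blast
qed

text \<open>F is the positive variation from \<open>a\<close>, and F - f is nondecreasing because
  the increment of \<open>f\<close> over a single interval is one of the sums in the
  supremum.\<close>

lemma abs_cont_on_decompose:
  obtains F G where "abs_cont_on a b F" "abs_cont_on a b G" "mono_on {a..b} F" "mono_on {a..b} G"
    "\<And>t. f t = F t - G t"
proof
  show "abs_cont_on a b (pos_var f a)" by (rule abs_cont_on_pos_var)
  then show "abs_cont_on a b (\<lambda>t. pos_var f a t - f t)" using ac by (rule abs_cont_on_diff)
  show "mono_on {a..b} (pos_var f a)"
  proof (rule mono_onI)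
    fix r s assume "r \<in> {a..b}" "s \<in> {a..b}" "r \<le> s"
    then show "pos_var f a r \<le> pos_var f a s"
      using pos_var_diff_ge[of r s 0] incr_sums_zero by auto
  qed
  show "mono_on {a..b} (\<lambda>t. pos_var f a t - f t)"
  proof (rule mono_onI)
    fix r s assume "r \<in> {a..b}" "s \<in> {a..b}" "r \<le> s"
    then show "pos_var f a r - f r \<le> pos_var f a s - f s"
      using pos_var_diff_ge[of r s "f s - f r"] incr_sums_single[of r s f] by auto
  qed
qed simp

end


section \<open>The Stieltjes measure of a monotone absolutely continuous function and its
  density\<close>

definition clamp_fun :: "real \<Rightarrow> real \<Rightarrow> (real \<Rightarrow> real) \<Rightarrow> real \<Rightarrow> real" where
  "clamp_fun a b f t = f (max a (min b t))"

context
  fixes f :: "real \<Rightarrow> real" and a b :: real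
  assumes ac: "abs_cont_on a b f" and mono: "mono_on {a..b} f" and ab: "a \<le> b"
begin

lemma clamp_fun_mono: "x \<le> y \<Longrightarrow> clamp_fun a b f x \<le> clamp_fun a b f y"
  unfolding clamp_fun_def using ab by (intro mono_onD[OF mono]) auto

lemma clamp_fun_continuous: "continuous_on UNIV (clamp_fun a b f)"
proof -
  have "continuous_on UNIV (f \<circ> (\<lambda>t. max a (min b t)))"
  proof (rule continuous_on_compose)
    show "continuous_on UNIV (\<lambda>t. max a (min b t))" by (intro continuous_intros)
    show "continuous_on (range (\<lambda>t. max a (min b t))) f"
      by (rule continuous_on_subset[OF abs_cont_on_imp_continuous[OF ac]]) (use ab in auto)
  qed
  then show ?thesis by (simp add: clamp_fun_def[abs_def] o_def)
qed

text \<open>\<open>interval_measure\<close> takes a nondecreasing right-continuous function on the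
  whole line; continuing \<open>f\<close> by its end values provides one and puts no mass outside
  {a..b}.\<close>

lemma emeasure_clamp_Ioc:
  "s \<le> t \<Longrightarrow> emeasure (interval_measure (clamp_fun a b f)) {s<..t} = ennreal (clamp_fun a b f t - clamp_fun a b f s)"
proof (rule emeasure_interval_measure_Ioc)
  show "continuous (at_right a') (clamp_fun a b f)" for a'
    using clamp_fun_continuous continuous_on_eq_continuous_within
    by (metis UNIV_I continuous_within_subset subset_UNIV)
qed (use clamp_fun_mono in auto)

lemma emeasure_clamp_finite: "emeasure (interval_measure (clamp_fun a b f)) UNIV \<noteq> \<infinity>"
proof -
  let ?\<mu> = "interval_measure (clamp_fun a b f)"
  have U: "(\<Union>n::nat. {- real n<..real n}) = UNIV"
  proof -
    have "\<exists>n::nat. - real n < x \<and> x \<le> real n" for x :: real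
    proof -
      obtain n :: nat where "\<bar>x\<bar> < real n" using reals_Archimedean2 by blast
      then show ?thesis by (intro exI[of _ n]) auto
    qed
    then show ?thesis by auto
  qed
  have 1: "(SUP n::nat. emeasure ?\<mu> {- real n<..real n}) = emeasure ?\<mu> (\<Union>n::nat. {- real n<..real n})"
    by (rule SUP_emeasure_incseq) (auto simp: incseq_def)
  have 2: "emeasure ?\<mu> {- real n<..real n} \<le> ennreal (f b - f a)" for n :: nat
  proof -
    have "clamp_fun a b f (real n) \<le> f b" "f a \<le> clamp_fun a b f (- real n)"
      unfolding clamp_fun_def using ab by (auto intro!: mono_onD[OF mono])
    then show ?thesis by (subst emeasure_clamp_Ioc) (auto intro!: ennreal_leI)
  qed
  have "emeasure ?\<mu> UNIV \<le> ennreal (f b - f a)"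
    unfolding 1[unfolded U, symmetric] by (rule SUP_least) (rule 2)
  then show ?thesis by (auto simp: top_unique)
qed

text \<open>A compact null set is covered by the cells of a grid finer than its distance to the complement
  of an open neighbourhood \<open>U\<close> of small measure; the cells that meet it lie in \<open>U\<close>.\<close>

lemma emeasure_clamp_null:
  assumes N: "N \<in> null_sets lborel"
  shows "emeasure (interval_measure (clamp_fun a b f)) N = 0"
proof -
  let ?F = "clamp_fun a b f"
  let ?\<mu> = "interval_measure ?F"
  have le: "emeasure ?\<mu> K \<le> ennreal \<epsilon>" if K: "K \<subseteq> N" "compact K" and e: "0 < \<epsilon>" for K \<epsilon>
  proof -
    obtain \<delta> where d: "0 < \<delta>" and dd: "ac_modulus f a b \<epsilon> \<delta>"
      using abs_cont_on_modulus[OF ac e] by blast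
    \<comment> \<open>Clamping the endpoints to {a..b} keeps intervals nonoverlapping and does not
      lengthen them, so the modulus of \<open>f\<close> serves for families anywhere on the
      line.\<close>
    have *: "(\<Sum>i<n. norm (?F (v i) - ?F (u i))) < \<epsilon>"
      if no: "nonoverlap s t {..<n} u v" and len: "(\<Sum>i<n. v i - u i) < \<delta>"
      for n :: nat and u v :: "nat \<Rightarrow> real" and s t
    proof -
      let ?c = "\<lambda>t. max a (min b t)"
      have ui: "u i \<le> v i" if "i < n" for i using no that by (simp add: nonoverlap_def)
      have "nonoverlap a b {..<n} (\<lambda>i. ?c (u i)) (\<lambda>i. ?c (v i))"
        unfolding nonoverlap_def
      proof (intro conjI ballI impI)
        fix i j assume "i \<in> {..<n}" "j \<in> {..<n}" "i \<noteq> j"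
        then have "v i \<le> u j \<or> v j \<le> u i" using no by (simp add: nonoverlap_def)
        then show "?c (v i) \<le> ?c (u j) \<or> ?c (v j) \<le> ?c (u i)" by linarith
      next
        fix i assume "i \<in> {..<n}"
        then show "?c (u i) \<le> ?c (v i)" using ui[of i] by auto
      qed (use ab in auto)
      moreover have "(\<Sum>i<n. ?c (v i) - ?c (u i)) \<le> (\<Sum>i<n. v i - u i)"
      proof (rule sum_mono)
        fix i assume "i \<in> {..<n}"
        then show "?c (v i) - ?c (u i) \<le> v i - u i" using ui[of i] by auto
      qed
      ultimately show ?thesis using ac_modulusD[OF dd] len unfolding clamp_fun_def by force
    qed
    have "K \<in> null_sets lborel"
      by (rule null_sets_subset[OF N _ K(1)]) (use K in \<open>simp add: borel_compact\<close>)
    then have Knull: "K \<in> null_sets lebesgue" by (rule null_sets_completionI)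
    obtain U where U: "open U" "K \<subseteq> U" "(U - K) \<in> lmeasurable" "emeasure lebesgue (U - K) < ennreal \<delta>"
      using sets_lebesgue_outer_open[of K \<delta>] Knull d by (auto simp: null_sets_def)
    have "emeasure lebesgue U = emeasure lebesgue (U - K)"
      using emeasure_Diff_null_set[OF Knull, of U] U(1) by (simp add: borel_open)
    then have U': "emeasure lborel U < ennreal \<delta>" using U by (simp add: borel_open)
    have Umeas: "U \<in> fmeasurable lborel" using U' U(1) by (intro fmeasurableI) (auto simp: borel_open intro: less_trans)
    have mU: "measure lborel U < \<delta>"
      using U' d unfolding measure_def by (metis enn2real_less_iff ennreal_less_zero_iff Umeas fmeasurableD2 less_top top.not_eq_extremum)
    obtain h where h: "0 < h" "(\<Union>x\<in>K. ball x h) \<subseteq> U"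
      using compact_subset_open_imp_ball_epsilon_subset[OF K(2) U(1,2)] by blast
    obtain Z0 where Z0: "\<And>x. x \<in> K \<Longrightarrow> norm x \<le> Z0"
      using compact_imp_bounded[OF K(2)] by (auto simp: bounded_iff)
    define Z where "Z = \<bar>Z0\<bar> + 1"
    have Z: "0 < Z" "\<And>x. x \<in> K \<Longrightarrow> \<bar>x\<bar> < Z" using Z0 by (force simp: Z_def)+
    obtain n :: nat where n: "2 * Z / h < real n" using reals_Archimedean2 by blast
    then have npos: "0 < n" using Z h by (metis divide_pos_pos gr0I less_asym mult_pos_pos of_nat_0 zero_less_numeral)
    define d' where "d' = 2 * Z / real n"
    have d': "0 < d'" "d' < h" using n npos Z h by (auto simp: d'_def field_simps)
    define u where "u i = - Z + real i * d'" for i :: nat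
    define I where "I = {i. i < n \<and> {u i<..u (Suc i)} \<inter> K \<noteq> {}}"
    have usuc: "u (Suc i) = u i + d'" for i by (simp add: u_def algebra_simps)
    have umono: "u i \<le> u j" if "i \<le> j" for i j
      using that d' by (simp add: u_def)
    have un: "u n = Z" using npos by (simp add: u_def d'_def)
    have no: "nonoverlap (- Z) Z I u (\<lambda>i. u (Suc i))"
      unfolding nonoverlap_def
    proof (intro conjI ballI impI)
      show "finite I" unfolding I_def by auto
      fix i assume "i \<in> I"
      then have "i < n" by (auto simp: I_def)
      show "- Z \<le> u i" using umono[of 0 i] by (simp add: u_def)
      show "u i \<le> u (Suc i)" by (rule umono) simp
      show "u (Suc i) \<le> Z" using umono[of "Suc i" n] un \<open>i < n\<close> by simp
    next
      fix i j assume "i \<in> I" "j \<in> I" "i \<noteq> j"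
      then show "u (Suc i) \<le> u j \<or> u (Suc j) \<le> u i"
        by (metis umono Suc_leI linorder_neqE_nat)
    qed
    have sub: "{u i<..u (Suc i)} \<subseteq> U" if i: "i \<in> I" for i
    proof
      fix y assume y: "y \<in> {u i<..u (Suc i)}"
      obtain x where x: "x \<in> K" "x \<in> {u i<..u (Suc i)}" using i unfolding I_def by blast
      then have "dist x y < h" using y d' usuc[of i] by (auto simp: dist_real_def)
      then show "y \<in> U" using h x by (auto simp: ball_def)
    qed
    have cover: "K \<subseteq> (\<Union>i\<in>I. {u i<..u (Suc i)})"
    proof
      fix x assume x: "x \<in> K"
      have xb: "- Z < x" "x \<le> u n" using Z(2)[OF x] un by auto
      \<comment> \<open>Cells are open on the left, so x lies in the cell with the least right
        endpoint not below x; for the first cell this uses - Z < x.\<close>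
      define i where "i = (LEAST i. x \<le> u (Suc i))"
      have ex: "x \<le> u (Suc (n - 1))" using xb npos by simp
      have 1: "x \<le> u (Suc i)" unfolding i_def using ex by (rule LeastI)
      have 2: "i \<le> n - 1" unfolding i_def using ex by (rule Least_le)
      have 3: "u i < x"
      proof (cases i)
        case 0 then show ?thesis using xb by (simp add: u_def)
      next
        case (Suc j)
        then have "\<not> x \<le> u (Suc j)" unfolding i_def by (metis i_def lessI not_less_Least Suc)
        then show ?thesis using Suc by simp
      qed
      have "i \<in> I" using 1 2 3 x npos by (auto simp: I_def)
      then show "x \<in> (\<Union>i\<in>I. {u i<..u (Suc i)})" using 1 3 by auto
    qed
    have finI: "finite I" using no by (simp add: nonoverlap_def)
    obtain m and u' v' :: "nat \<Rightarrow> real" where uv: "nonoverlap (- Z) Z {..<m} u' v'"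
      and sums: "\<And>g :: real \<Rightarrow> real \<Rightarrow> real. (\<Sum>i<m. g (u' i) (v' i)) = (\<Sum>i\<in>I. g (u i) (u (Suc i)))"
      using nonoverlap_reindex_nat[OF no] by metis
    have "(\<Sum>i<m. v' i - u' i) \<le> measure lborel U"
      unfolding sums[of "\<lambda>x y. y - x"] by (rule nonoverlap_sum_le_measure[OF no sub Umeas])
    then have small: "(\<Sum>i\<in>I. norm (?F (u (Suc i)) - ?F (u i))) < \<epsilon>"
      using *[OF uv] mU sums[of "\<lambda>x y. norm (?F y - ?F x)"] by simp
    have "emeasure ?\<mu> K \<le> emeasure ?\<mu> (\<Union>i\<in>I. {u i<..u (Suc i)})"
      by (rule emeasure_mono[OF cover]) auto
    also have "\<dots> \<le> (\<Sum>i\<in>I. emeasure ?\<mu> {u i<..u (Suc i)})"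
      by (rule emeasure_subadditive_finite) (auto simp: finI)
    also have "\<dots> = (\<Sum>i\<in>I. ennreal (?F (u (Suc i)) - ?F (u i)))"
      by (intro sum.cong emeasure_clamp_Ioc umono) auto
    also have "\<dots> = ennreal (\<Sum>i\<in>I. ?F (u (Suc i)) - ?F (u i))"
      by (rule sum_ennreal) (simp add: clamp_fun_mono umono)
    also have "\<dots> \<le> ennreal (\<Sum>i\<in>I. norm (?F (u (Suc i)) - ?F (u i)))"
      by (intro ennreal_leI sum_mono) auto
    also have "\<dots> \<le> ennreal \<epsilon>" using small by (intro ennreal_leI) simp
    finally show ?thesis .
  qed
  have zero: "emeasure ?\<mu> K = 0" if "K \<subseteq> N" "compact K" for K
  proof (rule ccontr)
    assume "emeasure ?\<mu> K \<noteq> 0"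
    then have pos: "0 < emeasure ?\<mu> K" by (simp add: zero_less_iff_neq_zero)
    have lt: "emeasure ?\<mu> K < \<infinity>" using le[OF that, of 1] by (simp add: le_less_trans)
    obtain r where r: "emeasure ?\<mu> K = ennreal r" "0 < r"
      using lt pos by (cases "emeasure ?\<mu> K") auto
    then show False using le[OF that, of "r/2"] by (simp add: ennreal_le_iff)
  qed
  \<comment> \<open>A finite Borel measure is inner regular, so N is null once its compact subsets
    are. Here the finiteness of the total mass enters.\<close>
  have "emeasure ?\<mu> N = (SUP K \<in> {K. K \<subseteq> N \<and> compact K}. emeasure ?\<mu> K)"
    by (rule inner_regular) (use emeasure_clamp_finite N in auto)
  also have "\<dots> = (SUP K \<in> {K. K \<subseteq> N \<and> compact K}. 0)"
    by (rule SUP_cong) (use zero in auto)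
  also have "\<dots> = 0" by (simp add: SUP_constant bot_ennreal)
  finally show ?thesis .
qed

text \<open>The density is the Radon-Nikodym derivative of the Stieltjes measure. Its values lie in
  [0, \<infinity>], and finite total mass makes it finite almost everywhere, so
  \<open>enn2real\<close> changes it on a null set only.\<close>

lemma abs_cont_on_mono_density:
  "\<exists>g :: real \<Rightarrow> real. integrable lborel g \<and>
     (\<forall>s t. a \<le> s \<longrightarrow> s \<le> t \<longrightarrow> t \<le> b \<longrightarrow> f t - f s = integral {s..t} g)"
proof -
  let ?F = "clamp_fun a b f"
  let ?\<mu> = "interval_measure ?F"
  have "absolutely_continuous lborel ?\<mu>"
    unfolding absolutely_continuous_def using emeasure_clamp_null by (auto simp: null_sets_def)
  then obtain g0 :: "real \<Rightarrow> ennreal" where g0: "g0 \<in> borel_measurable lborel" and dens: "density lborel g0 = ?\<mu>"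
    using sigma_finite_measure.Radon_Nikodym[OF sigma_finite_lborel, of ?\<mu>] by auto
  have tot: "(\<integral>\<^sup>+x. g0 x \<partial>lborel) \<noteq> \<infinity>"
    using emeasure_clamp_finite emeasure_density[OF g0, of UNIV] unfolding dens by simp
  then have fin: "AE x in lborel. g0 x \<noteq> \<infinity>" using nn_integral_PInf_AE[OF g0] by auto
  define g where "g x = enn2real (g0 x)" for x
  have gm: "g \<in> borel_measurable lborel" using g0 unfolding g_def[abs_def] by measurable
  have AEg: "AE x in lborel. ennreal (g x) = g0 x"
    using fin by eventually_elim (simp add: g_def less_top)
  have int: "integrable lborel g"
  proof (rule integrableI_nonneg[OF gm])
    show "AE x in lborel. 0 \<le> g x" by (simp add: g_def)
    have "(\<integral>\<^sup>+x. g x \<partial>lborel) = (\<integral>\<^sup>+x. g0 x \<partial>lborel)" using AEg by (rule nn_integral_cong_AE)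
    then show "(\<integral>\<^sup>+x. g x \<partial>lborel) < \<infinity>" using tot by (simp add: less_top)
  qed
  have "f t - f s = integral {s..t} g" if "a \<le> s" "s \<le> t" "t \<le> b" for s t
  proof -
    have ff: "?F t = f t" "?F s = f s" using that by (auto simp: clamp_fun_def)
    have nn: "0 \<le> f t - f s" using clamp_fun_mono[OF that(2)] ff by simp
    have "ennreal (f t - f s) = emeasure ?\<mu> {s..t}"
      using emeasure_interval_measure_Icc[OF that(2) clamp_fun_mono clamp_fun_continuous] ff by simp
    also have "\<dots> = (\<integral>\<^sup>+x. g0 x * indicator {s..t} x \<partial>lborel)"
      unfolding dens[symmetric] by (rule emeasure_density[OF g0]) simp
    also have "\<dots> = (\<integral>\<^sup>+x. ennreal (indicator {s..t} x *\<^sub>R g x) \<partial>lborel)"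
    proof (rule nn_integral_cong_AE)
      show "AE x in lborel. g0 x * indicator {s..t} x = ennreal (indicator {s..t} x *\<^sub>R g x)"
        using AEg by eventually_elim (auto simp: indicator_def)
    qed
    also have "\<dots> = ennreal (\<integral>x. indicator {s..t} x *\<^sub>R g x \<partial>lborel)"
    proof (rule nn_integral_eq_integral)
      show "integrable lborel (\<lambda>x. indicator {s..t} x *\<^sub>R g x)"
        by (rule integrable_mult_indicator[OF _ int]) simp
    qed (simp add: g_def)
    finally have "f t - f s = (\<integral>x. indicator {s..t} x *\<^sub>R g x \<partial>lborel)"
      using nn by (simp add: g_def integral_nonneg_AE)
    also have "\<dots> = integral {s..t} g"
      using set_borel_integral_eq_integral(2)[of "{s..t}" g] integrable_mult_indicator[OF _ int, of "{s..t}"]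
      by (simp add: set_integrable_def set_lebesgue_integral_def)
    finally show ?thesis .
  qed
  then show ?thesis using int by blast
qed

end


section \<open>Indefinite integrals, their derivatives and the fundamental theorem of
  calculus\<close>

lemma integral_eq_integral_indicator_Ioc:
  fixes f :: "real \<Rightarrow> 'a::euclidean_space"
  assumes f: "integrable (lebesgue_on {a..b}) f" and uv: "a \<le> u" "u \<le> v" "v \<le> b"
  shows "integral {u..v} f = (\<integral>t. indicator {u<..v} t *\<^sub>R f t \<partial>lebesgue_on {a..b})"
proof -
  have fi: "integrable lebesgue (\<lambda>t. indicator {a..b} t *\<^sub>R f t)"
    using f by (subst (asm) integrable_restrict_space) auto
  have eq: "indicator {u..v} t *\<^sub>R f t = indicator {u..v} t *\<^sub>R (indicator {a..b} t *\<^sub>R f t)" for t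
    using uv by (auto simp: indicator_def)
  have "set_integrable lebesgue {u..v} f"
    unfolding set_integrable_def eq by (rule integrable_mult_indicator[OF _ fi]) simp
  then have "integral {u..v} f = (LINT t:{u..v}|lebesgue. f t)"
    using set_lebesgue_integral_eq_integral(2) by metis
  also have "\<dots> = (\<integral>t. indicator {a..b} t *\<^sub>R (indicator {u<..v} t *\<^sub>R f t) \<partial>lebesgue)"
    unfolding set_lebesgue_integral_def
  proof (rule integral_cong_AE)
    have "AE t in lebesgue. t \<noteq> u"
      by (rule AE_completion) (rule AE_lborel_singleton)
    then show "AE t in lebesgue. indicator {u..v} t *\<^sub>R f t = indicator {a..b} t *\<^sub>R (indicator {u<..v} t *\<^sub>R f t)"
      by eventually_elim (use uv in \<open>auto simp: indicator_def\<close>)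
    show "(\<lambda>t. indicator {u..v} t *\<^sub>R f t) \<in> borel_measurable lebesgue"
      unfolding eq by (rule borel_measurable_integrable[OF integrable_mult_indicator[OF _ fi]]) simp
    have eq2: "indicator {a..b} t *\<^sub>R (indicator {u<..v} t *\<^sub>R f t) = indicator {u<..v} t *\<^sub>R (indicator {a..b} t *\<^sub>R f t)" for t
      by simp
    show "(\<lambda>t. indicator {a..b} t *\<^sub>R (indicator {u<..v} t *\<^sub>R f t)) \<in> borel_measurable lebesgue"
      unfolding eq2 by (rule borel_measurable_integrable[OF integrable_mult_indicator[OF _ fi]]) simp
  qed
  also have "\<dots> = (\<integral>t. indicator {u<..v} t *\<^sub>R f t \<partial>lebesgue_on {a..b})"
    by (subst integral_restrict_space) auto
  finally show ?thesis .
qed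

text \<open>For large k the integral of m - min m k is small, whatever the family, and the bounded
  remainder contributes at most k times the total length. Besides indefinite integrals this covers
  limits of trajectories, whose increments inherit such a bound.\<close>

lemma abs_cont_on_integral_bound:
  fixes m :: "real \<Rightarrow> real"
  assumes m: "integrable (lebesgue_on {a..b}) m" and m0: "\<And>t. t \<in> {a..b} \<Longrightarrow> 0 \<le> m t"
    and x: "\<And>s t. a \<le> s \<Longrightarrow> s \<le> t \<Longrightarrow> t \<le> b \<Longrightarrow> norm (x t - x s) \<le> integral {s..t} m"
  shows "abs_cont_on a b x"
proof (rule abs_cont_onI)
  fix \<epsilon> :: real assume e: "0 < \<epsilon>"
  let ?M = "lebesgue_on {a..b}"
  have mk: "integrable ?M (\<lambda>t. min (m t) (real k))" for k :: nat
    by (rule Bochner_Integration.integrable_bound[OF m]) (use m0 borel_measurable_integrable[OF m] in \<open>auto intro!: AE_I2\<close>)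
  have "(\<lambda>k. \<integral>t. m t - min (m t) (real k) \<partial>?M) \<longlonglongrightarrow> (\<integral>t. 0 \<partial>?M)"
  proof (rule integral_dominated_convergence[where w = m])
    show "AE t in ?M. (\<lambda>k. m t - min (m t) (real k)) \<longlonglongrightarrow> 0"
    proof (rule AE_I2)
      fix t
      obtain k0 :: nat where "m t \<le> real k0" using real_arch_simple by blast
      then have "eventually (\<lambda>k. m t - min (m t) (real k) = 0) sequentially"
        unfolding eventually_sequentially by (intro exI[of _ k0]) auto
      then show "(\<lambda>k. m t - min (m t) (real k)) \<longlonglongrightarrow> 0" by (rule tendsto_eventually)
    qed
  qed (use m0 borel_measurable_integrable[OF m] m in \<open>auto intro!: AE_I2\<close>)
  then have "eventually (\<lambda>k. (\<integral>t. m t - min (m t) (real k) \<partial>?M) < \<epsilon> / 2) sequentially"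
    using e by (intro order_tendstoD) auto
  then obtain k :: nat where k: "(\<integral>t. m t - min (m t) (real k) \<partial>?M) < \<epsilon> / 2"
    by (auto simp: eventually_sequentially)
  have "(\<Sum>i<n. norm (x (v i) - x (u i))) < \<epsilon>"
    if no: "nonoverlap a b {..<n} u v" and len: "(\<Sum>i<n. v i - u i) < \<epsilon> / (2 * (real k + 1))"
    for n and u v :: "nat \<Rightarrow> real"
  proof -
    have uv: "a \<le> u i" "u i \<le> v i" "v i \<le> b" if "i < n" for i using no that by (simp_all add: nonoverlap_def)
    have disj: "disjoint_family_on (\<lambda>i. {u i<..v i}) {..<n}"
      unfolding disjoint_family_on_def
    proof (intro ballI impI)
      fix i j assume "i \<in> {..<n}" "j \<in> {..<n}" "i \<noteq> j"
      then have "v i \<le> u j \<or> v j \<le> u i" using no by (simp add: nonoverlap_def)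
      then show "{u i<..v i} \<inter> {u j<..v j} = {}" by auto
    qed
    have int1: "integrable ?M (\<lambda>t. indicator {u i<..v i} t *\<^sub>R m t)" if "i < n" for i
      using that uv[OF that] by (intro integrable_mult_indicator m) (auto simp: sets_restrict_space_iff)
    have sets: "{u i<..v i} \<in> sets ?M" if "i < n" for i
      using that uv[OF that] by (auto simp: sets_restrict_space_iff)
    have len_i: "(\<integral>t. indicator {u i<..v i} t \<partial>?M) = v i - u i" if "i < n" for i
    proof -
      have "measure ?M {u i<..v i} = v i - u i"
        using uv[OF that] by (subst measure_restrict_space) auto
      moreover have "{u i<..v i} \<inter> {a..b} = {u i<..v i}" using uv[OF that] by auto
      ultimately show ?thesis by simp
    qed
    have inti: "integrable ?M (\<lambda>t. indicator {u i<..v i} t :: real)" if "i < n" for i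
      using sets[OF that] uv[OF that]
      by (intro integrable_real_indicator) (simp, subst emeasure_restrict_space, auto)
    have "(\<Sum>i<n. norm (x (v i) - x (u i))) \<le> (\<Sum>i<n. integral {u i..v i} m)"
      using uv by (intro sum_mono x) auto
    also have "\<dots> = (\<Sum>i<n. \<integral>t. indicator {u i<..v i} t *\<^sub>R m t \<partial>?M)"
      using uv by (intro sum.cong integral_eq_integral_indicator_Ioc[OF m]) auto
    also have "\<dots> = (\<integral>t. (\<Sum>i<n. indicator {u i<..v i} t *\<^sub>R m t) \<partial>?M)"
      using int1 by (intro Bochner_Integration.integral_sum[symmetric]) auto
    also have "\<dots> \<le> (\<integral>t. (m t - min (m t) (real k)) + (\<Sum>i<n. real k * indicator {u i<..v i} t) \<partial>?M)"
    proof (rule integral_mono)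
      show "integrable ?M (\<lambda>t. \<Sum>i<n. indicator {u i<..v i} t *\<^sub>R m t)"
        using int1 by (intro Bochner_Integration.integrable_sum) auto
      show "integrable ?M (\<lambda>t. (m t - min (m t) (real k)) + (\<Sum>i<n. real k * indicator {u i<..v i} t))"
        using inti m mk by (intro Bochner_Integration.integrable_add Bochner_Integration.integrable_diff
             Bochner_Integration.integrable_sum integrable_mult_right) auto
      fix t assume "t \<in> space ?M"
      then have mt: "0 \<le> m t" using m0 by simp
      show "(\<Sum>i<n. indicator {u i<..v i} t *\<^sub>R m t) \<le> (m t - min (m t) (real k)) + (\<Sum>i<n. real k * indicator {u i<..v i} t)"
      proof -
        \<comment> \<open>The intervals are disjoint, so the sum of indicators is at most 1, and the
          claim reduces to m \<le> (m - min m k) + k on their union.\<close>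
        have ind: "(\<Sum>i<n. indicator {u i<..v i} t :: real) = indicator (\<Union>i<n. {u i<..v i}) t"
          by (rule indicator_UN_disjoint[OF _ disj, symmetric]) simp
        show ?thesis
          unfolding scaleR_sum_left[symmetric] sum_distrib_left[symmetric] ind using mt by (auto simp: indicator_def)
      qed
    qed
    also have "\<dots> = (\<integral>t. m t - min (m t) (real k) \<partial>?M) + (\<integral>t. (\<Sum>i<n. real k * indicator {u i<..v i} t) \<partial>?M)"
      using inti m mk by (intro Bochner_Integration.integral_add Bochner_Integration.integrable_diff
             Bochner_Integration.integrable_sum integrable_mult_right) auto
    also have "(\<integral>t. (\<Sum>i<n. real k * indicator {u i<..v i} t) \<partial>?M) = (\<Sum>i<n. \<integral>t. real k * indicator {u i<..v i} t \<partial>?M)"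
      using inti by (intro Bochner_Integration.integral_sum integrable_mult_right) auto
    also have "\<dots> = (\<Sum>i<n. real k * (v i - u i))"
      using inti len_i by (intro sum.cong) auto
    also have "\<dots> = real k * (\<Sum>i<n. v i - u i)" by (simp add: sum_distrib_left)
    also have "\<dots> \<le> real k * (\<epsilon> / (2 * (real k + 1)))" using len by (intro mult_left_mono) auto
    also have "\<dots> \<le> \<epsilon> / 2" using e by (simp add: field_simps)
    finally show ?thesis using k by simp
  qed
  then have "ac_modulus x a b \<epsilon> (\<epsilon> / (2 * (real k + 1)))" by (rule ac_modulusI)
  moreover have "0 < \<epsilon> / (2 * (real k + 1))" using e by simp
  ultimately show "\<exists>\<delta>>0. ac_modulus x a b \<epsilon> \<delta>" by blast
qed

text \<open>\<open>integrable_ccontinuous_explicit\<close> controls the averages over intervals to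
  the right of almost every point. Applied to the reflected function it controls those to the left,
  and both together give a two-sided derivative.\<close>

lemma AE_has_vector_derivative_indefinite_integral:
  fixes g :: "real \<Rightarrow> 'a::euclidean_space"
  assumes g: "integrable (lebesgue_on {a..b}) g"
  shows "AE t in lebesgue_on {a..b}. ((\<lambda>t. integral {a..t} g) has_vector_derivative g t) (at t)"
proof -
  \<comment> \<open>The extension by zero is integrable on every interval of the line, as the
    differentiation theorem asks.\<close>
  define G where "G t = (if t \<in> {a..b} then g t else 0)" for t
  have gi: "g integrable_on {a..b}" by (rule integrable_on_lebesgue_on[OF g]) simp
  have "G integrable_on UNIV" unfolding G_def[abs_def] using gi by (simp only: Henstock_Kurzweil_Integration.integrable_restrict_UNIV)
  then have Gi: "G integrable_on cbox u v" for u v by (rule integrable_on_subcbox) simp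
  have Gi': "(\<lambda>t. G (- t)) integrable_on cbox u v" for u v
    using Gi[of "-v" "-u"] by (metis integrable_reflect minus_minus)
  obtain N where N: "negligible N" and right: "\<And>x e. x \<notin> N \<Longrightarrow> 0 < e \<Longrightarrow>
     \<exists>d>0. \<forall>h. 0 < h \<and> h < d \<longrightarrow> norm (integral (cbox x (x + h *\<^sub>R One)) G /\<^sub>R h ^ DIM(real) - G x) < e"
    using integrable_ccontinuous_explicit[of G] Gi by metis
  obtain N' where N': "negligible N'" and left: "\<And>x e. x \<notin> N' \<Longrightarrow> 0 < e \<Longrightarrow>
     \<exists>d>0. \<forall>h. 0 < h \<and> h < d \<longrightarrow> norm (integral (cbox x (x + h *\<^sub>R One)) (\<lambda>t. G (- t)) /\<^sub>R h ^ DIM(real) - G (- x)) < e"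
    using integrable_ccontinuous_explicit[of "\<lambda>t. G (- t)"] Gi' by metis
  have "negligible (uminus ` N')"
    by (rule negligible_differentiable_image_negligible[OF _ N'])
       (auto intro!: linear_imp_differentiable_on simp: linear_uminus)
  then have neg: "negligible (N \<union> uminus ` N' \<union> {a, b})"
    using N by (intro negligible_Un) auto
  have der: "((\<lambda>t. integral {a..t} g) has_vector_derivative g t) (at t)"
    if t: "t \<in> {a..b}" "t \<notin> N \<union> uminus ` N' \<union> {a, b}" for t
  proof -
    have t': "a < t" "t < b" using t by auto
    have tN: "t \<notin> N" "- t \<notin> N'" using t by (auto simp: image_iff)
    have Gt: "G t = g t" using t by (simp add: G_def)
    have comb: "integral {a..v} g - integral {a..u} g = integral {u..v} G" if "a \<le> u" "u \<le> v" "v \<le> b" for u v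
    proof -
      have "integral {a..u} g + integral {u..v} g = integral {a..v} g"
        by (rule Henstock_Kurzweil_Integration.integral_combine[OF that(1,2)])
           (rule integrable_on_subinterval[OF gi], use that in auto)
      moreover have "integral {u..v} g = integral {u..v} G"
        by (rule Henstock_Kurzweil_Integration.integral_cong) (use that in \<open>auto simp: G_def\<close>)
      ultimately show ?thesis by (simp add: algebra_simps)
    qed
    show ?thesis
      unfolding has_vector_derivative_def has_derivative_at_alt
    proof (intro conjI allI impI)
      show "bounded_linear (\<lambda>x. x *\<^sub>R g t)" by (rule bounded_linear_scaleR_left)
      fix e :: real assume e: "0 < e"
      obtain d1 where d1: "0 < d1" "\<And>h. 0 < h \<Longrightarrow> h < d1 \<Longrightarrow> norm (integral {t..t + h} G /\<^sub>R h - G t) < e"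
        using right[OF tN(1) e] by auto
      obtain d2 where d2: "0 < d2" "\<And>h. 0 < h \<Longrightarrow> h < d2 \<Longrightarrow> norm (integral {-t..-t + h} (\<lambda>t. G (- t)) /\<^sub>R h - G t) < e"
        using left[OF tN(2) e] by auto
      define d where "d = min (min d1 d2) (min (t - a) (b - t))"
      have dpos: "0 < d" using d1 d2 t' by (simp add: d_def)
      have "norm (integral {a..y} g - integral {a..t} g - (y - t) *\<^sub>R g t) \<le> e * norm (y - t)"
        if y: "norm (y - t) < d" for y
      proof -
        have main: "norm (I - h *\<^sub>R G t) \<le> e * h" if "norm (I /\<^sub>R h - G t) < e" "0 < h" for I h
        proof -
          have "I - h *\<^sub>R G t = h *\<^sub>R (I /\<^sub>R h - G t)" using that(2) by (simp add: algebra_simps)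
          then have "norm (I - h *\<^sub>R G t) = h * norm (I /\<^sub>R h - G t)" using that(2) by simp
          then show ?thesis using that by (simp add: mult.commute)
        qed
        consider "y = t" | "t < y" | "y < t" by linarith
        then show ?thesis
        proof cases
          case 1 then show ?thesis by simp
        next
          case 2
          then have "norm (integral {t..y} G - (y - t) *\<^sub>R G t) \<le> e * (y - t)"
            using y d1(2)[of "y - t"] by (intro main) (auto simp: d_def)
          then show ?thesis using 2 y comb[of t y] t' Gt by (simp add: d_def)
        next
          case 3
          have "integral {-t..-y} (\<lambda>t. G (- t)) = integral {y..t} G" by simp
          then have "norm (integral {y..t} G - (t - y) *\<^sub>R G t) \<le> e * (t - y)"
            using 3 y d2(2)[of "t - y"] by (intro main) (auto simp: d_def)
          moreover have "integral {a..y} g - integral {a..t} g - (y - t) *\<^sub>R g t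
              = - (integral {y..t} G - (t - y) *\<^sub>R G t)"
            using 3 y comb[of y t] t' Gt by (simp add: d_def algebra_simps)
          ultimately show ?thesis using 3 by (simp only: norm_minus_cancel) simp
        qed
      qed
      then show "\<exists>d>0. \<forall>y. norm (y - t) < d \<longrightarrow>
        norm (integral {a..y} g - integral {a..t} g - (y - t) *\<^sub>R g t) \<le> e * norm (y - t)"
        using dpos by blast
    qed
  qed
  have "AE t in lebesgue. t \<notin> N \<union> uminus ` N' \<union> {a, b}"
    using neg by (intro AE_not_in) (simp add: negligible_iff_null_sets)
  then have "AE t in lebesgue. t \<in> {a..b} \<longrightarrow> ((\<lambda>t. integral {a..t} g) has_vector_derivative g t) (at t)"
    by eventually_elim (use der in blast)
  then show ?thesis by (subst AE_restrict_space_iff) auto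
qed


lemma integrable_lebesgue_on_subinterval:
  fixes f :: "real \<Rightarrow> 'a::euclidean_space"
  assumes "integrable (lebesgue_on {a..b}) f" "a \<le> s" "t \<le> b"
  shows "integrable (lebesgue_on {s..t}) f"
proof -
  have "integrable lebesgue (\<lambda>x. indicator {a..b} x *\<^sub>R f x)"
    using assms(1) by (subst (asm) integrable_restrict_space) auto
  then have 1: "integrable lebesgue (\<lambda>x. indicator {s..t} x *\<^sub>R (indicator {a..b} x *\<^sub>R f x))"
    by (rule integrable_mult_indicator[rotated]) simp
  have 2: "indicator {s..t} x *\<^sub>R (indicator {a..b} x *\<^sub>R f x) = indicator {s..t} x *\<^sub>R f x" for x
    using assms(2,3) by (auto simp: indicator_def)
  show ?thesis using 1 unfolding 2 by (subst integrable_restrict_space) auto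
qed

lemma abs_cont_on_real_density:
  fixes f :: "real \<Rightarrow> real"
  assumes ac: "abs_cont_on a b f" and ab: "a \<le> b"
  shows "\<exists>g :: real \<Rightarrow> real. integrable (lebesgue_on {a..b}) g \<and>
     (\<forall>t. a \<le> t \<longrightarrow> t \<le> b \<longrightarrow> f t - f a = integral {a..t} g)"
proof -
  have *: "\<exists>g :: real \<Rightarrow> real. integrable (lebesgue_on {a..b}) g \<and>
     (\<forall>t. a \<le> t \<longrightarrow> t \<le> b \<longrightarrow> F t - F a = integral {a..t} g)"
    if F: "abs_cont_on a b F" "mono_on {a..b} F" for F
  proof -
    obtain g where g: "integrable lborel g" "\<And>s t. a \<le> s \<Longrightarrow> s \<le> t \<Longrightarrow> t \<le> b \<Longrightarrow> F t - F s = integral {s..t} g"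
      using abs_cont_on_mono_density[OF F ab] by blast
    have "integrable lebesgue g" using g(1) by (subst integrable_completion) auto
    then have "integrable (lebesgue_on {a..b}) g"
      by (subst integrable_restrict_space) (use integrable_mult_indicator[of "{a..b}" lebesgue g] in auto)
    then show ?thesis using g(2) by blast
  qed
  obtain F G where FG: "abs_cont_on a b F" "abs_cont_on a b G" "mono_on {a..b} F" "mono_on {a..b} G"
    "\<And>t. f t = F t - G t" using abs_cont_on_decompose[OF ac ab] by metis
  obtain g1 where g1: "integrable (lebesgue_on {a..b}) g1" "\<And>t. a \<le> t \<Longrightarrow> t \<le> b \<Longrightarrow> F t - F a = integral {a..t} g1"
    using *[OF FG(1,3)] by blast
  obtain g2 where g2: "integrable (lebesgue_on {a..b}) g2" "\<And>t. a \<le> t \<Longrightarrow> t \<le> b \<Longrightarrow> G t - G a = integral {a..t} g2"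
    using *[OF FG(2,4)] by blast
  have "f t - f a = integral {a..t} (\<lambda>x. g1 x - g2 x)" if "a \<le> t" "t \<le> b" for t
  proof -
    have "integral {a..t} (\<lambda>x. g1 x - g2 x) = integral {a..t} g1 - integral {a..t} g2"
      using integrable_lebesgue_on_subinterval[OF g1(1) order_refl that(2)]
            integrable_lebesgue_on_subinterval[OF g2(1) order_refl that(2)]
      by (intro Henstock_Kurzweil_Integration.integral_diff integrable_on_lebesgue_on) auto
    then show ?thesis using g1(2)[OF that] g2(2)[OF that] by (simp add: FG(5))
  qed
  then show ?thesis using g1(1) g2(1) by blast
qed

lemma abs_cont_on_density:
  fixes x :: "real \<Rightarrow> 'a::euclidean_space"
  assumes ac: "abs_cont_on a b x" and ab: "a \<le> b"
  shows "\<exists>g :: real \<Rightarrow> 'a. integrable (lebesgue_on {a..b}) g \<and>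
     (\<forall>t. a \<le> t \<longrightarrow> t \<le> b \<longrightarrow> x t = x a + integral {a..t} g)"
proof -
  have "\<exists>g :: real \<Rightarrow> real. integrable (lebesgue_on {a..b}) g \<and>
     (\<forall>t. a \<le> t \<longrightarrow> t \<le> b \<longrightarrow> x t \<bullet> i - x a \<bullet> i = integral {a..t} g)" for i :: 'a
  proof (rule abs_cont_on_real_density[OF _ ab])
    show "abs_cont_on a b (\<lambda>t. x t \<bullet> i)"
    proof (rule abs_cont_on_compose_le[OF ac, of "norm i"])
      show "norm (x t \<bullet> i - x s \<bullet> i) \<le> norm i * norm (x t - x s)" for s t
        using Cauchy_Schwarz_ineq2[of "x t - x s" i] by (simp add: inner_diff_left mult.commute)
    qed simp
  qed
  then obtain g :: "'a \<Rightarrow> real \<Rightarrow> real" where g: "\<And>i. integrable (lebesgue_on {a..b}) (g i)"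
    "\<And>i t. a \<le> t \<Longrightarrow> t \<le> b \<Longrightarrow> x t \<bullet> i - x a \<bullet> i = integral {a..t} (g i)"
    by metis
  have gi: "g i integrable_on {a..t}" if "t \<le> b" for i t
    using integrable_lebesgue_on_subinterval[OF g(1) order_refl that] by (intro integrable_on_lebesgue_on) auto
  have "x t = x a + integral {a..t} (\<lambda>s. \<Sum>i\<in>Basis. g i s *\<^sub>R i)" if t: "a \<le> t" "t \<le> b" for t
  proof -
    have "integral {a..t} (\<lambda>s. \<Sum>i\<in>Basis. g i s *\<^sub>R i) = (\<Sum>i\<in>Basis. integral {a..t} (\<lambda>s. g i s *\<^sub>R i))"
      by (intro integral_sum finite_Basis) (rule integrable_on_scaleR_left[OF gi[OF t(2)]])
    also have "\<dots> = (\<Sum>i\<in>Basis. ((x t - x a) \<bullet> i) *\<^sub>R i)"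
    proof (rule sum.cong[OF refl])
      fix i :: 'a assume "i \<in> Basis"
      have "((\<lambda>s. g i s *\<^sub>R i) has_integral (integral {a..t} (g i) *\<^sub>R i)) {a..t}"
        using has_integral_scaleR_left[OF integrable_integral[OF gi[OF t(2)]]] .
      then show "integral {a..t} (\<lambda>s. g i s *\<^sub>R i) = ((x t - x a) \<bullet> i) *\<^sub>R i"
        using g(2)[OF t] by (simp add: integral_unique inner_diff_left)
    qed
    also have "\<dots> = x t - x a" by (rule euclidean_representation)
    finally show ?thesis by simp
  qed
  moreover have "integrable (lebesgue_on {a..b}) (\<lambda>s. \<Sum>i\<in>Basis. g i s *\<^sub>R i)"
    using g(1) by (intro Bochner_Integration.integrable_sum integrable_scaleR_left) auto
  ultimately show ?thesis by blast
qed

text \<open>Covers t0 = T: there \<open>at a within {a..a}\<close> is trivial and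
  \<open>vector_derivative\<close> carries no information, but the single point is a null
  set.\<close>

lemma AE_lebesgue_on_singleton: "AE t in lebesgue_on {a::real..a}. P t"
proof -
  have "AE t in lebesgue. t \<noteq> a" by (rule AE_completion) (rule AE_lborel_singleton)
  then have "AE t in lebesgue. t \<in> {a..a} \<longrightarrow> P t" by eventually_elim auto
  then show ?thesis by (subst AE_restrict_space_iff) auto
qed

lemma AE_vector_derivative_of_integral:
  fixes x :: "real \<Rightarrow> 'a::euclidean_space"
  assumes g: "integrable (lebesgue_on {a..b}) g"
    and x: "\<And>t. a \<le> t \<Longrightarrow> t \<le> b \<Longrightarrow> x t = x0 + integral {a..t} g"
  shows "AE t in lebesgue_on {a..b}. (x has_vector_derivative g t) (at t within {a..b}) \<and>
    vector_derivative x (at t within {a..b}) = g t"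
proof (cases "a < b")
  case False
  then consider "a = b" | "b < a" by linarith
  then show ?thesis
  proof cases
    case 1 then show ?thesis by (simp only: AE_lebesgue_on_singleton)
  next
    case 2
    then have "{a..b} = {}" by simp
    then show ?thesis by (intro AE_I2) simp
  qed
next
  case True
  show ?thesis
    using AE_has_vector_derivative_indefinite_integral[OF g] AE_space
  proof eventually_elim
    case (elim t)
    then have t: "t \<in> {a..b}" by simp
    have "((\<lambda>t. x0 + integral {a..t} g) has_vector_derivative g t) (at t within {a..b})"
      using elim(1) by (auto intro!: derivative_eq_intros intro: has_vector_derivative_at_within)
    then have d: "(x has_vector_derivative g t) (at t within {a..b})"
      using x t by (subst has_vector_derivative_cong_ev[where g = "\<lambda>t. x0 + integral {a..t} g"])
         (auto intro: eventuallyI)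
    then show ?case using vector_derivative_within_closed_interval[OF True t d] by simp
  qed
qed

context
  fixes x :: "real \<Rightarrow> 'a::euclidean_space" and a b :: real
  assumes ac: "abs_cont_on a b x" and ab: "a \<le> b"
begin

text \<open>Measurability of a derivative defined by choice is not immediate. It agrees almost
  everywhere with the density of x, and completeness of Lebesgue measure carries measurability,
  integrability and the integral formula over.\<close>

lemma abs_cont_on_integrable_vector_derivative:
  "integrable (lebesgue_on {a..b}) (\<lambda>t. vector_derivative x (at t within {a..b}))" (is ?int)
  and abs_cont_on_ftc: "a \<le> s \<Longrightarrow> s \<le> t \<Longrightarrow> t \<le> b \<Longrightarrow>
    x t - x s = integral {s..t} (\<lambda>t. vector_derivative x (at t within {a..b}))"
proof -
  let ?d = "\<lambda>t. vector_derivative x (at t within {a..b})"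
  obtain g where g: "integrable (lebesgue_on {a..b}) g" "\<And>t. a \<le> t \<Longrightarrow> t \<le> b \<Longrightarrow> x t = x a + integral {a..t} g"
    using abs_cont_on_density[OF ac ab] by blast
  have "AE t in lebesgue_on {a..b}. (x has_vector_derivative g t) (at t within {a..b}) \<and> ?d t = g t"
    by (rule AE_vector_derivative_of_integral[OF g(1) g(2)])
  then have AEd: "AE t in lebesgue_on {a..b}. g t = ?d t" by eventually_elim auto
  have AEl: "AE t in lebesgue. t \<in> {a..b} \<longrightarrow> g t = ?d t"
    using AEd by (subst (asm) AE_restrict_space_iff) auto
  then obtain N where N: "N \<in> null_sets lebesgue" "{t \<in> space lebesgue. \<not> (t \<in> {a..b} \<longrightarrow> g t = ?d t)} \<subseteq> N"
    by (auto simp: eventually_ae_filter)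
  have gm: "(\<lambda>t. if t \<in> {a..b} then g t else 0) \<in> borel_measurable lebesgue"
    using borel_measurable_integrable[OF g(1)] by (subst borel_measurable_if) auto
  have "(\<lambda>t. if t \<in> {a..b} then ?d t else 0) \<in> borel_measurable lebesgue"
    by (rule borel_measurable_AE[OF gm]) (use AEl in eventually_elim, auto)
  then have dm: "?d \<in> borel_measurable (lebesgue_on {a..b})"
    by (subst (asm) borel_measurable_if) auto
  show int: ?int
    using Bochner_Integration.integrable_cong_AE[THEN iffD1, OF _ dm AEd g(1)] g(1) by auto
  assume st: "a \<le> s" "s \<le> t" "t \<le> b"
  have gi: "g integrable_on {a..t}"
    using integrable_lebesgue_on_subinterval[OF g(1) order_refl st(3)] by (intro integrable_on_lebesgue_on) auto
  have comb: "integral {a..t} g = integral {a..s} g + integral {s..t} g"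
    by (rule sym, rule Henstock_Kurzweil_Integration.integral_combine[OF st(1,2) gi])
  have "x t - x s = integral {s..t} g" using g(2)[of t] g(2)[of s] st by (simp add: comb)
  also have "\<dots> = integral {s..t} ?d"
  proof (rule integral_spike[of N])
    fix r assume r: "r \<in> {s..t} - N"
    then have "r \<in> {a..b}" using st by auto
    then show "?d r = g r" using N(2) r by auto
  qed (use N in \<open>simp add: negligible_iff_null_sets\<close>)
  finally show "x t - x s = integral {s..t} ?d" .
qed

end

subsection \<open>Bump averages and the Steiner point\<close>


text \<open>The gradient is - 2 z inside the unit ball and 0 outside. Moving a derivative from h to
  this weight leaves the kernel h z * z, and continuity across the sphere leaves no boundary
  term.\<close>

definition bump :: "'b::euclidean_space \<Rightarrow> real" where
  "bump z = max 0 (1 - z \<bullet> z)"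

lemma bump_nonneg: "0 \<le> bump z"
  by (simp add: bump_def)

text \<open>As 1 minus a square of a number in [0, 1] the bump is visibly Lipschitz with constant 2,
  also across the sphere.\<close>

lemma bump_eq: "bump z = 1 - (min 1 (norm z))\<^sup>2"
proof (cases "norm z \<le> 1")
  case True
  then have "z \<bullet> z \<le> 1" by (simp add: dot_square_norm power_le_one)
  then show ?thesis using True by (simp add: bump_def dot_square_norm)
next
  case False
  then have "1 < z \<bullet> z" by (simp add: dot_square_norm)
  then show ?thesis using False by (simp add: bump_def)
qed

lemma bump_outside: "1 \<le> norm z \<Longrightarrow> bump z = 0"
  by (simp add: bump_eq)

lemma bump_lipschitz: "\<bar>bump x - bump y\<bar> \<le> 2 * norm (x - y)"
proof -
  let ?a = "min 1 (norm x)" and ?b = "min 1 (norm y)"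
  have "bump x - bump y = (?b - ?a) * (?a + ?b)"
    by (simp add: bump_eq power2_eq_square algebra_simps)
  then have "\<bar>bump x - bump y\<bar> = \<bar>?b - ?a\<bar> * \<bar>?a + ?b\<bar>" by (simp only: abs_mult)
  also have "\<dots> = \<bar>?a - ?b\<bar> * (?a + ?b)" by (simp add: abs_minus_commute)
  also have "\<dots> \<le> \<bar>?a - ?b\<bar> * 2" by (intro mult_left_mono) auto
  also have "\<bar>?a - ?b\<bar> \<le> \<bar>norm x - norm y\<bar>" by auto
  also have "\<dots> \<le> norm (x - y)" by (rule norm_triangle_ineq3)
  finally show ?thesis by simp
qed

lemma continuous_on_bump: "continuous_on S (bump :: 'b::euclidean_space \<Rightarrow> real)"
  unfolding bump_def[abs_def] by (intro continuous_intros)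

lemma integrable_continuous_on_cball:
  fixes g :: "'b::euclidean_space \<Rightarrow> 'c::euclidean_space"
  assumes "continuous_on UNIV g" "\<And>z. z \<notin> cball 0 r \<Longrightarrow> g z = 0"
  shows "integrable lborel g"
proof -
  have "integrable lborel (\<lambda>z. indicator (cball 0 r) z *\<^sub>R g z)"
    by (rule borel_integrable_compact) (use assms(1) continuous_on_subset in auto)
  moreover have "(\<lambda>z. indicator (cball 0 r) z *\<^sub>R g z) = g"
    using assms(2) by (auto simp: fun_eq_iff indicator_def)
  ultimately show ?thesis by simp
qed

lemma integrable_indicator_ball_continuous:
  fixes g :: "'b::euclidean_space \<Rightarrow> 'c::euclidean_space"
  assumes "continuous_on UNIV g"
  shows "integrable lborel (\<lambda>z. indicator (ball 0 r) z *\<^sub>R g z)"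
proof -
  have "integrable lborel (\<lambda>z. indicator (cball 0 r) z *\<^sub>R g z)"
    by (rule borel_integrable_compact) (use assms continuous_on_subset in auto)
  then have "integrable lborel (\<lambda>z. indicator (ball 0 r) z *\<^sub>R (indicator (cball 0 r) z *\<^sub>R g z))"
    by (rule integrable_mult_indicator[rotated]) simp
  moreover have "(\<lambda>z. indicator (ball 0 r) z *\<^sub>R (indicator (cball 0 r) z *\<^sub>R g z)) = (\<lambda>z. indicator (ball 0 r) z *\<^sub>R g z)"
    by (auto simp: fun_eq_iff indicator_def)
  ultimately show ?thesis by simp
qed

definition bump_mass :: "'b::euclidean_space itself \<Rightarrow> real" where
  "bump_mass TYPE('b) = (\<integral>z. bump (z :: 'b) \<partial>lborel)"

text \<open>For smooth h, integration by parts identifies this with the average of the gradient of h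
  under the weight \<open>bump\<close> of normalized mass; the factor 2 is that of the gradient - 2
  z. The formula needs only values of h.\<close>

definition bump_grad :: "('b::euclidean_space \<Rightarrow> real) \<Rightarrow> 'b" where
  "bump_grad h = (2 / bump_mass TYPE('b)) *\<^sub>R (\<integral>z. indicator (ball 0 1) z *\<^sub>R (h z *\<^sub>R z) \<partial>lborel)"

lemma integrable_bump_mult:
  assumes "continuous_on UNIV g"
  shows "integrable lborel (\<lambda>z. bump z * g z :: real)"
  by (rule integrable_continuous_on_cball[where r = 1])
     (auto intro!: continuous_intros continuous_on_bump assms simp: bump_outside)

lemma bump_mass_pos: "0 < bump_mass TYPE('b::euclidean_space)"
proof -
  have int: "integrable lborel (bump :: 'b \<Rightarrow> real)"
    using integrable_bump_mult[of "\<lambda>_. 1"] by simp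
  have "(\<integral>z. indicator (ball 0 (1/2)) (z :: 'b) * (1/2) \<partial>lborel) \<le> (\<integral>z. bump (z :: 'b) \<partial>lborel)"
  proof (rule Bochner_Integration.integral_mono[OF _ int])
    show "integrable lborel (\<lambda>z::'b. indicator (ball 0 (1/2)) z * (1/2) :: real)"
      by (intro integrable_mult_left integrable_real_indicator) (use emeasure_bounded_finite[of "ball (0::'b) (1/2)"] in auto)
    fix z :: 'b
    show "indicator (ball 0 (1/2)) z * (1/2) \<le> bump z"
    proof (cases "z \<in> ball 0 (1/2)")
      case True
      then have "(norm z)\<^sup>2 \<le> (1/2)\<^sup>2" by (intro power_mono) auto
      then show ?thesis using True by (simp add: bump_def dot_square_norm power2_eq_square)
    qed (simp add: bump_nonneg)
  qed
  moreover have "0 < (\<integral>z. indicator (ball 0 (1/2)) (z :: 'b) * (1/2 :: real) \<partial>lborel)"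
    using content_ball_pos[of "1/2" "0::'b"] by simp
  ultimately show ?thesis unfolding bump_mass_def by linarith
qed

text \<open>The bump average of the difference quotients of \<open>h\<close> in direction \<open>p\<close> equals, by a change of
  variables, the integral of \<open>h\<close> against difference quotients of the bump.\<close>

lemma bump_quotient_tendsto:
  fixes h :: "'b::euclidean_space \<Rightarrow> real"
  assumes h: "continuous_on UNIV h"
  shows "(\<lambda>n. \<integral>z. bump z * ((h (z + p /\<^sub>R Suc n) - h z) * Suc n) \<partial>lborel)
     \<longlonglongrightarrow> bump_mass TYPE('b) * (bump_grad h \<bullet> p)"
proof -
  define q where "q n = p /\<^sub>R real (Suc n)" for n
  have qn: "norm (q n) \<le> norm p" for n
  proof -
    have "norm (q n) = norm p / real (Suc n)" by (simp add: q_def divide_inverse mult.commute)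
    also have "\<dots> \<le> norm p / 1" by (intro divide_left_mono) auto
    finally show ?thesis by simp
  qed
  have q0: "q \<longlonglongrightarrow> 0"
    unfolding q_def[abs_def] using tendsto_scaleR[OF LIMSEQ_inverse_real_of_nat tendsto_const[of p]] by simp
  \<comment> \<open>Outside the ball of radius R both bump z and bump (z - q n) vanish, because norm
    (q n) \<le> norm p.\<close>
  define R where "R = 1 + norm p"
  have eq: "(\<integral>z. bump z * ((h (z + q n) - h z) * Suc n) \<partial>lborel)
      = (\<integral>z. h z * ((bump (z - q n) - bump z) * Suc n) \<partial>lborel)" (is "?L = ?R") for n
  proof -
    have i1: "integrable lborel (\<lambda>z. bump z * h (z + q n))"
      by (rule integrable_bump_mult) (intro continuous_on_compose2[OF h] continuous_intros; simp)
    have i2: "integrable lborel (\<lambda>z. bump z * h z)" by (rule integrable_bump_mult[OF h])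
    have tr: "(\<integral>z. bump z * h (z + q n) \<partial>lborel) = (\<integral>z. bump (z - q n) * h z \<partial>lborel)"
      and i3: "integrable lborel (\<lambda>z. bump (z - q n) * h z)"
    proof -
      have d: "distr lborel borel ((+) (- q n)) = (lborel :: 'b measure)" by (rule lborel_distr_plus)
      have m: "(\<lambda>z. bump z * h (z + q n)) \<in> borel_measurable borel"
        using borel_measurable_integrable[OF i1] by simp
      have "(\<integral>z. bump z * h (z + q n) \<partial>distr lborel borel ((+) (- q n))) = (\<integral>z. bump (- q n + z) * h ((- q n + z) + q n) \<partial>lborel)"
        by (rule integral_distr[OF _ m]) simp
      then show "(\<integral>z. bump z * h (z + q n) \<partial>lborel) = (\<integral>z. bump (z - q n) * h z \<partial>lborel)"
        unfolding d by (simp add: algebra_simps)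
      have "integrable (distr lborel borel ((+) (- q n))) (\<lambda>z. bump z * h (z + q n))" unfolding d by (rule i1)
      then show "integrable lborel (\<lambda>z. bump (z - q n) * h z)"
        by (subst (asm) integrable_distr_eq) (use m in \<open>auto simp: algebra_simps\<close>)
    qed
    have "?L = (\<integral>z. bump z * h (z + q n) - bump z * h z \<partial>lborel) * Suc n"
      by (subst integral_mult_left_zero[symmetric]) (simp add: algebra_simps)
    also have "\<dots> = ((\<integral>z. bump (z - q n) * h z \<partial>lborel) - (\<integral>z. bump z * h z \<partial>lborel)) * Suc n"
      using i1 i2 tr by simp
    also have "\<dots> = (\<integral>z. bump (z - q n) * h z - bump z * h z \<partial>lborel) * Suc n"
      using i2 i3 by simp
    also have "\<dots> = ?R"
      by (subst integral_mult_left_zero[symmetric]) (simp add: algebra_simps)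
    finally show ?thesis .
  qed
  let ?lim = "\<lambda>z. indicator (ball 0 1) z * (2 * (h z * (z \<bullet> p)))"
  have lim: "(\<lambda>n. \<integral>z. h z * ((bump (z - q n) - bump z) * Suc n) \<partial>lborel) \<longlonglongrightarrow> (\<integral>z. ?lim z \<partial>lborel)"
  proof (rule integral_dominated_convergence[where w = "\<lambda>z. indicator (cball 0 R) z *\<^sub>R (\<bar>h z\<bar> * (2 * norm p))"])
    have hb: "h \<in> borel_measurable borel" by (rule borel_measurable_continuous_onI[OF h])
    have bb: "bump \<in> borel_measurable (borel :: 'b measure)" by (rule borel_measurable_continuous_onI[OF continuous_on_bump])
    have "indicator (ball 0 1) \<in> borel_measurable (borel :: 'b measure)" by (rule borel_measurable_indicator) simp
    moreover have "h \<in> borel_measurable lborel" using hb by simp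
    ultimately show "?lim \<in> borel_measurable lborel"
      by (intro borel_measurable_times borel_measurable_inner) simp_all
    show "(\<lambda>z. h z * ((bump (z - q n) - bump z) * Suc n)) \<in> borel_measurable lborel" for n
      using hb bb by measurable
    show "integrable lborel (\<lambda>z. indicator (cball 0 R) z *\<^sub>R (\<bar>h z\<bar> * (2 * norm p)))"
      by (rule borel_integrable_compact) (auto intro!: continuous_intros continuous_on_subset[OF h])
    show "AE z in lborel. norm (h z * ((bump (z - q n) - bump z) * Suc n)) \<le> indicator (cball 0 R) z *\<^sub>R (\<bar>h z\<bar> * (2 * norm p))" for n
    proof (rule AE_I2)
      fix z
      show "norm (h z * ((bump (z - q n) - bump z) * Suc n)) \<le> indicator (cball 0 R) z *\<^sub>R (\<bar>h z\<bar> * (2 * norm p))"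
      proof (cases "z \<in> cball 0 R")
        case True
        have "\<bar>bump (z - q n) - bump z\<bar> \<le> 2 * norm (q n)" using bump_lipschitz[of "z - q n" z] by simp
        then have "\<bar>bump (z - q n) - bump z\<bar> * Suc n \<le> 2 * norm (q n) * Suc n" by (intro mult_right_mono) auto
        also have "\<dots> = 2 * norm p" by (simp add: q_def)
        finally have "\<bar>h z\<bar> * (\<bar>bump (z - q n) - bump z\<bar> * Suc n) \<le> \<bar>h z\<bar> * (2 * norm p)"
          by (intro mult_left_mono) auto
        then show ?thesis using True by (simp add: abs_mult)
      next
        case False
        then have "R < norm z" by simp
        then have "1 \<le> norm z" "1 \<le> norm (z - q n)"
          using qn[of n] norm_triangle_ineq2[of z "q n"] norm_ge_zero[of p] by (auto simp: R_def simp del: norm_ge_zero)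
        then show ?thesis using False by (simp add: bump_outside)
      qed
    qed
    \<comment> \<open>The bump has a kink on the unit sphere, where the quotients may tend to
      another value; the sphere is discarded as a null set.\<close>
    have "negligible (sphere (0::'b) 1)" by (rule negligible_sphere)
    then have "AE z in lebesgue. z \<notin> sphere (0::'b) 1" by (intro AE_not_in) (simp add: negligible_iff_null_sets)
    then have "AE z in lborel. z \<notin> sphere (0::'b) 1" by (simp add: AE_completion_iff)
    then show "AE z in lborel. (\<lambda>n. h z * ((bump (z - q n) - bump z) * Suc n)) \<longlonglongrightarrow> ?lim z"
    proof eventually_elim
      case (elim z)
      have zq: "(\<lambda>n. norm (z - q n)) \<longlonglongrightarrow> norm z" using tendsto_norm[OF tendsto_diff[OF tendsto_const q0]] by simp
      show ?case
      proof (cases "norm z < 1")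
        case True
        have "eventually (\<lambda>n. norm (z - q n) < 1) sequentially" by (rule order_tendstoD(2)[OF zq True])
        then have ev: "eventually (\<lambda>n. (bump (z - q n) - bump z) * Suc n = 2 * (z \<bullet> p) - q n \<bullet> p) sequentially"
        proof eventually_elim
          case (elim n)
          have a: "bump z = 1 - z \<bullet> z" "bump (z - q n) = 1 - (z - q n) \<bullet> (z - q n)"
            using True elim by (auto simp: bump_eq dot_square_norm min_def)
          have b: "z \<bullet> q n * Suc n = z \<bullet> p" "q n \<bullet> q n * Suc n = q n \<bullet> p" by (simp_all add: q_def)
          have "bump (z - q n) - bump z = 2 * (z \<bullet> q n) - q n \<bullet> q n"
            unfolding a by (simp add: inner_diff_left inner_diff_right inner_commute)
          then show ?case using b by (simp only: left_diff_distrib mult.assoc)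
        qed
        have "(\<lambda>n. 2 * (z \<bullet> p) - q n \<bullet> p) \<longlonglongrightarrow> 2 * (z \<bullet> p) - 0 \<bullet> p" by (intro tendsto_intros q0)
        then have "(\<lambda>n. (bump (z - q n) - bump z) * Suc n) \<longlonglongrightarrow> 2 * (z \<bullet> p)"
          using ev by (subst tendsto_cong[OF ev]) simp
        then have "(\<lambda>n. h z * ((bump (z - q n) - bump z) * Suc n)) \<longlonglongrightarrow> h z * (2 * (z \<bullet> p))" by (rule tendsto_mult_left)
        then show ?thesis using True by (simp add: mult.left_commute)
      next
        case False
        then have "1 < norm z" using elim by simp
        then have "eventually (\<lambda>n. 1 < norm (z - q n)) sequentially" by (rule order_tendstoD(1)[OF zq])
        then have "eventually (\<lambda>n. h z * ((bump (z - q n) - bump z) * Suc n) = ?lim z) sequentially"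
          by eventually_elim (use False in \<open>simp add: bump_outside\<close>)
        then show ?thesis by (rule tendsto_eventually)
      qed
    qed
  qed
  have "(\<integral>z. ?lim z \<partial>lborel) = bump_mass TYPE('b) * (bump_grad h \<bullet> p)"
  proof -
    have int: "integrable lborel (\<lambda>z. indicator (ball 0 1) z *\<^sub>R (h z *\<^sub>R z))"
      by (intro integrable_indicator_ball_continuous continuous_intros h)
    have "bump_mass TYPE('b) * (bump_grad h \<bullet> p) = 2 * ((\<integral>z. indicator (ball 0 1) z *\<^sub>R (h z *\<^sub>R z) \<partial>lborel) \<bullet> p)"
      using bump_mass_pos[where 'b = 'b] by (simp add: bump_grad_def)
    also have "\<dots> = 2 * (\<integral>z. (indicator (ball 0 1) z *\<^sub>R (h z *\<^sub>R z)) \<bullet> p \<partial>lborel)"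
      by (simp only: integral_inner_left[OF int])
    also have "\<dots> = (\<integral>z. 2 * ((indicator (ball 0 1) z *\<^sub>R (h z *\<^sub>R z)) \<bullet> p) \<partial>lborel)"
      by (rule integral_mult_right_zero[symmetric])
    also have "\<dots> = (\<integral>z. ?lim z \<partial>lborel)"
      by (intro Bochner_Integration.integral_cong) auto
    finally show ?thesis by simp
  qed
  then show ?thesis using lim unfolding eq[symmetric] unfolding q_def by simp
qed

text \<open>Along the segment from z to z + p the difference quotients of a convex function grow
  with the step, so each is at most h (z + p) - h z. The bound B is asked for on the unit ball,
  where the bump lives.\<close>

lemma bump_grad_le:
  fixes h :: "'b::euclidean_space \<Rightarrow> real"
  assumes h: "convex_on UNIV h" and c: "continuous_on UNIV h"
    and B: "\<And>z. norm z \<le> 1 \<Longrightarrow> h (z + p) - h z \<le> B"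
  shows "bump_grad h \<bullet> p \<le> B"
proof -
  have "(\<integral>z. bump z * ((h (z + p /\<^sub>R Suc n) - h z) * Suc n) \<partial>lborel) \<le> bump_mass TYPE('b) * B" for n
  proof -
    have "(\<integral>z. bump z * ((h (z + p /\<^sub>R Suc n) - h z) * Suc n) \<partial>lborel) \<le> (\<integral>z. bump (z :: 'b) * B \<partial>lborel)"
    proof (rule Bochner_Integration.integral_mono)
      show "integrable lborel (\<lambda>z. bump z * ((h (z + p /\<^sub>R Suc n) - h z) * Suc n))"
        by (rule integrable_bump_mult) (intro continuous_intros continuous_on_compose2[OF c]; simp)
      show "integrable lborel (\<lambda>z::'b. bump z * B)" by (rule integrable_bump_mult) simp
      fix z :: 'b
      show "bump z * ((h (z + p /\<^sub>R Suc n) - h z) * Suc n) \<le> bump z * B"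
      proof (cases "norm z \<le> 1")
        case True
        let ?s = "inverse (real (Suc n))"
        have s: "0 \<le> ?s" "?s \<le> 1" by (auto simp: inverse_le_1_iff)
        have "z + p /\<^sub>R Suc n = (1 - ?s) *\<^sub>R z + ?s *\<^sub>R (z + p)" by (simp add: algebra_simps)
        then have "h (z + p /\<^sub>R Suc n) \<le> (1 - ?s) * h z + ?s * h (z + p)"
          using convex_onD[OF h s, of z "z + p"] by simp
        then have "h (z + p /\<^sub>R Suc n) - h z \<le> ?s * (h (z + p) - h z)" by (simp add: algebra_simps)
        also have "\<dots> \<le> ?s * B" by (intro mult_left_mono B True s)
        finally have "(h (z + p /\<^sub>R Suc n) - h z) * Suc n \<le> ?s * B * Suc n" by (rule mult_right_mono) simp
        also have "?s * B * Suc n = B" by simp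
        finally have "(h (z + p /\<^sub>R Suc n) - h z) * Suc n \<le> B" .
        then show ?thesis by (intro mult_left_mono bump_nonneg)
      qed (simp add: bump_outside)
    qed
    then show ?thesis by (simp add: bump_mass_def)
  qed
  then have "bump_mass TYPE('b) * (bump_grad h \<bullet> p) \<le> bump_mass TYPE('b) * B"
    by (intro LIMSEQ_le_const2[OF bump_quotient_tendsto[OF c]]) auto
  then show ?thesis using bump_mass_pos[where 'b = 'b] by simp
qed


section \<open>Scaling identities in place of polar coordinates\<close>

lemma lborel_integral_scaleR:
  fixes g :: "'b::euclidean_space \<Rightarrow> real"
  assumes "0 < r" and g: "g \<in> borel_measurable borel"
  shows "(\<integral>x. g x \<partial>lborel) = r ^ DIM('b) * (\<integral>x. g (r *\<^sub>R x) \<partial>lborel)"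
proof -
  let ?D = "distr lborel borel (\<lambda>x. 0 + r *\<^sub>R x) :: 'b measure"
  have "(\<integral>x. g x \<partial>lborel) = (\<integral>x. g x \<partial>density ?D (\<lambda>_. ennreal (r ^ DIM('b))))"
    using lborel_affine[of r "0::'b"] assms(1) by simp
  also have "\<dots> = (\<integral>x. r ^ DIM('b) *\<^sub>R g x \<partial>?D)"
    by (rule integral_density) (use assms in auto)
  also have "\<dots> = (\<integral>x. r ^ DIM('b) *\<^sub>R g (0 + r *\<^sub>R x) \<partial>lborel)"
    by (rule integral_distr) (use g in auto)
  also have "\<dots> = r ^ DIM('b) * (\<integral>x. g (r *\<^sub>R x) \<partial>lborel)" by simp
  finally show ?thesis .
qed

lemma integrable_indicator_ball_bounded:
  fixes F :: "'b::euclidean_space \<Rightarrow> real"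
  assumes "F \<in> borel_measurable borel" "\<And>x. norm x \<le> r \<Longrightarrow> \<bar>F x\<bar> \<le> C"
  shows "integrable lborel (\<lambda>x. indicator (ball 0 r) x * F x)"
proof (rule Bochner_Integration.integrable_bound)
  show "integrable lborel (\<lambda>x::'b. indicator (ball 0 r) x * C)"
    by (intro integrable_mult_left integrable_real_indicator)
       (use emeasure_bounded_finite[of "ball (0::'b) r"] in auto)
  show "(\<lambda>x. indicator (ball 0 r) x * F x) \<in> borel_measurable lborel"
    using assms(1) by (intro borel_measurable_times borel_measurable_indicator) auto
  show "AE x in lborel. norm (indicator (ball 0 r) x * F x) \<le> norm (indicator (ball 0 r) x * C)"
  proof (rule AE_I2)
    fix x :: 'b
    show "norm (indicator (ball 0 r) x * F x) \<le> norm (indicator (ball 0 r) x * C)"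
      using assms(2)[of x] by (cases "norm x < r") auto
  qed
qed

text \<open>The polar-coordinates identity: comparing the shells \<open>r \<le> norm x < 1\<close> as \<open>r\<close> tends to 1
  replaces Fubini in spherical coordinates.\<close>

lemma ball_second_moment:
  fixes F :: "'b::euclidean_space \<Rightarrow> real"
  assumes F: "F \<in> borel_measurable borel" and C: "\<And>x. \<bar>F x\<bar> \<le> C"
    and hom: "\<And>r x. 0 < r \<Longrightarrow> F (r *\<^sub>R x) = F x"
  shows "(real DIM('b) + 2) * (\<integral>x. indicator (ball 0 1) x * ((norm x)\<^sup>2 * F x) \<partial>lborel)
     = real DIM('b) * (\<integral>x. indicator (ball 0 1) x * F x \<partial>lborel)"
proof -
  let ?n = "DIM('b)"
  define I where "I = (\<integral>x. indicator (ball 0 1) x * F x \<partial>lborel)"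
  define J where "J = (\<integral>x. indicator (ball 0 1) x * ((norm x)\<^sup>2 * F x) \<partial>lborel)"
  define V where "V = (\<integral>x. indicator (ball (0::'b) 1) x * 1 \<partial>lborel :: real)"
  have C0: "0 \<le> C" using C[of 0] by simp
  have scale: "(\<integral>x. indicator (ball 0 r) x * ((norm x) ^ k * G x) \<partial>lborel)
      = r ^ (?n + k) * (\<integral>x. indicator (ball 0 1) x * ((norm x) ^ k * G x) \<partial>lborel)"
    if r: "0 < r" and G: "G \<in> borel_measurable borel" "\<And>r x. 0 < r \<Longrightarrow> G (r *\<^sub>R x) = G x"
    for r k and G :: "'b \<Rightarrow> real"
  proof -
    have "(\<lambda>x. indicator (ball 0 r) x * ((norm x) ^ k * G x)) \<in> borel_measurable borel"
      using G(1) by (intro borel_measurable_times borel_measurable_indicator borel_measurable_power) auto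
    then have "(\<integral>x. indicator (ball 0 r) x * ((norm x) ^ k * G x) \<partial>lborel)
      = r ^ ?n * (\<integral>x. indicator (ball 0 r) (r *\<^sub>R x) * ((norm (r *\<^sub>R x)) ^ k * G (r *\<^sub>R x)) \<partial>lborel)"
      by (rule lborel_integral_scaleR[OF r])
    also have "(\<lambda>x. indicator (ball 0 r) (r *\<^sub>R x) * ((norm (r *\<^sub>R x)) ^ k * G (r *\<^sub>R x)))
       = (\<lambda>x. r ^ k * (indicator (ball 0 1) x * ((norm x) ^ k * G x)))"
    proof
      fix x :: 'b
      have "indicator (ball 0 r) (r *\<^sub>R x) = (indicator (ball 0 1) x :: real)"
        using r by (auto simp: indicator_def)
      then show "indicator (ball 0 r) (r *\<^sub>R x) * ((norm (r *\<^sub>R x)) ^ k * G (r *\<^sub>R x))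
         = r ^ k * (indicator (ball 0 1) x * ((norm x) ^ k * G x))"
        using r G(2)[OF r, of x] by (simp add: power_mult_distrib)
    qed
    also have "r ^ ?n * (\<integral>x. r ^ k * (indicator (ball 0 1) x * ((norm x) ^ k * G x)) \<partial>lborel)
      = r ^ (?n + k) * (\<integral>x. indicator (ball 0 1) x * ((norm x) ^ k * G x) \<partial>lborel)"
      by (simp add: power_add)
    finally show ?thesis .
  qed
  have n2F: "(\<lambda>x. (norm x)\<^sup>2 * F x) \<in> borel_measurable borel"
    using F by (intro borel_measurable_times borel_measurable_power) auto
  have iF: "integrable lborel (\<lambda>x. indicator (ball 0 r) x * F x)" for r
    by (rule integrable_indicator_ball_bounded[OF F]) (rule C)
  have i2F: "integrable lborel (\<lambda>x. indicator (ball 0 r) x * ((norm x)\<^sup>2 * F x))" for r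
  proof (rule integrable_indicator_ball_bounded[OF n2F])
    fix x :: 'b assume "norm x \<le> r"
    then have "(norm x)\<^sup>2 \<le> r\<^sup>2" by (intro power_mono) auto
    then show "\<bar>(norm x)\<^sup>2 * F x\<bar> \<le> r\<^sup>2 * C" using C[of x] by (simp add: abs_mult mult_mono)
  qed
  have i1: "integrable lborel (\<lambda>x::'b. indicator (ball 0 r) x * (1::real))" for r
    by (rule integrable_indicator_ball_bounded[where C = 1]) auto
  \<comment> \<open>By \<open>scale\<close> the integrals over the shell are J (1 - r^(n+2)) and I
    (1 - r^n), and on the shell the integrands differ by at most (1 - r^2) C. Division by 1 - r
    leaves geometric sums of n + 2 and n terms, the origin of the two constants.\<close>
  have bound: "\<bar>J * (\<Sum>i<?n+2. r ^ i) - I * (\<Sum>i<?n. r ^ i)\<bar> \<le> (1 - r\<^sup>2) * (C * V * (\<Sum>i<?n. r ^ i))"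
    if r: "0 < r" "r < 1" for r
  proof -
    have J: "J * (1 - r ^ (?n + 2)) = (\<integral>x. indicator (ball 0 1) x * ((norm x)\<^sup>2 * F x) - indicator (ball 0 r) x * ((norm x)\<^sup>2 * F x) \<partial>lborel)"
      using scale[OF r(1) F hom, of 2] i2F by (simp add: J_def algebra_simps)
    have I: "I * (1 - r ^ ?n) = (\<integral>x. indicator (ball 0 1) x * F x - indicator (ball 0 r) x * F x \<partial>lborel)"
      using scale[OF r(1) F hom, of 0] iF by (simp add: I_def algebra_simps)
    have V: "V * (1 - r ^ ?n) = (\<integral>x. indicator (ball 0 1) x * 1 - indicator (ball (0::'b) r) x * 1 \<partial>lborel)"
      using scale[OF r(1), of "\<lambda>_. 1" 0] i1 by (simp add: V_def algebra_simps)
    define D where "D x = (indicator (ball 0 1) x * ((norm x)\<^sup>2 * F x) - indicator (ball 0 r) x * ((norm x)\<^sup>2 * F x))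
         - (indicator (ball 0 1) x * F x - indicator (ball 0 r) x * F x)" for x
    have iD: "integrable lborel D"
      unfolding D_def[abs_def] by (intro Bochner_Integration.integrable_diff iF i2F)
    have "J * (1 - r ^ (?n + 2)) - I * (1 - r ^ ?n) = (\<integral>x. D x \<partial>lborel)"
      unfolding J I D_def using iF i2F by (intro Bochner_Integration.integral_diff[symmetric] Bochner_Integration.integrable_diff)
    also have "\<bar>\<dots>\<bar> \<le> (\<integral>x. \<bar>D x\<bar> \<partial>lborel)" by (rule integral_abs_bound)
    also have "\<dots> \<le> (\<integral>x. (1 - r\<^sup>2) * C * (indicator (ball (0::'b) 1) x * 1 - indicator (ball 0 r) x * 1) \<partial>lborel)"
    proof (rule Bochner_Integration.integral_mono)
      show "integrable lborel (\<lambda>x. \<bar>D x\<bar>)" using iD by (rule integrable_abs)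
      show "integrable lborel (\<lambda>x::'b. (1 - r\<^sup>2) * C * (indicator (ball 0 1) x * 1 - indicator (ball 0 r) x * 1))"
        by (intro integrable_mult_right Bochner_Integration.integrable_diff i1)
      fix x :: 'b
      show "\<bar>D x\<bar> \<le> (1 - r\<^sup>2) * C * (indicator (ball 0 1) x * 1 - indicator (ball 0 r) x * 1)"
      proof -
        consider "norm x < r" | "r \<le> norm x" "norm x < 1" | "1 \<le> norm x" by linarith
        then show ?thesis
        proof cases
          case 2
          have a: "r\<^sup>2 \<le> (norm x)\<^sup>2" using 2 r by (intro power_mono) auto
          have b: "(norm x)\<^sup>2 \<le> 1" using 2 by (simp add: power_le_one)
          have ind: "indicator (ball 0 1) x = (1::real)" "indicator (ball 0 r) x = (0::real)" using 2 by auto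
          have "D x = - ((1 - (norm x)\<^sup>2) * F x)" unfolding ind D_def by (simp add: algebra_simps)
          then have "\<bar>D x\<bar> = \<bar>1 - (norm x)\<^sup>2\<bar> * \<bar>F x\<bar>" by (simp only: abs_minus_cancel abs_mult)
          also have "\<dots> = (1 - (norm x)\<^sup>2) * \<bar>F x\<bar>" using b by simp
          also have "\<dots> \<le> (1 - r\<^sup>2) * C" using a b C[of x] C0 by (intro mult_mono) auto
          finally show ?thesis unfolding ind by simp
        qed (use r in \<open>auto simp: D_def\<close>)
      qed
    qed
    also have "\<dots> = (1 - r\<^sup>2) * C * (V * (1 - r ^ ?n))" unfolding V by (rule integral_mult_right_zero)
    finally have *: "\<bar>J * (1 - r ^ (?n + 2)) - I * (1 - r ^ ?n)\<bar> \<le> (1 - r\<^sup>2) * C * (V * (1 - r ^ ?n))" .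
    have "(1 - r) * \<bar>J * (\<Sum>i<?n+2. r ^ i) - I * (\<Sum>i<?n. r ^ i)\<bar>
        = \<bar>J * ((1 - r) * (\<Sum>i<?n+2. r ^ i)) - I * ((1 - r) * (\<Sum>i<?n. r ^ i))\<bar>"
    proof -
      have "(1 - r) * \<bar>J * (\<Sum>i<?n+2. r ^ i) - I * (\<Sum>i<?n. r ^ i)\<bar> = \<bar>(1 - r) * (J * (\<Sum>i<?n+2. r ^ i) - I * (\<Sum>i<?n. r ^ i))\<bar>"
        using r by (simp add: abs_mult)
      then show ?thesis by (simp only: right_diff_distrib mult.left_commute)
    qed
    also have "\<dots> \<le> (1 - r\<^sup>2) * C * (V * ((1 - r) * (\<Sum>i<?n. r ^ i)))"
      using * by (simp only: one_diff_power_eq)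
    also have "\<dots> = (1 - r) * ((1 - r\<^sup>2) * (C * V * (\<Sum>i<?n. r ^ i)))" by (simp only: ac_simps)
    finally show ?thesis using r by simp
  qed
  have "((\<lambda>r. \<bar>J * (\<Sum>i<?n+2. r ^ i) - I * (\<Sum>i<?n. r ^ i)\<bar>) \<longlongrightarrow> \<bar>J * (\<Sum>i<?n+2. 1 ^ i) - I * (\<Sum>i<?n. 1 ^ i)\<bar>) (at_left 1)"
    by (intro tendsto_intros)
  moreover have "((\<lambda>r::real. (1 - r\<^sup>2) * (C * V * (\<Sum>i<?n. r ^ i))) \<longlongrightarrow> (1 - 1\<^sup>2) * (C * V * (\<Sum>i<?n. 1 ^ i))) (at_left 1)"
    by (intro tendsto_intros)
  moreover have "eventually (\<lambda>r. \<bar>J * (\<Sum>i<?n+2. r ^ i) - I * (\<Sum>i<?n. r ^ i)\<bar> \<le> (1 - r\<^sup>2) * (C * V * (\<Sum>i<?n. r ^ i))) (at_left (1::real))"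
  proof (rule eventually_mono[OF eventually_at_left_real[of 0 1]])
    fix r :: real assume "r \<in> {0<..<1}"
    then show "\<bar>J * (\<Sum>i<?n+2. r ^ i) - I * (\<Sum>i<?n. r ^ i)\<bar> \<le> (1 - r\<^sup>2) * (C * V * (\<Sum>i<?n. r ^ i))"
      by (intro bound) simp_all
  qed simp
  ultimately have "\<bar>J * (\<Sum>i<?n+2. 1 ^ i) - I * (\<Sum>i<?n. 1 ^ i)\<bar> \<le> (1 - 1\<^sup>2) * (C * V * (\<Sum>i<?n. 1 ^ i))"
    by (intro tendsto_le[OF trivial_limit_at_left_real])
  then have "J * (real ?n + 2) = I * real ?n" by (simp add: add.commute)
  then show ?thesis by (simp add: I_def J_def mult.commute)
qed

text \<open>The case F = 1 of \<open>ball_second_moment\<close>: the second moment of the ball is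
  n/(n+2) times its volume V, which leaves the mass 2 V/(n+2) for the bump.\<close>

lemma bump_mass_eq:
  "bump_mass TYPE('b::euclidean_space) * (real DIM('b) + 2) = 2 * measure lborel (ball (0::'b) 1)"
proof -
  let ?V = "measure lborel (ball (0::'b) 1)"
  let ?J = "\<integral>x. indicator (ball (0::'b) 1) x * ((norm x)\<^sup>2 * 1) \<partial>lborel :: real"
  have i1: "integrable lborel (\<lambda>x::'b. indicator (ball 0 1) x * (1::real))"
    by (rule integrable_indicator_ball_bounded[where C = 1]) auto
  have i2: "integrable lborel (\<lambda>x::'b. indicator (ball 0 1) x * ((norm x)\<^sup>2 * 1 :: real))"
    by (rule integrable_indicator_ball_bounded[where C = 1]) (auto simp: power_le_one)
  have m: "(real DIM('b) + 2) * ?J = real DIM('b) * ?V"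
    using ball_second_moment[of "\<lambda>_::'b. 1" 1] by simp
  have "bump_mass TYPE('b) = (\<integral>x. indicator (ball (0::'b) 1) x * 1 - indicator (ball (0::'b) 1) x * ((norm x)\<^sup>2 * 1) \<partial>lborel)"
    unfolding bump_mass_def
    by (rule Bochner_Integration.integral_cong) (auto simp: indicator_def bump_eq min_def)
  also have "\<dots> = ?V - ?J" using i1 i2 by (subst Bochner_Integration.integral_diff) auto
  finally have e: "bump_mass TYPE('b) = ?V - ?J" .
  show ?thesis unfolding e using m by (simp add: algebra_simps)
qed

lemma integral_sphere_measure:
  fixes g :: "'b::euclidean_space \<Rightarrow> 'b"
  assumes g: "g \<in> borel_measurable borel"
  shows "(\<integral>p. g p \<partial>sphere_measure)
     = (1 / measure lborel (ball (0::'b) 1)) *\<^sub>R (\<integral>x. indicator (ball 0 1) x *\<^sub>R g (x /\<^sub>R norm x) \<partial>lborel)"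
proof -
  let ?V = "measure lborel (ball (0::'b) 1)"
  have Vpos: "0 < ?V" using content_ball_pos[of 1 "0::'b"] by simp
  have V: "emeasure lborel (ball (0::'b) 1) = ennreal ?V"
    using emeasure_bounded_finite[of "ball (0::'b) 1"] by (intro emeasure_eq_ennreal_measure) auto
  have nm: "(\<lambda>x::'b. x /\<^sub>R norm x) \<in> borel_measurable borel" by measurable
  have "(\<integral>p. g p \<partial>sphere_measure) = (\<integral>x. g (x /\<^sub>R norm x) \<partial>uniform_measure lborel (ball 0 1))"
    unfolding sphere_measure_def by (rule integral_distr) (use nm g in auto)
  also have "uniform_measure lborel (ball (0::'b) 1) = density lborel (\<lambda>x. ennreal (indicator (ball 0 1) x / ?V))"
    unfolding uniform_measure_def V
    by (rule density_cong) (use Vpos in \<open>auto simp: indicator_def divide_ennreal[symmetric]\<close>)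
  also have "(\<integral>x. g (x /\<^sub>R norm x) \<partial>density lborel (\<lambda>x. ennreal (indicator (ball 0 1) x / ?V)))
     = (\<integral>x. (indicator (ball 0 1) x / ?V) *\<^sub>R g (x /\<^sub>R norm x) \<partial>lborel)"
  proof (rule integral_density)
    show "(\<lambda>x. g (x /\<^sub>R norm x)) \<in> borel_measurable lborel"
      using measurable_compose[OF nm g] by simp
    show "(\<lambda>x. indicator (ball (0::'b) 1) x / ?V) \<in> borel_measurable lborel"
      by (intro borel_measurable_divide borel_measurable_indicator) auto
  qed (use Vpos in auto)
  also have "\<dots> = (\<integral>x. (1 / ?V) *\<^sub>R (indicator (ball 0 1) x *\<^sub>R g (x /\<^sub>R norm x)) \<partial>lborel)"
    by (intro Bochner_Integration.integral_cong) auto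
  also have "\<dots> = (1 / ?V) *\<^sub>R (\<integral>x. indicator (ball 0 1) x *\<^sub>R g (x /\<^sub>R norm x) \<partial>lborel)"
    by (rule integral_scaleR_right)
  finally show ?thesis .
qed

section \<open>Support functions and the location of the Steiner point\<close>

definition supp_fun :: "'b::euclidean_space set \<Rightarrow> 'b \<Rightarrow> real" where
  "supp_fun K p = (SUP y\<in>K. p \<bullet> y)"

context
  fixes K :: "'b::euclidean_space set"
  assumes K: "compact K" "K \<noteq> {}"
begin

lemma supp_fun_bdd: "bdd_above ((\<lambda>y. p \<bullet> y) ` K)"
  by (intro bounded_imp_bdd_above compact_imp_bounded compact_continuous_image K continuous_intros)

lemma supp_fun_ge: "y \<in> K \<Longrightarrow> p \<bullet> y \<le> supp_fun K p"
  unfolding supp_fun_def by (rule cSUP_upper[OF _ supp_fun_bdd])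

lemma supp_fun_le: "(\<And>y. y \<in> K \<Longrightarrow> p \<bullet> y \<le> B) \<Longrightarrow> supp_fun K p \<le> B"
  unfolding supp_fun_def using K(2) by (rule cSUP_least)

lemma supp_fun_add: "supp_fun K (p + q) \<le> supp_fun K p + supp_fun K q"
  by (rule supp_fun_le) (simp add: inner_add_left add_mono supp_fun_ge)

lemma supp_fun_scaleR:
  assumes "0 < r"
  shows "supp_fun K (r *\<^sub>R p) = r * supp_fun K p"
proof (rule antisym)
  show "supp_fun K (r *\<^sub>R p) \<le> r * supp_fun K p"
    by (rule supp_fun_le) (use assms supp_fun_ge in \<open>simp add: mult_left_mono\<close>)
  have "supp_fun K p \<le> supp_fun K (r *\<^sub>R p) / r"
    by (rule supp_fun_le) (use assms supp_fun_ge[of _ "r *\<^sub>R p"] in \<open>simp add: field_simps\<close>)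
  then show "r * supp_fun K p \<le> supp_fun K (r *\<^sub>R p)" using assms by (simp add: field_simps)
qed

lemma supp_fun_convex: "convex_on UNIV (supp_fun K)"
proof (rule convex_onI)
  fix t :: real and x y :: 'b assume t: "0 < t" "t < 1"
  have "supp_fun K ((1 - t) *\<^sub>R x + t *\<^sub>R y) \<le> supp_fun K ((1 - t) *\<^sub>R x) + supp_fun K (t *\<^sub>R y)"
    by (rule supp_fun_add)
  then show "supp_fun K ((1 - t) *\<^sub>R x + t *\<^sub>R y) \<le> (1 - t) * supp_fun K x + t * supp_fun K y"
    using t by (simp add: supp_fun_scaleR)
qed simp

lemma supp_fun_continuous: "continuous_on UNIV (supp_fun K)"
  by (rule convex_on_continuous[OF open_UNIV supp_fun_convex])

text \<open>Let F be the radial projection of the integrand. Positive homogeneity of the support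
  function h gives h x * (x \<bullet> b) = (norm x)^2 * F x. So Steiner's integral is one of F over
  the ball, the bump gradient one of (norm x)^2 * F x, and \<open>ball_second_moment\<close>
  converts the first into the second with matching constants.\<close>

lemma steiner_point_eq_bump_grad: "steiner_point K = bump_grad (supp_fun K)"
proof (rule euclidean_eqI)
  fix b :: 'b assume "b \<in> Basis"
  let ?V = "measure lborel (ball (0::'b) 1)" and ?n = "real DIM('b)"
  let ?h = "supp_fun K"
  let ?u = "\<lambda>x::'b. x /\<^sub>R norm x"
  have Vpos: "0 < ?V" using content_ball_pos[of 1 "0::'b"] by simp
  have hm: "?h \<in> borel_measurable borel" by (rule borel_measurable_continuous_onI[OF supp_fun_continuous])
  have um: "?u \<in> borel_measurable borel" by measurable
  obtain R where R: "\<And>y. y \<in> K \<Longrightarrow> norm y \<le> R" using compact_imp_bounded[OF K(1)] by (auto simp: bounded_iff)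
  have hR: "\<bar>?h p\<bar> \<le> R" if "norm p \<le> 1" for p
  proof -
    have *: "\<bar>p \<bullet> y\<bar> \<le> R" if "y \<in> K" for y
    proof -
      have "\<bar>p \<bullet> y\<bar> \<le> norm p * norm y" by (rule Cauchy_Schwarz_ineq2)
      also have "\<dots> \<le> 1 * norm y" using \<open>norm p \<le> 1\<close> by (intro mult_right_mono) auto
      finally show ?thesis using R[OF that] by simp
    qed
    obtain y where "y \<in> K" using K(2) by blast
    then have "- R \<le> ?h p" using *[of y] supp_fun_ge[of y p] by linarith
    moreover have "?h p \<le> R" by (rule supp_fun_le) (use * in fastforce)
    ultimately show ?thesis by linarith
  qed
  \<comment> \<open>An inequality and not an equality: at x = 0 the projection is 0.\<close>
  have un: "norm (?u x) \<le> 1" for x by (cases "x = 0") auto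
  define F where "F x = ?h (?u x) * (?u x \<bullet> b)" for x
  have Fm: "F \<in> borel_measurable borel"
    unfolding F_def[abs_def] using hm um by (intro borel_measurable_times borel_measurable_inner) (auto intro: measurable_compose)
  have F1: "\<bar>F x\<bar> \<le> R" for x
  proof -
    have "\<bar>?u x \<bullet> b\<bar> \<le> norm (?u x) * norm b" by (rule Cauchy_Schwarz_ineq2)
    also have "\<dots> \<le> 1" using un[of x] \<open>b \<in> Basis\<close> by simp
    finally have "\<bar>?h (?u x)\<bar> * \<bar>?u x \<bullet> b\<bar> \<le> R * 1"
      using hR[OF un[of x]] by (intro mult_mono) auto
    then show ?thesis by (simp add: F_def abs_mult)
  qed
  have Fhom: "F (r *\<^sub>R x) = F x" if "0 < r" for r x
  proof -
    have "?u (r *\<^sub>R x) = ?u x" using that by simp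
    then show ?thesis by (simp only: F_def)
  qed
  have F2: "(norm x)\<^sup>2 * F x = ?h x * (x \<bullet> b)" for x
  proof (cases "x = 0")
    case False
    then have "?h x = norm x * ?h (?u x)" using supp_fun_scaleR[of "norm x" "?u x"] by simp
    then show ?thesis using False by (simp add: F_def power2_eq_square)
  qed simp
  have gm: "(\<lambda>p. ?h p *\<^sub>R p) \<in> borel_measurable borel" using hm by measurable
  have intF: "integrable lborel (\<lambda>x. indicator (ball 0 1) x *\<^sub>R (?h (?u x) *\<^sub>R ?u x))"
  proof (rule Bochner_Integration.integrable_bound)
    show "integrable lborel (\<lambda>x::'b. indicator (ball 0 1) x * R)"
      by (rule integrable_indicator_ball_bounded[where C = "\<bar>R\<bar>"]) auto
    have "(\<lambda>x. ?h (?u x) *\<^sub>R ?u x) \<in> borel_measurable lborel"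
      using measurable_compose[OF um gm] by simp
    then show "(\<lambda>x. indicator (ball 0 1) x *\<^sub>R (?h (?u x) *\<^sub>R ?u x)) \<in> borel_measurable lborel"
      by (rule borel_measurable_scaleR[rotated]) (simp add: borel_measurable_indicator)
    show "AE x in lborel. norm (indicator (ball 0 1) x *\<^sub>R (?h (?u x) *\<^sub>R ?u x)) \<le> norm (indicator (ball 0 1) x * R)"
    proof (rule AE_I2)
      fix x :: 'b
      have "\<bar>?h (?u x)\<bar> * norm (?u x) \<le> \<bar>R\<bar> * 1"
        using hR[OF un[of x]] un[of x] by (intro mult_mono) auto
      then show "norm (indicator (ball 0 1) x *\<^sub>R (?h (?u x) *\<^sub>R ?u x)) \<le> norm (indicator (ball 0 1) x * R)"
        by (auto simp: indicator_def abs_mult mult.assoc)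
    qed
  qed
  have intG: "integrable lborel (\<lambda>x. indicator (ball 0 1) x *\<^sub>R (?h x *\<^sub>R x))"
    by (intro integrable_indicator_ball_continuous continuous_intros supp_fun_continuous)
  let ?I = "\<integral>x. indicator (ball 0 1) x * F x \<partial>lborel"
  let ?J = "\<integral>x. indicator (ball 0 1) x * ((norm x)\<^sup>2 * F x) \<partial>lborel"
  have "steiner_point K = ?n *\<^sub>R (\<integral>p. ?h p *\<^sub>R p \<partial>sphere_measure)"
    unfolding steiner_point_def supp_fun_def ..
  then have "steiner_point K \<bullet> b = ?n / ?V * ((\<integral>x. indicator (ball 0 1) x *\<^sub>R (?h (?u x) *\<^sub>R ?u x) \<partial>lborel) \<bullet> b)"
    by (simp only: integral_sphere_measure[OF gm] inner_scaleR_left) simp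
  also have "\<dots> = ?n / ?V * (\<integral>x. (indicator (ball 0 1) x *\<^sub>R (?h (?u x) *\<^sub>R ?u x)) \<bullet> b \<partial>lborel)"
    by (simp only: integral_inner_left[OF intF])
  also have "\<dots> = ?n / ?V * ?I"
    by (simp only: F_def inner_scaleR_left)
  also have "\<dots> = (?n + 2) / ?V * ?J"
    using ball_second_moment[OF Fm F1 Fhom] by (simp add: field_simps)
  finally have 1: "steiner_point K \<bullet> b = (?n + 2) / ?V * ?J" .
  have "bump_grad ?h \<bullet> b = 2 / bump_mass TYPE('b) * ((\<integral>x. indicator (ball 0 1) x *\<^sub>R (?h x *\<^sub>R x) \<partial>lborel) \<bullet> b)"
    by (simp only: bump_grad_def inner_scaleR_left)
  also have "\<dots> = 2 / bump_mass TYPE('b) * (\<integral>x. (indicator (ball 0 1) x *\<^sub>R (?h x *\<^sub>R x)) \<bullet> b \<partial>lborel)"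
    by (simp only: integral_inner_left[OF intG])
  also have "\<dots> = 2 / bump_mass TYPE('b) * ?J"
    by (simp only: F2 inner_scaleR_left)
  also have "2 / bump_mass TYPE('b) = (?n + 2) / ?V"
    using bump_mass_eq[where 'b = 'b] bump_mass_pos[where 'b = 'b] Vpos by (simp add: field_simps)
  finally show "steiner_point K \<bullet> b = bump_grad ?h \<bullet> b" using 1 by simp
qed

text \<open>Subadditivity bounds supp_fun K (z + q) - supp_fun K z by supp_fun K q for every z, so
  \<open>bump_grad_le\<close> puts the Steiner point into every half-space containing K. A
  separating hyperplane would contradict this.\<close>

theorem steiner_point_in:
  assumes cK: "convex K"
  shows "steiner_point K \<in> K"
proof (rule ccontr)
  assume "steiner_point K \<notin> K"
  then obtain a d where a: "a \<bullet> steiner_point K < d" "\<And>y. y \<in> K \<Longrightarrow> d < a \<bullet> y"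
    using separating_hyperplane_closed_point[OF cK compact_imp_closed[OF K(1)]] by metis
  have "steiner_point K \<bullet> (- a) \<le> supp_fun K (- a)"
    unfolding steiner_point_eq_bump_grad
  proof (rule bump_grad_le[OF supp_fun_convex supp_fun_continuous])
    show "supp_fun K (z + - a) - supp_fun K z \<le> supp_fun K (- a)" for z
      using supp_fun_add[of z "- a"] by simp
  qed
  also have "\<dots> \<le> - d" by (rule supp_fun_le) (use a(2) in fastforce)
  finally show False using a(1) by (simp add: inner_commute)
qed

end

subsection \<open>The conjugate and the extended integral\<close>


text \<open>g is a pointwise limit of simple functions. For these, measurability in t at each fixed
  u suffices, and continuity in u carries the composition to the limit.\<close>

lemma borel_measurable_Caratheodory:
  fixes F :: "'t \<Rightarrow> 'u::{metric_space,second_countable_topology,zero} \<Rightarrow> real"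
  assumes meas: "\<And>u. (\<lambda>t. F t u) \<in> borel_measurable N"
    and cont: "\<And>t. t \<in> space N \<Longrightarrow> continuous_on UNIV (F t)"
    and g: "g \<in> borel_measurable N"
  shows "(\<lambda>t. F t (g t)) \<in> borel_measurable N"
proof -
  obtain s where s: "\<And>i. simple_function N (s i)" "\<And>t. t \<in> space N \<Longrightarrow> (\<lambda>i. s i t) \<longlonglongrightarrow> g t"
    using borel_measurable_implies_sequence_metric[OF g, of 0] by blast
  have si: "(\<lambda>t. F t (s i t)) \<in> borel_measurable N" for i
  proof (rule measurable_compose_countable'[where I = "s i ` space N" and f = "\<lambda>u t. F t u" and g = "s i"])
    show "s i \<in> measurable N (count_space (s i ` space N))"
    proof (rule measurableI)
      fix A assume "A \<in> sets (count_space (s i ` space N))"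
      show "s i -` A \<inter> space N \<in> sets N" by (rule simple_functionD(2)[OF s(1)])
    qed simp
    show "countable (s i ` space N)" using simple_functionD(1)[OF s(1)] by (rule countable_finite)
  qed (rule meas)
  show ?thesis
  proof (rule borel_measurable_LIMSEQ_real[OF _ si])
    fix t assume t: "t \<in> space N"
    show "(\<lambda>i. F t (s i t)) \<longlonglongrightarrow> F t (g t)"
      by (rule continuous_on_tendsto_compose[OF cont[OF t] s(2)[OF t]]) auto
  qed
qed

lemma conj_H_ge: "ereal (v \<bullet> p - H t x p) \<le> conj_H H t x v"
  unfolding conj_H_def by (rule SUP_upper) simp

lemma conj_H_le_iff: "conj_H H t x v \<le> ereal \<eta> \<longleftrightarrow> (\<forall>p. v \<bullet> p - H t x p \<le> \<eta>)"
  unfolding conj_H_def by (simp add: SUP_le_iff)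

lemma conj_H_not_MInf: "conj_H H t x v \<noteq> -\<infinity>"
  using conj_H_ge[of v 0 H t x] by auto

lemma conj_H_real:
  assumes "conj_H H t x v < \<infinity>"
  shows "ereal (real_of_ereal (conj_H H t x v)) = conj_H H t x v"
  using assms conj_H_not_MInf[of H t x v] by (cases "conj_H H t x v") auto

text \<open>Reduces \<open>ext_integral\<close> to a nonnegative integral, for which the usual limit theorems apply.\<close>

lemma ext_integral_shift:
  fixes f :: "real \<Rightarrow> ereal"
  assumes f: "f \<in> borel_measurable (lebesgue_on S)"
    and k: "integrable (lebesgue_on S) \<kappa>" "\<And>t. t \<in> S \<Longrightarrow> 0 \<le> \<kappa> t"
    and ge: "\<And>t. t \<in> S \<Longrightarrow> - ereal (\<kappa> t) \<le> f t"
  shows "ext_integral S f + ereal (\<integral>t. \<kappa> t \<partial>lebesgue_on S)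
    = enn2ereal (\<integral>\<^sup>+t. e2ennreal (f t + ereal (\<kappa> t)) \<partial>lebesgue_on S)"
proof -
  let ?M = "lebesgue_on S"
  define P where "P = (\<integral>\<^sup>+ t. e2ennreal (max 0 (f t)) \<partial>?M)"
  define N where "N = (\<integral>\<^sup>+ t. e2ennreal (max 0 (- f t)) \<partial>?M)"
  define K where "K = (\<integral>t. \<kappa> t \<partial>?M)"
  define Q where "Q = (\<integral>\<^sup>+t. e2ennreal (f t + ereal (\<kappa> t)) \<partial>?M)"
  have km: "\<kappa> \<in> borel_measurable ?M" using k(1) by simp
  note [measurable] = f km
  have K0: "0 \<le> K" unfolding K_def using k(2) by (intro integral_nonneg_AE AE_I2) simp
  have Kn: "(\<integral>\<^sup>+t. ennreal (\<kappa> t) \<partial>?M) = ennreal K"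
    unfolding K_def by (rule nn_integral_eq_integral[OF k(1)]) (use k(2) in \<open>auto intro: AE_I2\<close>)
  have "N \<le> (\<integral>\<^sup>+t. ennreal (\<kappa> t) \<partial>?M)"
    unfolding N_def
  proof (rule nn_integral_mono)
    fix t assume "t \<in> space ?M"
    then have t: "t \<in> S" by simp
    have "- f t \<le> ereal (\<kappa> t)" using ge[OF t] by (cases "f t") auto
    then have "max 0 (- f t) \<le> ereal (\<kappa> t)" using k(2)[OF t] by simp
    then have "e2ennreal (max 0 (- f t)) \<le> e2ennreal (ereal (\<kappa> t))" by (rule e2ennreal_mono)
    then show "e2ennreal (max 0 (- f t)) \<le> ennreal (\<kappa> t)" by (simp add: e2ennreal_ereal)
  qed
  then have Nfin: "N \<le> ennreal K" using Kn by simp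
  \<comment> \<open>With the positive and negative parts of f, f^+ + \<kappa> = (f + \<kappa>) +
    f^-. All terms are nonnegative, so the identity can be integrated even where f is \<infinity>; N
    is finite and is subtracted afterwards.\<close>
  have "P + ennreal K = (\<integral>\<^sup>+ t. e2ennreal (max 0 (f t)) + ennreal (\<kappa> t) \<partial>?M)"
    unfolding P_def Kn[symmetric] by (rule nn_integral_add[symmetric]; measurable)
  also have "\<dots> = (\<integral>\<^sup>+ t. e2ennreal (f t + ereal (\<kappa> t)) + e2ennreal (max 0 (- f t)) \<partial>?M)"
  proof (rule nn_integral_cong)
    fix t assume "t \<in> space ?M"
    then have t: "t \<in> S" by simp
    have e0: "e2ennreal 0 = 0" by (simp add: zero_ereal_def e2ennreal_ereal)
    show "e2ennreal (max 0 (f t)) + ennreal (\<kappa> t) = e2ennreal (f t + ereal (\<kappa> t)) + e2ennreal (max 0 (- f t))"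
    proof (cases "f t")
      case (real r)
      have "- \<kappa> t \<le> r" using ge[OF t] real by simp
      then show ?thesis using real k(2)[OF t]
        by (cases "0 \<le> r") (auto simp: max_def e0 e2ennreal_ereal ennreal_plus[symmetric] simp del: ennreal_plus)
    next
      case MInf then show ?thesis using ge[OF t] by simp
    qed (simp add: max_def)
  qed
  also have "\<dots> = Q + N"
    unfolding Q_def N_def by (rule nn_integral_add; measurable)
  finally have PK: "P + ennreal K = Q + N" .
  obtain n where n: "N = ennreal n" "0 \<le> n" using Nfin by (cases N) (auto simp: top_unique)
  have "ext_integral S f = enn2ereal P - enn2ereal N"
    unfolding ext_integral_def Let_def P_def[symmetric] N_def[symmetric] using n by simp
  moreover have "enn2ereal P + ereal K = enn2ereal Q + ereal n"
    using arg_cong[OF PK, of enn2ereal] K0 n by (simp add: plus_ennreal.rep_eq enn2ereal_ennreal)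
  ultimately show ?thesis
    unfolding K_def[symmetric] Q_def[symmetric] using n K0
    by (cases "enn2ereal P"; cases "enn2ereal Q") (auto simp: enn2ereal_ennreal)
qed

lemma ext_integral_cong_AE:
  assumes "AE t in lebesgue_on S. f t = g t"
  shows "ext_integral S f = ext_integral S g"
proof -
  have "(\<integral>\<^sup>+ t. e2ennreal (max 0 (f t)) \<partial>lebesgue_on S) = (\<integral>\<^sup>+ t. e2ennreal (max 0 (g t)) \<partial>lebesgue_on S)"
       "(\<integral>\<^sup>+ t. e2ennreal (max 0 (- f t)) \<partial>lebesgue_on S) = (\<integral>\<^sup>+ t. e2ennreal (max 0 (- g t)) \<partial>lebesgue_on S)"
    using assms by (auto intro!: nn_integral_cong_AE elim: eventually_mono)
  then show ?thesis by (simp add: ext_integral_def)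
qed

text \<open>Nonnegative integrals are monotone for arbitrary functions. Thus g may be
  \<open>steiner_l\<close> along a control, without a study of its measurability in t.\<close>

lemma ext_integral_mono_AE:
  assumes le: "AE t in lebesgue_on S. f t \<le> g t"
    and fin: "(\<integral>\<^sup>+ t. e2ennreal (max 0 (- f t)) \<partial>lebesgue_on S) \<noteq> \<infinity>"
  shows "ext_integral S f \<le> ext_integral S g"
proof -
  have P: "(\<integral>\<^sup>+ t. e2ennreal (max 0 (f t)) \<partial>lebesgue_on S) \<le> (\<integral>\<^sup>+ t. e2ennreal (max 0 (g t)) \<partial>lebesgue_on S)"
    using le by (intro nn_integral_mono_AE) (auto intro!: e2ennreal_mono elim!: eventually_mono simp: max.coboundedI2)
  have N: "(\<integral>\<^sup>+ t. e2ennreal (max 0 (- g t)) \<partial>lebesgue_on S) \<le> (\<integral>\<^sup>+ t. e2ennreal (max 0 (- f t)) \<partial>lebesgue_on S)"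
    using le by (intro nn_integral_mono_AE) (auto intro!: e2ennreal_mono elim!: eventually_mono simp: max.coboundedI2)
  have "(\<integral>\<^sup>+ t. e2ennreal (max 0 (- g t)) \<partial>lebesgue_on S) \<noteq> \<infinity>" using N fin by (auto simp: top_unique)
  then show ?thesis
    using fin P N by (simp add: ext_integral_def Let_def less_eq_ennreal.rep_eq ereal_minus_mono)
qed

subsection \<open>Hamiltonians with integrable bounds\<close>


locale hamiltonian =
  fixes H :: "real \<Rightarrow> 'a::euclidean_space \<Rightarrow> 'a \<Rightarrow> real" and c :: "real \<Rightarrow> real" and a b :: real
  assumes ab: "a \<le> b"
    and H_meas: "\<And>x p. (\<lambda>t. H t x p) \<in> borel_measurable (lebesgue_on {a..b})"
    and H_cont: "\<And>t. t \<in> {a..b} \<Longrightarrow> continuous_on UNIV (\<lambda>(x, p). H t x p)"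
    and H_convex: "\<And>t x. t \<in> {a..b} \<Longrightarrow> convex_on UNIV (H t x)"
    and c_int: "integrable (lebesgue_on {a..b}) c"
    and c_nonneg: "\<And>t. t \<in> {a..b} \<Longrightarrow> 0 \<le> c t"
    and H_lip: "\<And>t x p q. t \<in> {a..b} \<Longrightarrow> \<bar>H t x p - H t x q\<bar> \<le> c t * (1 + norm x) * norm (p - q)"
    and H_loc_lip: "\<And>R. R > 0 \<Longrightarrow> \<exists>k. integrable (lebesgue_on {a..b}) k \<and> (\<forall>t\<in>{a..b}. 0 \<le> k t) \<and>
               (\<forall>t\<in>{a..b}. \<forall>x\<in>cball 0 R. \<forall>y\<in>cball 0 R. \<forall>p.
                  \<bar>H t x p - H t y p\<bar> \<le> k t * (1 + norm p) * norm (x - y))"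
    and H00_int: "integrable (lebesgue_on {a..b}) (\<lambda>t. H t 0 0)"
begin

abbreviation "I \<equiv> lebesgue_on {a..b}"

lemma H_cont_p: "t \<in> {a..b} \<Longrightarrow> continuous_on UNIV (H t x)"
  using continuous_on_compose2[OF H_cont continuous_on_Pair[OF continuous_on_const continuous_on_id]]
  by simp

text \<open>A function with Lipschitz constant L in p cannot compensate v \<bullet> p if norm v > L:
  along p = s v the gap is at least s * norm v * (norm v - L), up to a constant. This is the a
  priori speed bound.\<close>

lemma conj_H_domain:
  assumes t: "t \<in> {a..b}" and fin: "conj_H H t x v < \<infinity>"
  shows "norm v \<le> c t * (1 + norm x)"
proof (rule ccontr)
  let ?L = "c t * (1 + norm x)"
  assume "\<not> norm v \<le> ?L"
  then have lt: "?L < norm v" by simp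
  have L0: "0 \<le> ?L" using c_nonneg[OF t] by simp
  obtain \<eta> where "conj_H H t x v \<le> ereal \<eta>" using fin by (metis ereal_dense2 less_imp_le)
  then have \<eta>: "v \<bullet> p - H t x p \<le> \<eta>" for p by (simp add: conj_H_le_iff)
  \<comment> \<open>C exceeds what the finite conjugate allows by 1, and s is the multiple of v at
    which the gap equals C.\<close>
  define C where "C = \<bar>\<eta> + H t x 0\<bar> + 1"
  define s where "s = C / (norm v * (norm v - ?L))"
  have pos: "0 < norm v * (norm v - ?L)" using lt L0 by (intro mult_pos_pos) linarith+
  have s0: "0 \<le> s" using pos by (simp add: s_def C_def)
  have 1: "v \<bullet> (s *\<^sub>R v) = s * norm v * norm v" by (simp add: dot_square_norm power2_eq_square)
  have 2: "H t x (s *\<^sub>R v) \<le> H t x 0 + ?L * (s * norm v)"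
    using H_lip[OF t, of x "s *\<^sub>R v" 0] s0 by simp
  have 3: "s * norm v * norm v - ?L * (s * norm v) \<le> \<eta> + H t x 0" using 1 2 \<eta>[of "s *\<^sub>R v"] by linarith
  have 4: "s * norm v * norm v - ?L * (s * norm v) = s * (norm v * (norm v - ?L))" by (simp add: algebra_simps)
  have 5: "s * (norm v * (norm v - ?L)) = C"
    unfolding s_def using pos by (intro nonzero_eq_divide_eq[THEN iffD1, OF _ refl]) linarith
  show False using 3 abs_ge_self[of "\<eta> + H t x 0"] unfolding 4 5 C_def by linarith
qed

text \<open>A bump average of subgradients of \<open>H t x\<close>, in place of a measurable selection of its
  subdifferential at \<open>0\<close>.\<close>

definition vel :: "real \<Rightarrow> 'a \<Rightarrow> 'a" where
  "vel t x = bump_grad (H t x)"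

text \<open>The Lipschitz bound is paid twice, to replace H t x (z + p) by H t x p and H t x z by H
  t x 0; hence the 2. Along bounded trajectories the result is integrable, which makes the cost of
  following \<open>vel\<close> finite.\<close>

lemma conj_H_vel:
  assumes t: "t \<in> {a..b}"
  shows "conj_H H t x (vel t x) \<le> ereal (- H t x 0 + 2 * c t * (1 + norm x))"
  unfolding conj_H_le_iff
proof
  fix p
  let ?L = "c t * (1 + norm x)"
  have L0: "0 \<le> ?L" using c_nonneg[OF t] by simp
  have "vel t x \<bullet> p \<le> H t x p - H t x 0 + 2 * ?L"
    unfolding vel_def
  proof (rule bump_grad_le[OF H_convex[OF t] H_cont_p[OF t]])
    fix z :: 'a assume z: "norm z \<le> 1"
    have 1: "?L * norm z \<le> ?L" using mult_left_mono[OF z L0] by simp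
    have "H t x (z + p) \<le> H t x p + ?L * norm z" using H_lip[OF t, of x "z + p" p] by simp
    moreover have "H t x 0 \<le> H t x z + ?L * norm z" using H_lip[OF t, of x z 0] by simp
    ultimately show "H t x (z + p) - H t x z \<le> H t x p - H t x 0 + 2 * ?L" using 1 by linarith
  qed
  then show "vel t x \<bullet> p - H t x p \<le> - H t x 0 + 2 * c t * (1 + norm x)" by (simp add: algebra_simps)
qed

lemma norm_vel_le:
  assumes "t \<in> {a..b}"
  shows "norm (vel t x) \<le> c t * (1 + norm x)"
  by (rule conj_H_domain[OF assms]) (use conj_H_vel[OF assms, of x] in \<open>auto intro: le_less_trans\<close>)

lemma epi_conj_eq: "epi_conj H t x = (\<Inter>p. {w. fst w \<bullet> p - H t x p \<le> snd w})"
  unfolding epi_conj_def by (auto simp: conj_H_le_iff)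

lemma epi_conj_closed: "closed (epi_conj H t x)"
  unfolding epi_conj_eq by (intro closed_INT ballI closed_Collect_le continuous_intros)

lemma epi_conj_convex: "convex (epi_conj H t x)"
  unfolding epi_conj_eq
proof (rule convex_INT)
  fix p :: 'a
  have "{w :: 'a \<times> real. fst w \<bullet> p - H t x p \<le> snd w} = {w. (p, - 1) \<bullet> w \<le> H t x p}"
    by (auto simp: inner_prod_def inner_commute)
  then show "convex {w. fst w \<bullet> p - H t x p \<le> snd w}" using convex_halfspace_le by metis
qed

lemma epi_conj_nonempty: "t \<in> {a..b} \<Longrightarrow> epi_conj H t x \<noteq> {}"
  using conj_H_vel[of t x] unfolding epi_conj_def by blast

lemma steiner_point_Phi_in:
  assumes t: "t \<in> {a..b}"
  shows "steiner_point (steiner_Phi H t x w) \<in> steiner_Phi H t x w"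
proof (rule steiner_point_in)
  show "compact (steiner_Phi H t x w)"
    unfolding steiner_Phi_def by (intro closed_Int_compact epi_conj_closed compact_cball)
  show "convex (steiner_Phi H t x w)"
    unfolding steiner_Phi_def by (intro convex_Int epi_conj_convex convex_cball)
  \<comment> \<open>A nearest point of the epigraph shows that the intersection is not empty: its
    distance d is at most the radius 2 d.\<close>
  obtain y where y: "y \<in> epi_conj H t x" "infdist w (epi_conj H t x) = dist w y"
    using infdist_attains_inf[OF epi_conj_closed epi_conj_nonempty[OF t]] by metis
  have "dist w y \<le> 2 * infdist w (epi_conj H t x)" using y(2) zero_le_dist[of w y] by linarith
  then show "steiner_Phi H t x w \<noteq> {}" using y(1) by (auto simp: steiner_Phi_def)
qed

lemma conj_H_steiner_le:
  assumes "t \<in> {a..b}"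
  shows "conj_H H t x (steiner_f H t x w) \<le> ereal (steiner_l H t x w)"
  using steiner_point_Phi_in[OF assms, of x w]
  by (auto simp: steiner_Phi_def epi_conj_def steiner_f_def steiner_l_def split: prod.splits)

lemma steiner_epi:
  assumes "t \<in> {a..b}" "conj_H H t x v \<le> ereal \<eta>"
  shows "steiner_f H t x (v, \<eta>) = v" "steiner_l H t x (v, \<eta>) = \<eta>"
proof -
  have "(v, \<eta>) \<in> epi_conj H t x" using assms(2) by (simp add: epi_conj_def)
  then have "steiner_Phi H t x (v, \<eta>) = {(v, \<eta>)}" by (auto simp: steiner_Phi_def)
  then have "steiner_point (steiner_Phi H t x (v, \<eta>)) = (v, \<eta>)"
    using steiner_point_Phi_in[OF assms(1), of x "(v, \<eta>)"] by simp
  then show "steiner_f H t x (v, \<eta>) = v" "steiner_l H t x (v, \<eta>) = \<eta>"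
    by (simp_all add: steiner_f_def steiner_l_def)
qed

lemma H_compose_measurable:
  assumes x: "x \<in> borel_measurable I" and p: "p \<in> borel_measurable I"
  shows "(\<lambda>t. H t (x t) (p t)) \<in> borel_measurable I"
proof -
  have "(\<lambda>t. (case (x t, p t) of (x, p) \<Rightarrow> H t x p)) \<in> borel_measurable I"
  proof (rule borel_measurable_Caratheodory[where F = "\<lambda>t. \<lambda>(x, p). H t x p"])
    show "(\<lambda>t. case u of (x, p) \<Rightarrow> H t x p) \<in> borel_measurable I" for u
      using H_meas by (cases u) simp
    show "(\<lambda>t. (x t, p t)) \<in> borel_measurable I" using x p by (rule borel_measurable_Pair)
  qed (use H_cont in simp)
  then show ?thesis by simp
qed

text \<open>Continuity of H t x lets one sequence serve all t, x and v. \<open>P 0 = 0\<close> is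
  put in front so that the finite maxima taken later never fall below - H t x 0.\<close>

lemma obtain_dense_sequence:
  obtains P :: "nat \<Rightarrow> 'a" where "P 0 = 0"
    "\<And>t x v. t \<in> {a..b} \<Longrightarrow> conj_H H t x v = (SUP n. ereal (v \<bullet> P n - H t x (P n)))"
proof -
  obtain D :: "'a set" where D: "countable D" "\<And>X. open X \<Longrightarrow> X \<noteq> {} \<Longrightarrow> \<exists>d\<in>D. d \<in> X"
    using countable_dense_setE by blast
  have Dne: "D \<noteq> {}" using D(2)[of UNIV] by auto
  define P where "P n = (case n of 0 \<Rightarrow> 0 | Suc n \<Rightarrow> from_nat_into D n)" for n
  have P: "\<exists>n. P n = d" if "d \<in> D" for d
    using from_nat_into_surj[OF D(1) that] by (metis P_def nat.simps(5))
  show thesis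
  proof
    show "P 0 = 0" by (simp add: P_def)
    fix t x v assume t: "t \<in> {a..b}"
    let ?f = "\<lambda>p. v \<bullet> p - H t x p"
    show "conj_H H t x v = (SUP n. ereal (?f (P n)))"
    proof (rule antisym)
      show "(SUP n. ereal (?f (P n))) \<le> conj_H H t x v" by (rule SUP_least) (rule conj_H_ge)
      show "conj_H H t x v \<le> (SUP n. ereal (?f (P n)))"
        unfolding conj_H_def
      proof (rule SUP_least)
        fix p
        show "ereal (?f p) \<le> (SUP n. ereal (?f (P n)))"
        proof (rule ereal_le_epsilon2)
          fix e :: real assume e: "0 < e"
          have "continuous_on UNIV ?f" by (intro continuous_intros H_cont_p[OF t])
          then have "open {q. ?f p - e < ?f q}" by (intro open_Collect_less continuous_on_const)
          moreover have "p \<in> {q. ?f p - e < ?f q}" using e by simp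
          ultimately obtain d where "d \<in> D" "?f p - e < ?f d" using D(2) by blast
          then obtain n where "?f p \<le> ?f (P n) + e" using P by (metis diff_less_eq less_imp_le)
          then have "ereal (?f p) \<le> ereal (?f (P n)) + ereal e" by simp
          also have "ereal (?f (P n)) \<le> (SUP n. ereal (?f (P n)))" by (rule SUP_upper) simp
          finally show "ereal (?f p) \<le> (SUP n. ereal (?f (P n))) + ereal e" by (simp add: add_right_mono)
        qed
      qed
    qed
  qed
qed

lemma conj_H_compose_measurable:
  assumes x: "x \<in> borel_measurable I" and v: "v \<in> borel_measurable I"
  shows "(\<lambda>t. conj_H H t (x t) (v t)) \<in> borel_measurable I"
proof -
  obtain P :: "nat \<Rightarrow> 'a" where P: "\<And>t x v. t \<in> {a..b} \<Longrightarrow> conj_H H t x v = (SUP n. ereal (v \<bullet> P n - H t x (P n)))"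
    using obtain_dense_sequence by metis
  have "(\<lambda>t. SUP n. ereal (v t \<bullet> P n - H t (x t) (P n))) \<in> borel_measurable I"
    using x v H_compose_measurable[OF x, of "\<lambda>_. P n" for n]
    by (intro borel_measurable_SUP borel_measurable_ereal borel_measurable_diff borel_measurable_inner) auto
  then show ?thesis
    by (subst measurable_cong[where g = "\<lambda>t. SUP n. ereal (v t \<bullet> P n - H t (x t) (P n))"]) (use P in auto)
qed

lemma obtain_H_bound:
  assumes R: "0 \<le> R"
  obtains \<kappa> where "integrable I \<kappa>" "\<And>t. t \<in> {a..b} \<Longrightarrow> 0 \<le> \<kappa> t"
    "\<And>t y. t \<in> {a..b} \<Longrightarrow> norm y \<le> R \<Longrightarrow> \<bar>H t y 0\<bar> \<le> \<kappa> t"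
proof -
  \<comment> \<open>R + 1 is a positive radius also when R = 0.\<close>
  obtain k where k: "integrable I k" "\<And>t. t \<in> {a..b} \<Longrightarrow> 0 \<le> k t"
    "\<And>t x y p. t \<in> {a..b} \<Longrightarrow> norm x \<le> R + 1 \<Longrightarrow> norm y \<le> R + 1 \<Longrightarrow> \<bar>H t x p - H t y p\<bar> \<le> k t * (1 + norm p) * norm (x - y)"
    using H_loc_lip[of "R + 1"] R by (auto simp: dist_norm)
  show thesis
  proof (rule that[of "\<lambda>t. \<bar>H t 0 0\<bar> + k t * R"])
    show "integrable I (\<lambda>t. \<bar>H t 0 0\<bar> + k t * R)"
      using H00_int k(1) by (intro Bochner_Integration.integrable_add integrable_abs integrable_mult_left) auto
    show "0 \<le> \<bar>H t 0 0\<bar> + k t * R" if "t \<in> {a..b}" for t using k(2)[OF that] R by simp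
    fix t and y :: 'a assume t: "t \<in> {a..b}" and y: "norm y \<le> R"
    have "\<bar>H t y 0 - H t 0 0\<bar> \<le> k t * norm y" using k(3)[OF t, of y 0 0] y R by simp
    also have "\<dots> \<le> k t * R" using k(2)[OF t] y by (intro mult_left_mono)
    finally show "\<bar>H t y 0\<bar> \<le> \<bar>H t 0 0\<bar> + k t * R" by linarith
  qed
qed

lemma conj_H_ge_bound:
  assumes "\<bar>H t y 0\<bar> \<le> K"
  shows "- ereal K \<le> conj_H H t y v"
proof -
  have "- ereal K \<le> ereal (v \<bullet> 0 - H t y 0)" using assms by (simp add: abs_le_iff)
  also have "\<dots> \<le> conj_H H t y v" by (rule conj_H_ge)
  finally show ?thesis .
qed

lemma abs_cont_on_bounded:
  assumes "abs_cont_on a b x"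
  obtains R where "0 \<le> R" "\<And>t. t \<in> {a..b} \<Longrightarrow> norm (x t) \<le> R"
proof -
  have "bounded (x ` {a..b})"
    by (intro compact_imp_bounded compact_continuous_image abs_cont_on_imp_continuous assms) simp
  then obtain R where "\<forall>y\<in>x ` {a..b}. norm y \<le> R" unfolding bounded_iff by blast
  then show thesis by (intro that[of "max R 0"]) (auto simp: max.coboundedI1)
qed

lemma abs_cont_on_measurable: "abs_cont_on a b x \<Longrightarrow> (x :: real \<Rightarrow> 'a) \<in> borel_measurable I"
  by (intro continuous_imp_measurable_on_sets_lebesgue abs_cont_on_imp_continuous) auto

text \<open>H t (y t) z is jointly measurable in (t, z) by the Caratheodory argument on the product
  space; integrating out z leaves a measurable function of t.\<close>

lemma vel_compose_measurable:
  assumes y: "y \<in> borel_measurable I"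
  shows "(\<lambda>t. vel t (y t)) \<in> borel_measurable I"
proof -
  have "(\<lambda>w. (case (y (fst w), snd w) of (x, p) \<Rightarrow> H (fst w) x p)) \<in> borel_measurable (I \<Otimes>\<^sub>M (lborel :: 'a measure))"
  proof (rule borel_measurable_Caratheodory[where F = "\<lambda>w. \<lambda>(x, p). H (fst w) x p"])
    show "(\<lambda>w. case u of (x, p) \<Rightarrow> H (fst w) x p) \<in> borel_measurable (I \<Otimes>\<^sub>M lborel)" for u
      using measurable_compose[OF measurable_fst H_meas] by (cases u) auto
    show "(\<lambda>w. (y (fst w), snd w)) \<in> borel_measurable (I \<Otimes>\<^sub>M lborel)"
      using measurable_compose[OF measurable_fst y] measurable_snd[of I "lborel :: 'a measure"]
      by (intro borel_measurable_Pair) auto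
  qed (use H_cont in \<open>auto simp: space_pair_measure\<close>)
  then have Hm: "(\<lambda>(t, z). H t (y t) z) \<in> borel_measurable (I \<Otimes>\<^sub>M (lborel :: 'a measure))"
    by (simp add: split_beta')
  have "(\<lambda>(t, z). indicator (ball 0 1) z *\<^sub>R (H t (y t) z *\<^sub>R z)) \<in> borel_measurable (I \<Otimes>\<^sub>M (lborel :: 'a measure))"
  proof -
    have i: "(\<lambda>w. indicator (ball 0 1) (snd w) :: real) \<in> borel_measurable (I \<Otimes>\<^sub>M (lborel :: 'a measure))"
      by (rule measurable_compose[OF measurable_snd]) (simp add: borel_measurable_indicator)
    have s: "snd \<in> borel_measurable (I \<Otimes>\<^sub>M (lborel :: 'a measure))"
      using measurable_snd[of I "lborel :: 'a measure"] by simp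
    show ?thesis using borel_measurable_scaleR[OF i borel_measurable_scaleR[OF Hm s]] by (simp add: split_beta')
  qed
  then have "(\<lambda>t. \<integral>z. indicator (ball 0 1) z *\<^sub>R (H t (y t) z *\<^sub>R z) \<partial>lborel) \<in> borel_measurable I"
    by (rule sigma_finite_measure.borel_measurable_lebesgue_integral[OF sigma_finite_lborel])
  then show ?thesis unfolding vel_def bump_grad_def by (intro borel_measurable_scaleR) auto
qed

text \<open>\<open>bump_grad\<close> is linear in the function, so a bound on H t x - H t y over the
  unit ball of z passes to the velocities. A selection of subgradients would have no such continuity
  in x.\<close>

lemma vel_lipschitz:
  assumes t: "t \<in> {a..b}" and K: "0 \<le> K" "\<And>z. norm z \<le> 1 \<Longrightarrow> \<bar>H t x z - H t y z\<bar> \<le> K"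
  shows "norm (vel t x - vel t y) \<le> 2 / bump_mass TYPE('a) * measure lborel (ball (0::'a) 1) * K"
proof -
  have int: "integrable lborel (\<lambda>z. indicator (ball 0 1) z *\<^sub>R (H t x z *\<^sub>R z))" for x
    by (intro integrable_indicator_ball_continuous continuous_intros H_cont_p[OF t])
  let ?D = "\<lambda>z. indicator (ball 0 1) z *\<^sub>R (H t x z *\<^sub>R z) - indicator (ball 0 1) z *\<^sub>R (H t y z *\<^sub>R z)"
  have "norm (\<integral>z. ?D z \<partial>lborel) \<le> (\<integral>z. indicator (ball (0::'a) 1) z * K \<partial>lborel)"
  proof (rule Bochner_Integration.integral_norm_bound_integral)
    show "integrable lborel ?D" by (intro Bochner_Integration.integrable_diff int)
    show "integrable lborel (\<lambda>z::'a. indicator (ball 0 1) z * K)"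
      by (rule integrable_indicator_ball_bounded[where C = K]) (use K in auto)
    fix z :: 'a
    show "norm (?D z) \<le> indicator (ball 0 1) z * K"
    proof (cases "norm z < 1")
      case True
      have "?D z = (H t x z - H t y z) *\<^sub>R z" using True by (simp add: scaleR_left_diff_distrib)
      then have "norm (?D z) = \<bar>H t x z - H t y z\<bar> * norm z" by simp
      also have "\<dots> \<le> K * 1" using True K by (intro mult_mono) auto
      finally show ?thesis using True by simp
    qed simp
  qed
  also have "(\<integral>z. indicator (ball (0::'a) 1) z * K \<partial>lborel) = measure lborel (ball (0::'a) 1) * K"
    by (subst integral_mult_left_zero) simp
  finally have *: "norm (\<integral>z. ?D z \<partial>lborel) \<le> measure lborel (ball (0::'a) 1) * K" .
  have "vel t x - vel t y = (2 / bump_mass TYPE('a)) *\<^sub>R (\<integral>z. ?D z \<partial>lborel)"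
    unfolding vel_def bump_grad_def using int by (simp add: scaleR_right_diff_distrib)
  then have "norm (vel t x - vel t y) = 2 / bump_mass TYPE('a) * norm (\<integral>z. ?D z \<partial>lborel)"
    using bump_mass_pos[where 'b = 'a] by simp
  also have "\<dots> \<le> 2 / bump_mass TYPE('a) * (measure lborel (ball (0::'a) 1) * K)"
    using * bump_mass_pos[where 'b = 'a] by (intro mult_left_mono) auto
  finally show ?thesis by (simp add: mult.assoc)
qed

end

subsection \<open>The Gronwall inequality\<close>


lemma integral_norm_bound_interval:
  fixes f :: "real \<Rightarrow> 'a::euclidean_space"
  assumes f: "integrable (lebesgue_on {a..b}) f" and g: "integrable (lebesgue_on {a..b}) g"
    and le: "AE t in lebesgue_on {a..b}. norm (f t) \<le> g t" and st: "a \<le> s" "t \<le> b"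
  shows "norm (integral {s..t} f) \<le> integral {s..t} g"
proof -
  have fi: "integrable (lebesgue_on {s..t}) f" and gi: "integrable (lebesgue_on {s..t}) g"
    using integrable_lebesgue_on_subinterval[OF f st] integrable_lebesgue_on_subinterval[OF g st] by auto
  have "AE r in lebesgue. r \<in> {a..b} \<longrightarrow> norm (f r) \<le> g r"
    using le by (subst (asm) AE_restrict_space_iff) auto
  then have "AE r in lebesgue. r \<in> {s..t} \<longrightarrow> norm (f r) \<le> g r"
    by eventually_elim (use st in auto)
  then have AE: "AE r in lebesgue_on {s..t}. norm (f r) \<le> g r"
    by (subst AE_restrict_space_iff) auto
  have "norm (integral\<^sup>L (lebesgue_on {s..t}) f) \<le> (\<integral>r. norm (f r) \<partial>lebesgue_on {s..t})"
    by (rule integral_norm_bound)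
  also have "\<dots> \<le> integral\<^sup>L (lebesgue_on {s..t}) g"
    using fi gi AE by (intro integral_mono_AE) auto
  finally show ?thesis using fi gi by (simp add: lebesgue_integral_eq_integral)
qed

lemma integral_diff_interval:
  fixes f :: "real \<Rightarrow> 'a::euclidean_space"
  assumes f: "integrable (lebesgue_on {a..b}) f" and st: "a \<le> s" "s \<le> t" "t \<le> b"
  shows "integral {a..t} f - integral {a..s} f = integral {s..t} f"
proof -
  have "f integrable_on {a..t}"
    using integrable_lebesgue_on_subinterval[OF f order_refl st(3)] by (intro integrable_on_lebesgue_on) auto
  then have "integral {a..t} f = integral {a..s} f + integral {s..t} f"
    using Henstock_Kurzweil_Integration.integral_combine[OF st(1,2)] by metis
  then show ?thesis by simp
qed

lemma abs_cont_on_indefinite_integral: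
  fixes f :: "real \<Rightarrow> 'a::euclidean_space"
  assumes f: "integrable (lebesgue_on {a..b}) f"
  shows "abs_cont_on a b (\<lambda>t. x0 + integral {a..t} f)"
proof (rule abs_cont_on_integral_bound)
  show "integrable (lebesgue_on {a..b}) (\<lambda>t. norm (f t))" using f by (rule integrable_norm)
  show "norm (x0 + integral {a..t} f - (x0 + integral {a..s} f)) \<le> integral {s..t} (\<lambda>t. norm (f t))"
    if "a \<le> s" "s \<le> t" "t \<le> b" for s t
    using integral_diff_interval[OF f that] integral_norm_bound_interval[OF f integrable_norm[OF f] _ that(1,3)] by simp
qed simp

text \<open>exp (l K) / l is absolutely continuous, as a Lipschitz image of K on a bounded range,
  and its derivative is the weighted k. The factor 1/l gained by the integration is what makes
  exponential weights contract.\<close>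

lemma integral_exp_weight:
  fixes k :: "real \<Rightarrow> real"
  assumes k: "integrable (lebesgue_on {a..b}) k" "\<And>t. t \<in> {a..b} \<Longrightarrow> 0 \<le> k t" and l: "l \<noteq> 0"
  defines "K \<equiv> \<lambda>t. integral {a..t} k"
  shows "integrable (lebesgue_on {a..b}) (\<lambda>t. k t * exp (l * K t))"
    and "a \<le> s \<Longrightarrow> s \<le> t \<Longrightarrow> t \<le> b \<Longrightarrow>
      integral {s..t} (\<lambda>r. k r * exp (l * K r)) = (exp (l * K t) - exp (l * K s)) / l"
    (is "_ \<Longrightarrow> _ \<Longrightarrow> _ \<Longrightarrow> ?goal")
proof -
  let ?M = "lebesgue_on {a..b}"
  let ?w = "\<lambda>t. k t * exp (l * K t)"
  have acK: "abs_cont_on a b K" using abs_cont_on_indefinite_integral[OF k(1), of 0] by (simp add: K_def)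
  have cK: "continuous_on {a..b} K" by (rule abs_cont_on_imp_continuous[OF acK])
  have "bounded ((\<lambda>t. l * K t) ` {a..b})"
    by (intro compact_imp_bounded compact_continuous_image continuous_intros cK) simp
  then obtain B where "\<forall>y\<in>(\<lambda>t. l * K t) ` {a..b}. norm y \<le> B" unfolding bounded_iff by blast
  then have B: "l * K t \<le> B" if "t \<in> {a..b}" for t using that by (metis abs_le_D1 imageI real_norm_def)
  have Km: "K \<in> borel_measurable ?M" by (intro continuous_imp_measurable_on_sets_lebesgue cK) simp
  have wm: "?w \<in> borel_measurable ?M" using k(1) Km by measurable
  show int: "integrable ?M ?w"
  proof (rule Bochner_Integration.integrable_bound[OF _ wm])
    show "integrable ?M (\<lambda>t. k t * exp B)" using k(1) by simp
    show "AE t in ?M. norm (?w t) \<le> norm (k t * exp B)"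
      using k(2) B by (intro AE_I2) (auto simp: abs_mult intro!: mult_left_mono)
  qed
  assume st: "a \<le> s" "s \<le> t" "t \<le> b"
  define G where "G t = exp (l * K t) / l" for t
  have exp_lip: "\<bar>exp x - exp y\<bar> \<le> exp B * \<bar>x - y\<bar>" if "x \<le> B" "y \<le> B" for x y :: real
  proof -
    have *: "exp x - exp y \<le> exp B * (x - y)" if "y \<le> x" "x \<le> B" for x y :: real
    proof -
      have "exp x * (1 + (y - x)) \<le> exp x * exp (y - x)" by (intro mult_left_mono exp_ge_add_one_self) simp
      then have "exp x - exp y \<le> exp x * (x - y)" by (simp add: exp_add[symmetric] algebra_simps)
      also have "\<dots> \<le> exp B * (x - y)" using that by (intro mult_right_mono) auto
      finally show ?thesis .
    qed
    show ?thesis using *[of y x] *[of x y] that by (cases "y \<le> x") (auto simp: abs_if)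
  qed
  have acG: "abs_cont_on a b G"
  proof (rule abs_cont_on_compose_le[OF acK, of "exp B"])
    fix s t assume "a \<le> s" "s \<le> t" "t \<le> b"
    then have "\<bar>exp (l * K t) - exp (l * K s)\<bar> \<le> exp B * \<bar>l * K t - l * K s\<bar>" by (intro exp_lip B) auto
    also have "\<dots> = exp B * (\<bar>l\<bar> * \<bar>K t - K s\<bar>)" by (simp add: abs_mult flip: right_diff_distrib)
    finally show "norm (G t - G s) \<le> exp B * norm (K t - K s)"
      using l by (simp add: G_def divide_simps flip: diff_divide_distrib) (simp add: mult.commute mult.left_commute)
  qed simp
  have ab: "a \<le> b" using st by simp
  show ?goal
  proof (cases "a < b")
    case False
    then have "s = t" using st by simp
    then show ?thesis by simp
  next
    case True
    have AEG: "AE t in ?M. vector_derivative G (at t within {a..b}) = ?w t"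
    proof -
      have "AE t in ?M. (K has_vector_derivative k t) (at t within {a..b}) \<and> vector_derivative K (at t within {a..b}) = k t"
        by (rule AE_vector_derivative_of_integral[OF k(1), of K 0]) (simp add: K_def)
      then show ?thesis using AE_space
      proof eventually_elim
        case (elim t)
        then have Kd: "(K has_real_derivative k t) (at t within {a..b})"
          by (simp add: has_real_derivative_iff_has_vector_derivative)
        have "(G has_real_derivative ?w t) (at t within {a..b})"
          unfolding G_def[abs_def] using l by (auto intro!: derivative_eq_intros Kd)
        then have "(G has_vector_derivative ?w t) (at t within {a..b})"
          by (simp add: has_real_derivative_iff_has_vector_derivative)
        then show ?case using elim by (intro vector_derivative_within_closed_interval[OF True]) auto
      qed
    qed
    then have AEl: "AE t in lebesgue. t \<in> {a..b} \<longrightarrow> vector_derivative G (at t within {a..b}) = ?w t"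
      by (subst (asm) AE_restrict_space_iff) auto
    then obtain N where N: "N \<in> null_sets lebesgue"
      "{t \<in> space lebesgue. \<not> (t \<in> {a..b} \<longrightarrow> vector_derivative G (at t within {a..b}) = ?w t)} \<subseteq> N"
      by (auto simp: eventually_ae_filter)
    have "G t - G s = integral {s..t} (\<lambda>t. vector_derivative G (at t within {a..b}))"
      by (rule abs_cont_on_ftc[OF acG ab st])
    also have "\<dots> = integral {s..t} ?w"
    proof (rule integral_spike[of N])
      fix r assume r: "r \<in> {s..t} - N"
      then have "r \<in> {a..b}" using st by auto
      then show "?w r = vector_derivative G (at r within {a..b})" using N(2) r by auto
    qed (use N in \<open>simp add: negligible_iff_null_sets\<close>)
    finally show ?thesis by (simp add: G_def diff_divide_distrib)
  qed
qed

text \<open>Gronwall by the weighted maximum norm: with \<open>u = 1 + norm x\<close>, the maximum \<open>m\<close> of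
  \<open>u exp (- l K)\<close> satisfies \<open>m \<le> u \<tau> + m / 2\<close>, where \<open>l = 2\<close> or \<open>l = - 2\<close>.\<close>

lemma Gronwall_abs_cont:
  fixes x :: "real \<Rightarrow> 'a::euclidean_space"
  assumes x: "abs_cont_on a b x"
    and k: "integrable (lebesgue_on {a..b}) k" "\<And>t. t \<in> {a..b} \<Longrightarrow> 0 \<le> k t"
    and d: "AE t in lebesgue_on {a..b}. norm (vector_derivative x (at t within {a..b})) \<le> k t * (1 + norm (x t))"
    and tau: "\<tau> = a \<or> \<tau> = b" and t: "t \<in> {a..b}"
  shows "1 + norm (x t) \<le> 2 * (1 + norm (x \<tau>)) * exp (2 * integral {a..b} k)"
proof -
  let ?M = "lebesgue_on {a..b}"
  have ab: "a \<le> b" using t by simp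
  define K where "K t = integral {a..t} k" for t
  \<comment> \<open>The sign lets the weight grow away from \<tau>, forward from a or backward from
    b. The size 2 gives the factor 1/2 with which the maximum is absorbed.\<close>
  define l where "l = (if \<tau> = a then 2 else - 2 :: real)"
  have l0: "l \<noteq> 0" by (simp add: l_def)
  have cx: "continuous_on {a..b} x" by (rule abs_cont_on_imp_continuous[OF x])
  have cK: "continuous_on {a..b} K"
    using abs_cont_on_imp_continuous[OF abs_cont_on_indefinite_integral[OF k(1), of 0]] by (simp add: K_def[abs_def])
  have Kdiff: "K t - K s = integral {s..t} k" if "a \<le> s" "s \<le> t" "t \<le> b" for s t
    unfolding K_def by (rule integral_diff_interval[OF k(1) that])
  have Kmono: "K s \<le> K t" if "a \<le> s" "s \<le> t" "t \<le> b" for s t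
  proof -
    have "0 \<le> integral {s..t} k"
      using k(2) that integrable_lebesgue_on_subinterval[OF k(1) that(1,3)]
      by (intro Henstock_Kurzweil_Integration.integral_nonneg integrable_on_lebesgue_on) auto
    then show ?thesis using Kdiff[OF that] by simp
  qed
  have Ka: "K a = 0" by (simp add: K_def)
  have Kt: "0 \<le> K t" "K t \<le> K b" if "t \<in> {a..b}" for t using Kmono[of a t] Kmono[of t b] Ka that by auto
  let ?u = "\<lambda>t. 1 + norm (x t)"
  let ?E = "\<lambda>t. exp (l * K t)"
  have "continuous_on {a..b} (\<lambda>t. ?u t * exp (- (l * K t)))" by (intro continuous_intros cx cK)
  then obtain t1 where t1: "t1 \<in> {a..b}" "\<And>t. t \<in> {a..b} \<Longrightarrow> ?u t * exp (- (l * K t)) \<le> ?u t1 * exp (- (l * K t1))"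
    using continuous_attains_sup[of "{a..b}" "\<lambda>t. ?u t * exp (- (l * K t))"] ab by auto
  define m where "m = ?u t1 * exp (- (l * K t1))"
  have m0: "0 \<le> m" by (simp add: m_def)
  have um: "?u t \<le> m * ?E t" if "t \<in> {a..b}" for t
  proof -
    have "?u t = (?u t * exp (- (l * K t))) * ?E t" by (simp add: exp_minus)
    also have "\<dots> \<le> m * ?E t" unfolding m_def by (intro mult_right_mono t1 that) simp
    finally show ?thesis .
  qed
  have dint: "integrable ?M (\<lambda>t. vector_derivative x (at t within {a..b}))"
    by (rule abs_cont_on_integrable_vector_derivative[OF x ab])
  have wint: "integrable ?M (\<lambda>t. m * (k t * ?E t))"
    using integral_exp_weight(1)[OF k l0] by (simp add: K_def)
  have dw: "AE t in ?M. norm (vector_derivative x (at t within {a..b})) \<le> m * (k t * ?E t)"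
    using d AE_space
  proof eventually_elim
    case (elim t)
    then have t: "t \<in> {a..b}" by simp
    have "k t * ?u t \<le> k t * (m * ?E t)" using k(2)[OF t] um[OF t] by (intro mult_left_mono)
    then show ?case using elim by (simp add: mult.left_commute)
  qed
  have inc: "norm (x t - x s) \<le> m * ((?E t - ?E s) / l)" if st: "a \<le> s" "s \<le> t" "t \<le> b" for s t
  proof -
    have "norm (x t - x s) \<le> integral {s..t} (\<lambda>t. m * (k t * ?E t))"
      unfolding abs_cont_on_ftc[OF x ab st] by (rule integral_norm_bound_interval[OF dint wint dw st(1,3)])
    also have "\<dots> = m * integral {s..t} (\<lambda>t. k t * ?E t)" by (rule integral_mult_right)
    also have "\<dots> = m * ((?E t - ?E s) / l)"
      using integral_exp_weight(2)[OF k l0 st] by (simp add: K_def)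
    finally show ?thesis .
  qed
  have "norm (x t1 - x \<tau>) \<le> m * (?E t1 / 2)"
  proof (cases "\<tau> = a")
    case True
    have "norm (x t1 - x a) \<le> m * ((?E t1 - ?E a) / 2)" using inc[of a t1] t1(1) True by (simp add: l_def)
    also have "\<dots> \<le> m * (?E t1 / 2)" using m0 by (intro mult_left_mono) auto
    finally show ?thesis using True by simp
  next
    case False
    then have tb: "\<tau> = b" "l = -2" using tau by (auto simp: l_def)
    have "norm (x b - x t1) \<le> m * ((?E t1 - ?E b) / 2)"
      using inc[of t1 b] t1(1) unfolding tb by (simp add: field_simps)
    also have "\<dots> \<le> m * (?E t1 / 2)" using m0 by (intro mult_left_mono) auto
    finally show ?thesis using tb by (simp add: norm_minus_commute)
  qed
  moreover have "m * ?E t1 = ?u t1" by (simp add: m_def exp_minus)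
  ultimately have "norm (x t1 - x \<tau>) \<le> ?u t1 / 2" by simp
  moreover have "norm (x t1) \<le> norm (x \<tau>) + norm (x t1 - x \<tau>)" by (rule norm_triangle_sub)
  ultimately have u1: "?u t1 \<le> 2 * ?u \<tau>" by (simp add: field_simps)
  have "?u t \<le> m * ?E t" by (rule um[OF t])
  also have "\<dots> = ?u t1 * exp (l * (K t - K t1))" by (simp add: m_def mult_exp_exp algebra_simps)
  also have "\<dots> \<le> 2 * ?u \<tau> * exp (2 * K b)"
  proof (intro mult_mono u1)
    have "l * (K t - K t1) \<le> 2 * K b" using Kt[OF t] Kt[OF t1(1)] by (auto simp: l_def)
    then show "exp (l * (K t - K t1)) \<le> exp (2 * K b)" by simp
  qed auto
  finally show ?thesis by (simp add: K_def)
qed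

subsection \<open>Finite cost and existence of a trajectory\<close>


context hamiltonian
begin

abbreviation "deriv_on x t \<equiv> vector_derivative x (at t within {a..b})"

abbreviation "cost x u \<equiv> ext_integral {a..b} (\<lambda>t. conj_H H t (x t) (u t))"

text \<open>\<kappa> bounds H t y 0 on the whole ball of radius R and not only along x, so one shift
  works for all members of a bounded sequence and for its limit.\<close>

lemma cost_shift:
  assumes x: "x \<in> borel_measurable I" and u: "u \<in> borel_measurable I"
    and R: "\<And>t. t \<in> {a..b} \<Longrightarrow> norm (x t) \<le> R"
    and k: "integrable I \<kappa>" "\<And>t. t \<in> {a..b} \<Longrightarrow> 0 \<le> \<kappa> t"
      "\<And>t y. t \<in> {a..b} \<Longrightarrow> norm y \<le> R \<Longrightarrow> \<bar>H t y 0\<bar> \<le> \<kappa> t"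
  shows "cost x u + ereal (\<integral>t. \<kappa> t \<partial>I) = enn2ereal (\<integral>\<^sup>+t. e2ennreal (conj_H H t (x t) (u t) + ereal (\<kappa> t)) \<partial>I)"
proof (rule ext_integral_shift[OF conj_H_compose_measurable[OF x u] k(1,2)])
  show "- ereal (\<kappa> t) \<le> conj_H H t (x t) (u t)" if "t \<in> {a..b}" for t
    by (intro conj_H_ge_bound k(3) R that)
qed

lemma obtain_cost_shift:
  assumes x: "x \<in> borel_measurable I" and u: "u \<in> borel_measurable I"
    and R: "0 \<le> R" "\<And>t. t \<in> {a..b} \<Longrightarrow> norm (x t) \<le> R"
  obtains \<kappa> where "integrable I \<kappa>" "\<And>t. t \<in> {a..b} \<Longrightarrow> 0 \<le> \<kappa> t"
    "\<And>t. t \<in> {a..b} \<Longrightarrow> - ereal (\<kappa> t) \<le> conj_H H t (x t) (u t)"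
    "cost x u + ereal (\<integral>t. \<kappa> t \<partial>I) = enn2ereal (\<integral>\<^sup>+t. e2ennreal (conj_H H t (x t) (u t) + ereal (\<kappa> t)) \<partial>I)"
proof -
  obtain \<kappa> where k: "integrable I \<kappa>" "\<And>t. t \<in> {a..b} \<Longrightarrow> 0 \<le> \<kappa> t"
    "\<And>t y. t \<in> {a..b} \<Longrightarrow> norm y \<le> R \<Longrightarrow> \<bar>H t y 0\<bar> \<le> \<kappa> t"
    using obtain_H_bound[OF R(1)] by metis
  show thesis
  proof (rule that[OF k(1,2)])
    show "- ereal (\<kappa> t) \<le> conj_H H t (x t) (u t)" if "t \<in> {a..b}" for t
      by (intro conj_H_ge_bound k(3) R that)
    show "cost x u + ereal (\<integral>t. \<kappa> t \<partial>I) = enn2ereal (\<integral>\<^sup>+t. e2ennreal (conj_H H t (x t) (u t) + ereal (\<kappa> t)) \<partial>I)"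
      by (rule cost_shift[OF x u R(2) k])
  qed
qed

lemma cost_neg_part:
  assumes x: "x \<in> borel_measurable I" and u: "u \<in> borel_measurable I"
    and R: "0 \<le> R" "\<And>t. t \<in> {a..b} \<Longrightarrow> norm (x t) \<le> R"
  shows "(\<integral>\<^sup>+ t. e2ennreal (max 0 (- conj_H H t (x t) (u t))) \<partial>I) \<noteq> \<infinity>"
proof -
  obtain \<kappa> where k: "integrable I \<kappa>" "\<And>t. t \<in> {a..b} \<Longrightarrow> 0 \<le> \<kappa> t"
    and ge: "\<And>t. t \<in> {a..b} \<Longrightarrow> - ereal (\<kappa> t) \<le> conj_H H t (x t) (u t)"
    and shift: "cost x u + ereal (\<integral>t. \<kappa> t \<partial>I) = enn2ereal (\<integral>\<^sup>+t. e2ennreal (conj_H H t (x t) (u t) + ereal (\<kappa> t)) \<partial>I)"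
    using obtain_cost_shift[OF x u R] by blast
  have "(\<integral>\<^sup>+ t. e2ennreal (max 0 (- conj_H H t (x t) (u t))) \<partial>I) \<le> (\<integral>\<^sup>+ t. ennreal (\<kappa> t) \<partial>I)"
  proof (rule nn_integral_mono)
    fix t assume "t \<in> space I"
    then have t: "t \<in> {a..b}" by simp
    have "max 0 (- conj_H H t (x t) (u t)) \<le> ereal (\<kappa> t)"
      using ge[OF t] k(2)[OF t] by (cases "conj_H H t (x t) (u t)") auto
    then show "e2ennreal (max 0 (- conj_H H t (x t) (u t))) \<le> ennreal (\<kappa> t)"
      using e2ennreal_mono by (fastforce simp flip: e2ennreal_ereal)
  qed
  also have "\<dots> = ennreal (\<integral>t. \<kappa> t \<partial>I)"
    by (rule nn_integral_eq_integral[OF k(1)]) (use k(2) in \<open>auto intro: AE_I2\<close>)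
  finally show ?thesis by (auto simp: top_unique)
qed

lemma cost_not_MInf:
  assumes x: "x \<in> borel_measurable I" and u: "u \<in> borel_measurable I"
    and R: "0 \<le> R" "\<And>t. t \<in> {a..b} \<Longrightarrow> norm (x t) \<le> R"
  shows "cost x u \<noteq> -\<infinity>"
proof -
  obtain \<kappa> where k: "integrable I \<kappa>" "\<And>t. t \<in> {a..b} \<Longrightarrow> 0 \<le> \<kappa> t"
    and ge: "\<And>t. t \<in> {a..b} \<Longrightarrow> - ereal (\<kappa> t) \<le> conj_H H t (x t) (u t)"
    and shift: "cost x u + ereal (\<integral>t. \<kappa> t \<partial>I) = enn2ereal (\<integral>\<^sup>+t. e2ennreal (conj_H H t (x t) (u t) + ereal (\<kappa> t)) \<partial>I)"
    using obtain_cost_shift[OF x u R] by blast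
  have "0 \<le> cost x u + ereal (\<integral>t. \<kappa> t \<partial>I)"
    unfolding shift by simp
  then show ?thesis by auto
qed

lemma cost_finiteD:
  assumes x: "x \<in> borel_measurable I" and u: "u \<in> borel_measurable I"
    and R: "0 \<le> R" "\<And>t. t \<in> {a..b} \<Longrightarrow> norm (x t) \<le> R"
    and fin: "cost x u < \<infinity>"
  shows "AE t in I. conj_H H t (x t) (u t) < \<infinity>"
    and "integrable I (\<lambda>t. real_of_ereal (conj_H H t (x t) (u t)))"
proof -
  obtain \<kappa> where k: "integrable I \<kappa>" "\<And>t. t \<in> {a..b} \<Longrightarrow> 0 \<le> \<kappa> t"
    and ge: "\<And>t. t \<in> {a..b} \<Longrightarrow> - ereal (\<kappa> t) \<le> conj_H H t (x t) (u t)"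
    and shift: "cost x u + ereal (\<integral>t. \<kappa> t \<partial>I) = enn2ereal (\<integral>\<^sup>+t. e2ennreal (conj_H H t (x t) (u t) + ereal (\<kappa> t)) \<partial>I)"
    using obtain_cost_shift[OF x u R] by blast
  let ?h = "\<lambda>t. conj_H H t (x t) (u t)"
  have km[measurable]: "\<kappa> \<in> borel_measurable I" using k(1) by simp
  have hm[measurable]: "?h \<in> borel_measurable I" by (rule conj_H_compose_measurable[OF x u])
  have "enn2ereal (\<integral>\<^sup>+t. e2ennreal (?h t + ereal (\<kappa> t)) \<partial>I) < \<infinity>"
    using fin unfolding shift[symmetric] by auto
  then have nn: "(\<integral>\<^sup>+t. e2ennreal (?h t + ereal (\<kappa> t)) \<partial>I) \<noteq> \<infinity>"
    by auto
  have "AE t in I. e2ennreal (?h t + ereal (\<kappa> t)) \<noteq> \<infinity>"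
    by (rule nn_integral_PInf_AE[OF _ nn]) measurable
  then show AE: "AE t in I. ?h t < \<infinity>"
    by eventually_elim auto
  let ?r = "\<lambda>t. real_of_ereal (?h t)"
  have AE2: "AE t in I. e2ennreal (?h t + ereal (\<kappa> t)) = ennreal (?r t + \<kappa> t) \<and> 0 \<le> ?r t + \<kappa> t"
    using AE AE_space
  proof eventually_elim
    case (elim t)
    then have t: "t \<in> {a..b}" by simp
    obtain r where r: "?h t = ereal r" using conj_H_real[OF elim(1)] by metis
    have "- \<kappa> t \<le> r" using ge[OF t] r by simp
    then show ?case using r by (simp add: e2ennreal_ereal)
  qed
  have "integrable I (\<lambda>t. ?r t + \<kappa> t)"
  proof (rule integrableI_nonneg)
    show "(\<lambda>t. ?r t + \<kappa> t) \<in> borel_measurable I" by measurable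
    show "AE t in I. 0 \<le> ?r t + \<kappa> t" using AE2 by eventually_elim simp
    have "(\<integral>\<^sup>+t. ennreal (?r t + \<kappa> t) \<partial>I) = (\<integral>\<^sup>+t. e2ennreal (?h t + ereal (\<kappa> t)) \<partial>I)"
      by (rule nn_integral_cong_AE) (use AE2 in eventually_elim, simp)
    then show "(\<integral>\<^sup>+t. ennreal (?r t + \<kappa> t) \<partial>I) < \<infinity>" using nn by (simp add: less_top)
  qed
  then have "integrable I (\<lambda>t. (?r t + \<kappa> t) - \<kappa> t)" using k(1) by (rule Bochner_Integration.integrable_diff)
  then show "integrable I ?r" by simp
qed

lemma cost_finiteI:
  assumes x: "x \<in> borel_measurable I" and u: "u \<in> borel_measurable I"
    and R: "0 \<le> R" "\<And>t. t \<in> {a..b} \<Longrightarrow> norm (x t) \<le> R"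
    and g: "integrable I g" "AE t in I. conj_H H t (x t) (u t) \<le> ereal (g t)"
  shows "cost x u < \<infinity>"
proof -
  obtain \<kappa> where k: "integrable I \<kappa>" "\<And>t. t \<in> {a..b} \<Longrightarrow> 0 \<le> \<kappa> t"
    and ge: "\<And>t. t \<in> {a..b} \<Longrightarrow> - ereal (\<kappa> t) \<le> conj_H H t (x t) (u t)"
    and shift: "cost x u + ereal (\<integral>t. \<kappa> t \<partial>I) = enn2ereal (\<integral>\<^sup>+t. e2ennreal (conj_H H t (x t) (u t) + ereal (\<kappa> t)) \<partial>I)"
    using obtain_cost_shift[OF x u R] by blast
  have "(\<integral>\<^sup>+t. e2ennreal (conj_H H t (x t) (u t) + ereal (\<kappa> t)) \<partial>I) \<le> (\<integral>\<^sup>+t. ennreal (norm (g t + \<kappa> t)) \<partial>I)"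
  proof (rule nn_integral_mono_AE)
    show "AE t in I. e2ennreal (conj_H H t (x t) (u t) + ereal (\<kappa> t)) \<le> ennreal (norm (g t + \<kappa> t))"
      using g(2)
    proof eventually_elim
      case (elim t)
      then have "conj_H H t (x t) (u t) + ereal (\<kappa> t) \<le> ereal (norm (g t + \<kappa> t))"
        by (cases "conj_H H t (x t) (u t)") auto
      then show ?case using e2ennreal_mono by (fastforce simp flip: e2ennreal_ereal)
    qed
  qed
  also have "\<dots> < \<infinity>"
    using Bochner_Integration.integrable_add[OF g(1) k(1)] unfolding integrable_iff_bounded by simp
  finally have "cost x u + ereal (\<integral>t. \<kappa> t \<partial>I) < \<infinity>"
    unfolding shift by (simp add: less_top[symmetric])
  then show ?thesis by auto
qed

lemma AC_regularity:
  fixes x :: "real \<Rightarrow> 'a"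
  assumes "abs_cont_on a b x"
  shows "x \<in> borel_measurable I" "deriv_on x \<in> borel_measurable I" "integrable I (deriv_on x)"
  using abs_cont_on_measurable[OF assms] abs_cont_on_integrable_vector_derivative[OF assms ab] by auto

lemma cost_le_Lambda:
  assumes "(x, w) \<in> Lambda_adm H a b"
  shows "cost x (deriv_on x) \<le> ext_integral {a..b} (\<lambda>t. ereal (steiner_l H t (x t) (w t)))"
proof -
  have x: "abs_cont_on a b x" and d: "AE t in I. deriv_on x t = steiner_f H t (x t) (w t)"
    using assms by (auto simp: Lambda_adm_def)
  obtain R where R: "0 \<le> R" "\<And>t. t \<in> {a..b} \<Longrightarrow> norm (x t) \<le> R" using abs_cont_on_bounded[OF x] by metis
  show ?thesis
  proof (rule ext_integral_mono_AE)
    show "AE t in I. conj_H H t (x t) (deriv_on x t) \<le> ereal (steiner_l H t (x t) (w t))"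
      using d AE_space by eventually_elim (simp add: conj_H_steiner_le)
  qed (rule cost_neg_part[OF AC_regularity(1,2)[OF x] R])
qed

text \<open>Finite cost makes the conjugate finite almost everywhere and integrable, hence the
  control integrable. Where the conjugate is infinite, \<open>real_of_ereal\<close> returns 0 and
  nothing is claimed about the Steiner pair; this is a null set.\<close>

lemma canonical_control:
  assumes x: "abs_cont_on a b x" and fin: "cost x (deriv_on x) < \<infinity>"
  defines "w \<equiv> \<lambda>t. (deriv_on x t, real_of_ereal (conj_H H t (x t) (deriv_on x t)))"
  shows "(x, w) \<in> Lambda_adm H a b"
    and "ext_integral {a..b} (\<lambda>t. ereal (steiner_l H t (x t) (w t))) = cost x (deriv_on x)"
proof -
  obtain R where R: "0 \<le> R" "\<And>t. t \<in> {a..b} \<Longrightarrow> norm (x t) \<le> R" using abs_cont_on_bounded[OF x] by metis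
  have C1: "AE t in I. conj_H H t (x t) (deriv_on x t) < \<infinity>"
    by (rule cost_finiteD(1)[OF AC_regularity(1,2)[OF x] R fin])
  have C2: "integrable I (\<lambda>t. real_of_ereal (conj_H H t (x t) (deriv_on x t)))"
    by (rule cost_finiteD(2)[OF AC_regularity(1,2)[OF x] R fin])
  have e: "AE t in I. steiner_f H t (x t) (w t) = deriv_on x t \<and>
      ereal (steiner_l H t (x t) (w t)) = conj_H H t (x t) (deriv_on x t)"
    using C1 AE_space
  proof eventually_elim
    case (elim t)
    then have t: "t \<in> {a..b}" by simp
    note r = conj_H_real[OF elim(1)]
    show ?case unfolding w_def using steiner_epi[OF t eq_refl[OF r[symmetric]]] r by simp
  qed
  have "integrable I w"
    unfolding w_def integrable_iff_bounded
  proof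
    show "(\<lambda>t. (deriv_on x t, real_of_ereal (conj_H H t (x t) (deriv_on x t)))) \<in> borel_measurable I"
      using AC_regularity(2)[OF x] C2 by (intro borel_measurable_Pair) auto
    have "(\<integral>\<^sup>+ t. ennreal (norm (deriv_on x t, real_of_ereal (conj_H H t (x t) (deriv_on x t)))) \<partial>I)
       \<le> (\<integral>\<^sup>+ t. ennreal (norm (norm (deriv_on x t) + \<bar>real_of_ereal (conj_H H t (x t) (deriv_on x t))\<bar>)) \<partial>I)"
    proof (rule nn_integral_mono, rule ennreal_leI)
      fix t
      show "norm (deriv_on x t, real_of_ereal (conj_H H t (x t) (deriv_on x t)))
        \<le> norm (norm (deriv_on x t) + \<bar>real_of_ereal (conj_H H t (x t) (deriv_on x t))\<bar>)"
        using norm_Pair_le[of "deriv_on x t" "real_of_ereal (conj_H H t (x t) (deriv_on x t))"] by simp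
    qed
    also have "\<dots> < \<infinity>"
      using Bochner_Integration.integrable_add[OF integrable_norm[OF AC_regularity(3)[OF x]] integrable_abs[OF C2]]
      unfolding integrable_iff_bounded by simp
    finally show "(\<integral>\<^sup>+ t. ennreal (norm (deriv_on x t, real_of_ereal (conj_H H t (x t) (deriv_on x t)))) \<partial>I) < \<infinity>" .
  qed
  moreover have "AE t in I. deriv_on x t = steiner_f H t (x t) (w t)" using e by eventually_elim simp
  ultimately show "(x, w) \<in> Lambda_adm H a b" using x by (simp add: Lambda_adm_def)
  show "ext_integral {a..b} (\<lambda>t. ereal (steiner_l H t (x t) (w t))) = cost x (deriv_on x)"
    by (rule ext_integral_cong_AE) (use e in eventually_elim, simp)
qed

section \<open>Picard iteration for the field \<open>vel\<close>\<close>

primrec picard :: "nat \<Rightarrow> real \<Rightarrow> 'a" where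
  "picard 0 t = 0"
| "picard (Suc n) t = integral {a..t} (\<lambda>s. vel s (picard n s))"

abbreviation "C t \<equiv> integral {a..t} c"

lemma vel_integrable:
  assumes "y \<in> borel_measurable I" "integrable I g" "\<And>t. t \<in> {a..b} \<Longrightarrow> c t * (1 + norm (y t)) \<le> g t"
  shows "integrable I (\<lambda>t. vel t (y t))"
proof (rule Bochner_Integration.integrable_bound[OF assms(2)])
  show "(\<lambda>t. vel t (y t)) \<in> borel_measurable I" by (rule vel_compose_measurable[OF assms(1)])
  show "AE t in I. norm (vel t (y t)) \<le> norm (g t)"
  proof (rule AE_I2)
    fix t assume "t \<in> space I"
    then have t: "t \<in> {a..b}" by simp
    show "norm (vel t (y t)) \<le> norm (g t)"
      using norm_vel_le[OF t, of "y t"] assms(3)[OF t] by simp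
  qed
qed

text \<open>The integral of 2 c exp (2 C) up to t is exp (2 C t) - 1, so a bound of this form
  reproduces itself. It is independent of n, which allows a single Lipschitz function for all
  iterates.\<close>

lemma picard_bound:
  "abs_cont_on a b (picard n) \<and> (\<forall>t\<in>{a..b}. 1 + norm (picard n t) \<le> 2 * exp (2 * C t))"
proof -
  have C0: "0 \<le> C t" if "t \<in> {a..b}" for t
    using c_nonneg that integrable_lebesgue_on_subinterval[OF c_int order_refl, of t]
    by (intro Henstock_Kurzweil_Integration.integral_nonneg integrable_on_lebesgue_on) auto
  let ?w = "\<lambda>t. 2 * (c t * exp (2 * C t))"
  have wint: "integrable I ?w" using integral_exp_weight(1)[OF c_int c_nonneg, of 2] by simp
  show ?thesis
  proof (induction n)
    case 0
    have "abs_cont_on a b (\<lambda>t. 0 + integral {a..t} (\<lambda>_. 0 :: 'a))" by (rule abs_cont_on_indefinite_integral) simp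
    then have "abs_cont_on a b (picard 0)" by (simp add: picard.simps(1)[abs_def])
    moreover have "1 + norm (picard 0 t) \<le> 2 * exp (2 * C t)" if "t \<in> {a..b}" for t
      using C0[OF that] one_le_exp_iff[of "2 * C t"] by (simp, linarith)
    ultimately show ?case by blast
  next
    case (Suc n)
    have le: "c t * (1 + norm (picard n t)) \<le> ?w t" if "t \<in> {a..b}" for t
      using mult_left_mono[OF _ c_nonneg[OF that], of "1 + norm (picard n t)" "2 * exp (2 * C t)"] Suc that
      by (simp add: mult.left_commute)
    have vi: "integrable I (\<lambda>t. vel t (picard n t))"
      using Suc by (intro vel_integrable[OF _ wint] le AC_regularity(1)) auto
    have "abs_cont_on a b (\<lambda>t. 0 + integral {a..t} (\<lambda>t. vel t (picard n t)))" by (rule abs_cont_on_indefinite_integral[OF vi])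
    then have ac: "abs_cont_on a b (picard (Suc n))" by (simp add: picard.simps(2)[abs_def])
    have "1 + norm (picard (Suc n) t) \<le> 2 * exp (2 * C t)" if t: "t \<in> {a..b}" for t
    proof -
      have "AE t in I. norm (vel t (picard n t)) \<le> ?w t"
      proof (rule AE_I2)
        fix s assume "s \<in> space I"
        then have s: "s \<in> {a..b}" by simp
        show "norm (vel s (picard n s)) \<le> ?w s" using norm_vel_le[OF s, of "picard n s"] le[OF s] by simp
      qed
      then have "norm (picard (Suc n) t) \<le> integral {a..t} ?w"
        unfolding picard.simps by (rule integral_norm_bound_interval[OF vi wint]) (use t in auto)
      also have "\<dots> = 2 * integral {a..t} (\<lambda>t. c t * exp (2 * C t))" by (rule integral_mult_right)
      also have "\<dots> = exp (2 * C t) - 1"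
        using integral_exp_weight(2)[OF c_int c_nonneg, of 2 a t] t by simp
      finally show ?thesis by (simp add: order_trans[OF _ mult_right_mono[of 1 2]])
    qed
    then show ?case using ac by blast
  qed
qed

text \<open>Needed when \<open>\<Gamma>\<close> is identically \<open>\<infinity>\<close>: without it the infimum of \<open>\<Lambda>\<close> could be over the empty set
  and would not be attained.\<close>

lemma exists_finite_cost: "\<exists>x. abs_cont_on a b x \<and> cost x (deriv_on x) < \<infinity>"
proof -
  have Cmono: "C t \<le> C b" if "t \<in> {a..b}" for t
  proof -
    have "0 \<le> integral {t..b} c"
      using c_nonneg that integrable_lebesgue_on_subinterval[OF c_int, of t b]
      by (intro Henstock_Kurzweil_Integration.integral_nonneg integrable_on_lebesgue_on) auto
    then show ?thesis using integral_diff_interval[OF c_int, of t b] that by simp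
  qed
  define R where "R = 2 * exp (2 * C b)"
  have R0: "0 < R" by (simp add: R_def)
  have pR: "norm (picard n t) \<le> R" if "t \<in> {a..b}" for n t
  proof -
    have "1 + norm (picard n t) \<le> 2 * exp (2 * C t)" using picard_bound that by blast
    also have "\<dots> \<le> R" using Cmono[OF that] by (simp add: R_def)
    finally show ?thesis by simp
  qed
  obtain k where k: "integrable I k" "\<And>t. t \<in> {a..b} \<Longrightarrow> 0 \<le> k t"
    "\<And>t x y p. t \<in> {a..b} \<Longrightarrow> norm x \<le> R \<Longrightarrow> norm y \<le> R \<Longrightarrow> \<bar>H t x p - H t y p\<bar> \<le> k t * (1 + norm p) * norm (x - y)"
    using H_loc_lip[OF R0] by (auto simp: dist_norm)
  define A where "A = 2 / bump_mass TYPE('a) * measure lborel (ball (0::'a) 1)"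
  have A0: "0 \<le> A" using bump_mass_pos[where 'b = 'a] by (simp add: A_def)
  \<comment> \<open>The Lipschitz function of \<open>vel\<close>: 2 bounds 1 + norm z on the unit
    ball, and A is the constant of \<open>vel_lipschitz\<close>.\<close>
  define \<kappa> where "\<kappa> t = A * (k t * 2)" for t
  have kint: "integrable I \<kappa>" using k(1) unfolding \<kappa>_def[abs_def] by (intro integrable_mult_right integrable_mult_left)
  have k0: "0 \<le> \<kappa> t" if "t \<in> {a..b}" for t using k(2)[OF that] A0 by (simp add: \<kappa>_def)
  have vlip: "norm (vel t x - vel t y) \<le> \<kappa> t * norm (x - y)"
    if t: "t \<in> {a..b}" and xy: "norm x \<le> R" "norm y \<le> R" for t x y
  proof -
    have "norm (vel t x - vel t y) \<le> A * (k t * 2 * norm (x - y))"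
      unfolding A_def
    proof (rule vel_lipschitz[OF t])
      show "0 \<le> k t * 2 * norm (x - y)" using k(2)[OF t] by simp
      fix z :: 'a assume "norm z \<le> 1"
      then have "k t * (1 + norm z) * norm (x - y) \<le> k t * 2 * norm (x - y)"
        using k(2)[OF t] by (intro mult_right_mono mult_left_mono) auto
      then show "\<bar>H t x z - H t y z\<bar> \<le> k t * 2 * norm (x - y)" using k(3)[OF t xy, of z] by linarith
    qed
    then show ?thesis by (simp add: \<kappa>_def mult.assoc)
  qed
  let ?K = "\<lambda>t. integral {a..t} \<kappa>"
  have vpint: "integrable I (\<lambda>t. vel t (picard n t))" for n
  proof (rule vel_integrable)
    show "picard n \<in> borel_measurable I" using picard_bound AC_regularity(1) by blast
    show "integrable I (\<lambda>t. c t * (1 + R))" using c_int by simp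
    show "c t * (1 + norm (picard n t)) \<le> c t * (1 + R)" if "t \<in> {a..b}" for t
      using pR[OF that] c_nonneg[OF that] by (intro mult_left_mono) auto
  qed
  have K0: "0 \<le> ?K t" if "t \<in> {a..b}" for t
    using k0 that integrable_lebesgue_on_subinterval[OF kint order_refl, of t]
    by (intro Henstock_Kurzweil_Integration.integral_nonneg integrable_on_lebesgue_on) auto
  \<comment> \<open>In the maximum norm weighted by exp (- 2 K) every iteration contracts by 1/2,
    however large the integral of \<kappa>, so the interval is not subdivided.\<close>
  have diff: "\<forall>t\<in>{a..b}. norm (picard (Suc n) t - picard n t) \<le> R * (1/2) ^ n * exp (2 * ?K t)" for n
  proof (induction n)
    case 0
    show ?case
    proof
      fix t assume t: "t \<in> {a..b}"
      have "norm (picard (Suc 0) t) \<le> R * 1" using pR[OF t, of "Suc 0"] by simp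
      also have "\<dots> \<le> R * exp (2 * ?K t)" using R0 K0[OF t] by (intro mult_left_mono) auto
      finally show "norm (picard (Suc 0) t - picard 0 t) \<le> R * (1/2) ^ 0 * exp (2 * ?K t)" by simp
    qed
  next
    case (Suc n)
    show ?case
    proof
      fix t assume t: "t \<in> {a..b}"
      let ?g = "\<lambda>s. R * (1/2) ^ n * (\<kappa> s * exp (2 * ?K s))"
      have gint: "integrable I ?g"
        using integral_exp_weight(1)[OF kint k0, of 2] by (intro integrable_mult_right) auto
      have on: "(\<lambda>s. vel s (picard m s)) integrable_on {a..t}" for m
        using integrable_lebesgue_on_subinterval[OF vpint order_refl, of t] t by (intro integrable_on_lebesgue_on) auto
      have eq: "picard (Suc (Suc n)) t - picard (Suc n) t = integral {a..t} (\<lambda>s. vel s (picard (Suc n) s) - vel s (picard n s))"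
        using Henstock_Kurzweil_Integration.integral_diff[OF on[of "Suc n"] on[of n]]
          picard.simps(2)[of "Suc n" t] picard.simps(2)[of n t] by (simp only:)
      have "norm (picard (Suc (Suc n)) t - picard (Suc n) t) \<le> integral {a..t} ?g"
        unfolding eq
      proof (rule integral_norm_bound_interval[OF _ gint])
        show "integrable I (\<lambda>s. vel s (picard (Suc n) s) - vel s (picard n s))"
          by (intro Bochner_Integration.integrable_diff vpint)
        show "AE s in I. norm (vel s (picard (Suc n) s) - vel s (picard n s)) \<le> ?g s"
        proof (rule AE_I2)
          fix s assume "s \<in> space I"
          then have s: "s \<in> {a..b}" by simp
          have "norm (vel s (picard (Suc n) s) - vel s (picard n s)) \<le> \<kappa> s * norm (picard (Suc n) s - picard n s)"
            by (intro vlip s pR)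
          also have "\<dots> \<le> \<kappa> s * (R * (1/2) ^ n * exp (2 * ?K s))" using Suc s k0[OF s] by (intro mult_left_mono) auto
          finally show "norm (vel s (picard (Suc n) s) - vel s (picard n s)) \<le> ?g s" by (simp only: ac_simps)
        qed
      qed (use t in auto)
      also have "\<dots> = R * (1/2) ^ n * integral {a..t} (\<lambda>s. \<kappa> s * exp (2 * ?K s))" by (rule integral_mult_right)
      also have "\<dots> = R * (1/2) ^ n * ((exp (2 * ?K t) - 1) / 2)"
        using integral_exp_weight(2)[OF kint k0, of 2 a t] t by simp
      also have "\<dots> \<le> R * (1/2) ^ n * (exp (2 * ?K t) / 2)" using R0 by (intro mult_left_mono) auto
      finally show "norm (picard (Suc (Suc n)) t - picard (Suc n) t) \<le> R * (1/2) ^ Suc n * exp (2 * ?K t)" by simp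
    qed
  qed
  have conv: "convergent (\<lambda>n. picard n t)" if t: "t \<in> {a..b}" for t
  proof -
    have "summable (\<lambda>n. picard (Suc n) t - picard n t)"
    proof (rule summable_comparison_test'[where N = 0])
      show "summable (\<lambda>n. R * (1/2) ^ n * exp (2 * ?K t))"
        by (intro summable_mult summable_mult2 summable_geometric) simp
    qed (use diff t in blast)
    then have "convergent (\<lambda>n. \<Sum>i<n. picard (Suc i) t - picard i t)" by (simp add: summable_iff_convergent)
    then show ?thesis
      by (simp only: sum_lessThan_telescope[of "\<lambda>i. picard i t"] picard.simps(1) diff_zero)
  qed
  define x where "x t = (if t \<in> {a..b} then lim (\<lambda>n. picard n t) else 0)" for t
  have lim: "(\<lambda>n. picard n t) \<longlonglongrightarrow> x t" if "t \<in> {a..b}" for t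
    using conv[OF that] that by (simp add: x_def convergent_LIMSEQ_iff)
  have xR: "norm (x t) \<le> R" if "t \<in> {a..b}" for t
    by (rule LIMSEQ_le_const2[OF tendsto_norm[OF lim[OF that]]]) (use pR[OF that] in auto)
  have xm: "x \<in> borel_measurable I"
    by (rule borel_measurable_LIMSEQ_metric[where f = picard]) (use lim picard_bound AC_regularity(1) in auto)
  have cR: "c t * (1 + norm (x t)) \<le> c t * (1 + R)" if "t \<in> {a..b}" for t
    using xR[OF that] c_nonneg[OF that] by (intro mult_left_mono) auto
  have cRint: "integrable I (\<lambda>t. c t * (1 + R))" using c_int by simp
  have vxint: "integrable I (\<lambda>t. vel t (x t))" by (rule vel_integrable[OF xm cRint cR])
  have xeq: "x t = 0 + integral {a..t} (\<lambda>s. vel s (x s))" if "a \<le> t" "t \<le> b" for t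
  proof -
    have t: "t \<in> {a..b}" using that by simp
    have "(\<lambda>n. integral {a..t} (\<lambda>s. vel s (picard n s))) \<longlonglongrightarrow> integral {a..t} (\<lambda>s. vel s (x s))"
    proof (rule dominated_convergence(2)[where h = "\<lambda>s. c s * (1 + R)"])
      show "(\<lambda>s. vel s (picard n s)) integrable_on {a..t}" for n
        using integrable_lebesgue_on_subinterval[OF vpint order_refl that(2)] by (intro integrable_on_lebesgue_on) auto
      show "(\<lambda>s. c s * (1 + R)) integrable_on {a..t}"
        using integrable_lebesgue_on_subinterval[OF cRint order_refl that(2)] by (intro integrable_on_lebesgue_on) auto
      show "norm (vel s (picard n s)) \<le> c s * (1 + R)" if s: "s \<in> {a..t}" for n s
      proof -
        have s': "s \<in> {a..b}" using s t by auto
        have "c s * (1 + norm (picard n s)) \<le> c s * (1 + R)" using pR[OF s'] c_nonneg[OF s'] by (intro mult_left_mono) auto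
        then show ?thesis using norm_vel_le[OF s', of "picard n s"] by linarith
      qed
      show "(\<lambda>n. vel s (picard n s)) \<longlonglongrightarrow> vel s (x s)" if s: "s \<in> {a..t}" for s
      proof -
        have s': "s \<in> {a..b}" using s t by auto
        have "(\<lambda>n. \<kappa> s * norm (picard n s - x s)) \<longlonglongrightarrow> \<kappa> s * norm (x s - x s)"
          by (intro tendsto_intros lim[OF s'])
        then have z: "(\<lambda>n. \<kappa> s * norm (picard n s - x s)) \<longlonglongrightarrow> 0" by simp
        have "(\<lambda>n. vel s (picard n s) - vel s (x s)) \<longlonglongrightarrow> 0"
          by (rule Lim_null_comparison[OF _ z]) (intro always_eventually allI vlip s' pR xR)
        then show ?thesis by (simp add: LIM_zero_iff)
      qed
    qed
    moreover have "(\<lambda>n. integral {a..t} (\<lambda>s. vel s (picard n s))) \<longlonglongrightarrow> x t"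
      using LIMSEQ_Suc[OF lim[OF t]] by simp
    ultimately show ?thesis using LIMSEQ_unique by auto
  qed
  have "abs_cont_on a b (\<lambda>t. 0 + integral {a..t} (\<lambda>s. vel s (x s)))" by (rule abs_cont_on_indefinite_integral[OF vxint])
  \<comment> \<open>x is set to 0 outside {a..b} and equals the indefinite integral only on the
    interval; hence the comparison of increments with L = 1.\<close>
  then have xac: "abs_cont_on a b x"
  proof (rule abs_cont_on_compose_le[where L = 1])
    fix s t assume st: "a \<le> s" "s \<le> t" "t \<le> b"
    have e: "x s = 0 + integral {a..s} (\<lambda>s. vel s (x s))" "x t = 0 + integral {a..t} (\<lambda>s. vel s (x s))"
      using st by (intro xeq; simp)+
    show "norm (x t - x s) \<le> 1 * norm (0 + integral {a..t} (\<lambda>s. vel s (x s)) - (0 + integral {a..s} (\<lambda>s. vel s (x s))))"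
      unfolding e[symmetric] by simp
  qed simp
  have dx: "AE t in I. (x has_vector_derivative vel t (x t)) (at t within {a..b}) \<and> deriv_on x t = vel t (x t)"
    by (rule AE_vector_derivative_of_integral[OF vxint xeq])
  obtain \<mu> where m: "integrable I \<mu>" "\<And>t y. t \<in> {a..b} \<Longrightarrow> norm y \<le> R \<Longrightarrow> \<bar>H t y 0\<bar> \<le> \<mu> t"
    using obtain_H_bound[of R] R0 by (metis less_imp_le)
  have "cost x (deriv_on x) < \<infinity>"
  proof (rule cost_finiteI[OF AC_regularity(1,2)[OF xac] less_imp_le[OF R0] xR])
    show "integrable I (\<lambda>t. \<mu> t + 2 * (c t * (1 + R)))"
      by (intro Bochner_Integration.integrable_add m integrable_mult_right cRint)
    show "AE t in I. conj_H H t (x t) (deriv_on x t) \<le> ereal (\<mu> t + 2 * (c t * (1 + R)))"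
      using dx AE_space
    proof eventually_elim
      case (elim t)
      then have t: "t \<in> {a..b}" by simp
      have "- H t (x t) 0 \<le> \<mu> t" using m(2)[OF t xR[OF t]] by linarith
      then have "- H t (x t) 0 + 2 * c t * (1 + norm (x t)) \<le> \<mu> t + 2 * (c t * (1 + R))"
        using cR[OF t] by (simp add: mult.assoc)
      then show ?case using conj_H_vel[OF t, of "x t"] elim(1) by (auto intro: order_trans)
    qed
  qed auto
  then show ?thesis using xac by blast
qed

end

subsection \<open>Weak convergence and lower semicontinuity\<close>


text \<open>The sets over which the integrals converge form a Dynkin system containing the half-lines.\<close>

lemma dominated_weak_convergence:
  fixes U :: "nat \<Rightarrow> real \<Rightarrow> 'a::euclidean_space"
  assumes U: "\<And>n. integrable (lebesgue_on {a..b}) (U n)" and u: "integrable (lebesgue_on {a..b}) u"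
    and m: "integrable (lebesgue_on {a..b}) m" and dom: "\<And>n. AE t in lebesgue_on {a..b}. norm (U n t) \<le> m t"
    and lim: "\<And>t. t \<in> {a..b} \<Longrightarrow> (\<lambda>n. integral {a..t} (U n)) \<longlonglongrightarrow> integral {a..t} u"
    and A: "A \<in> sets (lebesgue_on {a..b})"
  shows "(\<lambda>n. \<integral>t. indicator A t *\<^sub>R U n t \<partial>lebesgue_on {a..b}) \<longlonglongrightarrow> (\<integral>t. indicator A t *\<^sub>R u t \<partial>lebesgue_on {a..b})"
proof -
  let ?M = "lebesgue_on {a..b}"
  define F where "F v A = (\<integral>t. indicator A t *\<^sub>R v t \<partial>?M)" for v :: "real \<Rightarrow> 'a" and A
  have sb: "B \<inter> {a..b} \<in> sets ?M" if "B \<in> sets borel" for B :: "real set"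
    using that by (auto simp: sets_restrict_space)
  have Fi: "integrable ?M (\<lambda>t. indicator B t *\<^sub>R v t)" if "B \<in> sets borel" "integrable ?M v" for B and v :: "real \<Rightarrow> 'b::euclidean_space"
  proof -
    have "integrable ?M (\<lambda>t. indicator (B \<inter> {a..b}) t *\<^sub>R v t)"
      by (rule integrable_mult_indicator[OF sb[OF that(1)] that(2)])
    then show ?thesis
      by (rule Bochner_Integration.integrable_cong[THEN iffD1, rotated -1]) (auto simp: indicator_def)
  qed
  have F_atMost: "F v {..x} = (if x < a then 0 else integral {a..min x b} v)"
    if v: "integrable ?M v" and ab: "a \<le> b" for v x
  proof (cases "x < a")
    case True
    have "F v {..x} = (\<integral>t. 0 \<partial>?M)"
      unfolding F_def by (rule Bochner_Integration.integral_cong) (use True in auto)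
    then show ?thesis using True by simp
  next
    case False
    let ?y = "min x b"
    have y: "a \<le> a" "a \<le> ?y" "?y \<le> b" using False ab by auto
    have "integral {a..?y} v = F v {a<..?y}"
      unfolding F_def by (rule integral_eq_integral_indicator_Ioc[OF v y])
    also have "\<dots> = F v {..x}"
      unfolding F_def
    proof (rule integral_cong_AE)
      have "AE t in lebesgue. t \<noteq> a" by (rule AE_completion) (rule AE_lborel_singleton)
      then have "AE t in ?M. t \<noteq> a" by (subst AE_restrict_space_iff) (auto elim: eventually_mono)
      then show "AE t in ?M. indicator {a<..?y} t *\<^sub>R v t = indicator {..x} t *\<^sub>R v t"
        using AE_space by eventually_elim (auto simp: indicator_def)
    qed (intro borel_measurable_integrable Fi v; simp)+
    finally show ?thesis using False by simp
  qed
  have FC: "F v (UNIV - B) = F v UNIV - F v B" if "B \<in> sets borel" "integrable ?M v" for v B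
  proof -
    have "F v UNIV - F v B = (\<integral>t. indicator UNIV t *\<^sub>R v t - indicator B t *\<^sub>R v t \<partial>?M)"
      unfolding F_def using Fi[OF _ that(2), of UNIV] Fi[OF that] by simp
    also have "\<dots> = F v (UNIV - B)"
      unfolding F_def by (rule Bochner_Integration.integral_cong) (auto simp: indicator_def)
    finally show ?thesis by simp
  qed
  have borel: "(\<lambda>n. F (U n) B) \<longlonglongrightarrow> F u B" if B: "B \<in> sets borel" for B
  proof (cases "a \<le> b")
    case False
    then have "F v B = 0" for v
      unfolding F_def by (subst Bochner_Integration.integral_cong[where g = "\<lambda>_. 0"]) auto
    then show ?thesis by simp
  next
    case ab: True
    have UNIV: "(\<lambda>n. F (U n) UNIV) \<longlonglongrightarrow> F u UNIV"
    proof -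
      have "F v UNIV = F v {..b}" for v
        unfolding F_def by (rule Bochner_Integration.integral_cong) auto
      then show ?thesis using F_atMost[OF U ab, of _ b] F_atMost[OF u ab, of b] lim[of b] ab by simp
    qed
    have sig: "sigma_sets UNIV (range (\<lambda>x::real. {..x})) = sets borel"
      by (simp add: borel_eq_atMost)
    have "Int_stable (range (\<lambda>x::real. {..x}))" by (auto simp: Int_stable_def)
    moreover have "range (\<lambda>x::real. {..x}) \<subseteq> Pow UNIV" by simp
    moreover have "B \<in> sigma_sets UNIV (range (\<lambda>x::real. {..x}))" using B sig by simp
    ultimately show ?thesis
    proof (induction rule: sigma_sets_induct_disjoint)
      case (basic A)
      then obtain x where A: "A = {..x}" by auto
      show ?case
        unfolding A F_atMost[OF U ab] F_atMost[OF u ab] using lim[of "min x b"] ab by simp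
    next
      case empty
      show ?case by (simp add: F_def)
    next
      case (compl A)
      then have "A \<in> sets borel" using sig by simp
      then show ?case using compl.IH UNIV by (simp add: FC[OF _ U] FC[OF _ u] tendsto_diff)
    next
      case (union A)
      then have As: "A i \<in> sets borel" for i using sig by auto
      have disj: "disjoint_family A" using union by simp
      let ?S = "\<Union>i. A i"
      let ?Sk = "\<lambda>k. \<Union>i<k. A i"
      have Sb: "?S \<in> sets borel" "?Sk k \<in> sets borel" for k using As by auto
      \<comment> \<open>Bounds the tail of the union for all U n and for u at once. That m dominates
        u has not been shown, so norm (u t) is added to the weight.\<close>
      define r where "r k = (\<integral>t. indicator (?S - ?Sk k) t *\<^sub>R (m t + norm (u t)) \<partial>?M)" for k
      have mui: "integrable ?M (\<lambda>t. m t + norm (u t))" by (intro Bochner_Integration.integrable_add m integrable_norm u)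
      have rlim: "r \<longlonglongrightarrow> (\<integral>t. 0 \<partial>?M)"
        unfolding r_def[abs_def]
      proof (rule integral_dominated_convergence[where w = "\<lambda>t. norm (m t + norm (u t))"])
        show "AE t in ?M. (\<lambda>k. indicator (?S - ?Sk k) t *\<^sub>R (m t + norm (u t))) \<longlonglongrightarrow> 0"
        proof (rule AE_I2)
          fix t
          have "eventually (\<lambda>k. indicator (?S - ?Sk k) t *\<^sub>R (m t + norm (u t)) = 0) sequentially"
          proof (cases "t \<in> ?S")
            case True
            then obtain i where "t \<in> A i" by blast
            then show ?thesis unfolding eventually_sequentially
              by (intro exI[of _ "Suc i"]) (auto simp: indicator_def)
          qed simp
          then show "(\<lambda>k. indicator (?S - ?Sk k) t *\<^sub>R (m t + norm (u t))) \<longlonglongrightarrow> 0" by (rule tendsto_eventually)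
        qed
        show "(\<lambda>t. indicator (?S - ?Sk k) t *\<^sub>R (m t + norm (u t))) \<in> borel_measurable ?M" for k
          using Sb by (intro borel_measurable_integrable Fi mui) auto
        show "integrable ?M (\<lambda>t. norm (m t + norm (u t)))" by (rule integrable_norm[OF mui])
        show "AE t in ?M. norm (indicator (?S - ?Sk k) t *\<^sub>R (m t + norm (u t))) \<le> norm (m t + norm (u t))" for k
          by (intro AE_I2) (simp add: indicator_def)
      qed simp
      have close: "norm (F v ?S - F v (?Sk k)) \<le> r k"
        if v: "integrable ?M v" and le: "AE t in ?M. norm (v t) \<le> m t + norm (u t)" for v k
      proof -
        have "F v ?S - F v (?Sk k) = (\<integral>t. indicator ?S t *\<^sub>R v t - indicator (?Sk k) t *\<^sub>R v t \<partial>?M)"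
          unfolding F_def using Fi[OF Sb(1) v] Fi[OF Sb(2) v] by simp
        also have "\<dots> = (\<integral>t. indicator (?S - ?Sk k) t *\<^sub>R v t \<partial>?M)"
          by (rule Bochner_Integration.integral_cong) (auto simp: indicator_def)
        finally have e: "F v ?S - F v (?Sk k) = (\<integral>t. indicator (?S - ?Sk k) t *\<^sub>R v t \<partial>?M)" .
        have "norm (\<integral>t. indicator (?S - ?Sk k) t *\<^sub>R v t \<partial>?M) \<le> (\<integral>t. norm (indicator (?S - ?Sk k) t *\<^sub>R v t) \<partial>?M)"
          by (rule integral_norm_bound)
        also have "\<dots> \<le> r k"
          unfolding r_def
        proof (rule integral_mono_AE)
          show "integrable ?M (\<lambda>t. norm (indicator (?S - ?Sk k) t *\<^sub>R v t))"
            using Sb by (intro integrable_norm Fi v) auto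
          show "integrable ?M (\<lambda>t. indicator (?S - ?Sk k) t *\<^sub>R (m t + norm (u t)))"
            using Sb by (intro Fi mui) auto
          show "AE t in ?M. norm (indicator (?S - ?Sk k) t *\<^sub>R v t) \<le> indicator (?S - ?Sk k) t *\<^sub>R (m t + norm (u t))"
            using le by eventually_elim (simp add: indicator_def)
        qed
        finally show ?thesis using e by simp
      qed
      have finite: "(\<lambda>n. F (U n) (?Sk k)) \<longlonglongrightarrow> F u (?Sk k)" for k
      proof -
        have sum: "F v (?Sk k) = (\<Sum>i<k. F v (A i))" if "integrable ?M v" for v
        proof -
          have "(\<Sum>i<k. F v (A i)) = (\<integral>t. (\<Sum>i<k. indicator (A i) t *\<^sub>R v t) \<partial>?M)"
            unfolding F_def by (rule Bochner_Integration.integral_sum[symmetric]) (rule Fi[OF As that])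
          also have "\<dots> = F v (?Sk k)"
            unfolding F_def
          proof (rule Bochner_Integration.integral_cong[OF refl])
            fix t
            have "(\<Sum>i<k. indicator (A i) t :: real) = indicator (?Sk k) t"
              using disj by (intro indicator_UN_disjoint[symmetric]) (auto simp: disjoint_family_on_def)
            then show "(\<Sum>i<k. indicator (A i) t *\<^sub>R v t) = indicator (?Sk k) t *\<^sub>R v t"
              by (simp add: scaleR_sum_left[symmetric])
          qed
          finally show ?thesis by simp
        qed
        show ?thesis unfolding sum[OF U] sum[OF u] by (intro tendsto_sum union.IH)
      qed
      show ?case
        unfolding LIMSEQ_iff
      proof (intro allI impI)
        fix e :: real assume e: "0 < e"
        have "eventually (\<lambda>k. r k < e / 3) sequentially" using rlim e by (intro order_tendstoD(2)) auto
        then obtain k where k: "r k < e / 3" by (auto simp: eventually_sequentially)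
        obtain N where N: "\<And>n. n \<ge> N \<Longrightarrow> norm (F (U n) (?Sk k) - F u (?Sk k)) < e / 3"
          using finite[of k, unfolded LIMSEQ_iff] e by (metis divide_pos_pos zero_less_numeral)
        have "norm (F (U n) ?S - F u ?S) < e" if n: "n \<ge> N" for n
        proof -
          have "AE t in ?M. norm (U n t) \<le> m t + norm (u t)"
            using dom[of n] by eventually_elim (simp add: add_increasing2)
          then have 1: "norm (F (U n) ?S - F (U n) (?Sk k)) \<le> r k" by (rule close[OF U])
          have "AE t in ?M. norm (u t) \<le> m t + norm (u t)"
            using dom[of 0]
          proof eventually_elim
            case (elim t)
            then have "0 \<le> m t" using norm_ge_zero[of "U 0 t"] by linarith
            then show ?case by simp
          qed
          then have 2: "norm (F u ?S - F u (?Sk k)) \<le> r k" by (rule close[OF u])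
          have "F (U n) ?S - F u ?S = (F (U n) ?S - F (U n) (?Sk k)) + (F (U n) (?Sk k) - F u (?Sk k)) - (F u ?S - F u (?Sk k))"
            by simp
          also have "norm \<dots> \<le> norm (F (U n) ?S - F (U n) (?Sk k)) + norm (F (U n) (?Sk k) - F u (?Sk k)) + norm (F u ?S - F u (?Sk k))"
            by (intro order_trans[OF norm_triangle_ineq4] add_mono norm_triangle_ineq order_refl)
          also have "\<dots> < e" using 1 2 k N[OF n] by linarith
          finally show ?thesis .
        qed
        then show "\<exists>N. \<forall>n\<ge>N. norm (F (U n) ?S - F u ?S) < e" by blast
      qed
    qed
  qed
  obtain B where B: "A = B \<inter> {a..b}" "B \<in> sets lebesgue" using A by (auto simp: sets_restrict_space)
  \<comment> \<open>The set is only Lebesgue measurable; a Borel version of its indicator gives a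
    Borel set that differs from it by a null set.\<close>
  obtain g where g: "g \<in> borel_measurable lborel" "AE t in lborel. indicator B t = (g t :: real)"
    using completion_ex_borel_measurable_real[of "indicator B" lborel] B(2) by (auto simp: borel_measurable_indicator)
  define B' where "B' = g -` {1}"
  have B': "B' \<in> sets borel" using measurable_sets[OF g(1), of "{1}"] by (simp add: B'_def)
  have "AE t in lebesgue. t \<in> B \<longleftrightarrow> t \<in> B'"
    by (rule AE_completion) (use g(2) in eventually_elim, auto simp: B'_def indicator_def split: if_splits)
  then have AEB: "AE t in ?M. t \<in> B \<longleftrightarrow> t \<in> B'" by (subst AE_restrict_space_iff) (auto elim: eventually_mono)
  have "F v A = F v B'" if v: "integrable ?M v" for v
    unfolding F_def
  proof (rule integral_cong_AE)
    show "AE t in ?M. indicator A t *\<^sub>R v t = indicator B' t *\<^sub>R v t"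
      using AEB AE_space by eventually_elim (auto simp: B(1) indicator_def)
    show "(\<lambda>t. indicator A t *\<^sub>R v t) \<in> borel_measurable ?M"
      by (intro borel_measurable_integrable integrable_mult_indicator A v)
  qed (intro borel_measurable_integrable Fi v B')
  then show ?thesis using borel[OF B'] U u unfolding F_def by simp
qed


context hamiltonian
begin

section \<open>Lower semicontinuity of the cost along converging trajectories\<close>

context
  fixes R :: real and \<kappa> :: "real \<Rightarrow> real" and Y U :: "nat \<Rightarrow> real \<Rightarrow> 'a" and x u :: "real \<Rightarrow> 'a" and m :: "real \<Rightarrow> real"
  assumes R: "0 \<le> R"
    and \<kappa>: "integrable I \<kappa>" "\<And>t. t \<in> {a..b} \<Longrightarrow> 0 \<le> \<kappa> t"
      "\<And>t y. t \<in> {a..b} \<Longrightarrow> norm y \<le> R \<Longrightarrow> \<bar>H t y 0\<bar> \<le> \<kappa> t"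
    and Y: "\<And>n. Y n \<in> borel_measurable I" "\<And>n t. t \<in> {a..b} \<Longrightarrow> norm (Y n t) \<le> R"
    and x: "x \<in> borel_measurable I" "\<And>t. t \<in> {a..b} \<Longrightarrow> norm (x t) \<le> R"
    and Yx: "\<And>t. t \<in> {a..b} \<Longrightarrow> (\<lambda>n. Y n t) \<longlonglongrightarrow> x t"
    and U: "\<And>n. integrable I (U n)" and u: "integrable I u"
    and m: "integrable I m" "\<And>n. AE t in I. norm (U n t) \<le> m t"
    and Uu: "\<And>t. t \<in> {a..b} \<Longrightarrow> (\<lambda>n. integral {a..t} (U n)) \<longlonglongrightarrow> integral {a..t} u"
begin

text \<open>A minorant of the shifted conjugate, affine in v once the selection j is fixed. The
  shift by \<kappa> makes it nonnegative where the chosen vector is 0.\<close>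

definition test :: "(nat \<Rightarrow> 'a) \<Rightarrow> (real \<Rightarrow> nat) \<Rightarrow> (real \<Rightarrow> 'a) \<Rightarrow> (real \<Rightarrow> 'a) \<Rightarrow> real \<Rightarrow> real" where
  "test P j y v t = v t \<bullet> P (j t) - H t (y t) (P (j t)) + \<kappa> t"

lemma H_bound_p:
  assumes "t \<in> {a..b}" "norm y \<le> R"
  shows "\<bar>H t y p\<bar> \<le> \<kappa> t + c t * (1 + R) * norm p"
proof -
  have "\<bar>H t y p - H t y 0\<bar> \<le> c t * (1 + norm y) * norm p" using H_lip[OF assms(1), of y p 0] by simp
  also have "\<dots> \<le> c t * (1 + R) * norm p"
    using assms c_nonneg[OF assms(1)] by (intro mult_right_mono mult_left_mono) auto
  finally show ?thesis using \<kappa>(3)[OF assms] by linarith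
qed

context
  fixes P :: "nat \<Rightarrow> 'a" and j :: "real \<Rightarrow> nat" and N :: nat
  assumes j: "j \<in> measurable I (count_space UNIV)" and jN: "\<And>t. j t \<le> N"
begin

lemma P_bound: "norm (P (j t)) \<le> (\<Sum>i\<le>N. norm (P i))"
  using jN[of t] by (intro member_le_sum) auto

lemma level_sets: "{t \<in> {a..b}. j t = i} \<in> sets I"
proof -
  have "j -` {i} \<inter> space I \<in> sets I" using measurable_sets[OF j, of "{i}"] by simp
  moreover have "j -` {i} \<inter> space I = {t \<in> {a..b}. j t = i}" by auto
  ultimately show ?thesis by simp
qed

lemma Pj_measurable: "(\<lambda>t. P (j t)) \<in> borel_measurable I"
  using measurable_compose[OF j, of P borel] by simp

text \<open>P (j t) is constant on the finitely many level sets of j, so an integral against it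
  reduces to integrals of v over measurable sets, which \<open>dominated_weak_convergence\<close>
  handles.\<close>

lemma inner_Pj_eq:
  assumes v: "integrable I v"
  shows "integrable I (\<lambda>t. v t \<bullet> P (j t))"
    and "(\<integral>t. v t \<bullet> P (j t) \<partial>I) = (\<Sum>i\<le>N. (\<integral>t. indicator {t \<in> {a..b}. j t = i} t *\<^sub>R v t \<partial>I) \<bullet> P i)"
proof -
  have eq: "v t \<bullet> P (j t) = (\<Sum>i\<le>N. (indicator {t \<in> {a..b}. j t = i} t *\<^sub>R v t) \<bullet> P i)" if "t \<in> space I" for t
  proof -
    have "(\<Sum>i\<le>N. (indicator {t \<in> {a..b}. j t = i} t *\<^sub>R v t) \<bullet> P i) = (\<Sum>i\<le>N. if j t = i then v t \<bullet> P i else 0)"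
      using that by (intro sum.cong) (auto simp: indicator_def)
    also have "\<dots> = v t \<bullet> P (j t)" using jN[of t] by (simp add: sum.delta')
    finally show ?thesis by simp
  qed
  have i: "integrable I (\<lambda>t. indicator {t \<in> {a..b}. j t = i} t *\<^sub>R v t)" for i
    by (rule integrable_mult_indicator[OF level_sets v])
  have "integrable I (\<lambda>t. \<Sum>i\<le>N. (indicator {t \<in> {a..b}. j t = i} t *\<^sub>R v t) \<bullet> P i)"
    by (intro Bochner_Integration.integrable_sum integrable_inner_left i)
  then show "integrable I (\<lambda>t. v t \<bullet> P (j t))"
    by (rule Bochner_Integration.integrable_cong[THEN iffD1, rotated -1]) (use eq in auto)
  have "(\<integral>t. v t \<bullet> P (j t) \<partial>I) = (\<integral>t. (\<Sum>i\<le>N. (indicator {t \<in> {a..b}. j t = i} t *\<^sub>R v t) \<bullet> P i) \<partial>I)"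
    by (rule Bochner_Integration.integral_cong[OF refl eq])
  also have "\<dots> = (\<Sum>i\<le>N. \<integral>t. (indicator {t \<in> {a..b}. j t = i} t *\<^sub>R v t) \<bullet> P i \<partial>I)"
    by (intro Bochner_Integration.integral_sum integrable_inner_left i)
  also have "\<dots> = (\<Sum>i\<le>N. (\<integral>t. indicator {t \<in> {a..b}. j t = i} t *\<^sub>R v t \<partial>I) \<bullet> P i)"
    by (intro sum.cong refl integral_inner_left i)
  finally show "(\<integral>t. v t \<bullet> P (j t) \<partial>I) = \<dots>" .
qed

lemma HPj_integrable:
  assumes "y \<in> borel_measurable I" "\<And>t. t \<in> {a..b} \<Longrightarrow> norm (y t) \<le> R"
  shows "integrable I (\<lambda>t. H t (y t) (P (j t)))"
    and "\<And>t. t \<in> {a..b} \<Longrightarrow> \<bar>H t (y t) (P (j t))\<bar> \<le> \<kappa> t + c t * (1 + R) * (\<Sum>i\<le>N. norm (P i))"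
    and "integrable I (\<lambda>t. \<kappa> t + c t * (1 + R) * (\<Sum>i\<le>N. norm (P i)))"
proof -
  show le: "\<bar>H t (y t) (P (j t))\<bar> \<le> \<kappa> t + c t * (1 + R) * (\<Sum>i\<le>N. norm (P i))" if t: "t \<in> {a..b}" for t
  proof -
    have "c t * (1 + R) * norm (P (j t)) \<le> c t * (1 + R) * (\<Sum>i\<le>N. norm (P i))"
      using c_nonneg[OF t] R P_bound by (intro mult_left_mono) auto
    then show ?thesis using H_bound_p[OF t assms(2)[OF t], of "P (j t)"] by linarith
  qed
  show i: "integrable I (\<lambda>t. \<kappa> t + c t * (1 + R) * (\<Sum>i\<le>N. norm (P i)))"
    using \<kappa>(1) c_int by (intro Bochner_Integration.integrable_add integrable_mult_left) auto
  show "integrable I (\<lambda>t. H t (y t) (P (j t)))"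
  proof (rule Bochner_Integration.integrable_bound[OF i])
    show "(\<lambda>t. H t (y t) (P (j t))) \<in> borel_measurable I" by (rule H_compose_measurable[OF assms(1) Pj_measurable])
    show "AE t in I. norm (H t (y t) (P (j t))) \<le> norm (\<kappa> t + c t * (1 + R) * (\<Sum>i\<le>N. norm (P i)))"
    proof (rule AE_I2)
      fix t assume "t \<in> space I"
      then show "norm (H t (y t) (P (j t))) \<le> norm (\<kappa> t + c t * (1 + R) * (\<Sum>i\<le>N. norm (P i)))"
        using le[of t] by simp
    qed
  qed
qed

lemma test_integrable:
  assumes "y \<in> borel_measurable I" "\<And>t. t \<in> {a..b} \<Longrightarrow> norm (y t) \<le> R" "integrable I v"
  shows "integrable I (test P j y v)"
  unfolding test_def[abs_def]
  by (intro Bochner_Integration.integrable_add Bochner_Integration.integrable_diff inner_Pj_eq(1) HPj_integrable(1) assms \<kappa>)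

lemma test_integral_eq:
  assumes "y \<in> borel_measurable I" "\<And>t. t \<in> {a..b} \<Longrightarrow> norm (y t) \<le> R" "integrable I v"
  shows "(\<integral>t. test P j y v t \<partial>I) = (\<integral>t. v t \<bullet> P (j t) \<partial>I) - (\<integral>t. H t (y t) (P (j t)) \<partial>I) + (\<integral>t. \<kappa> t \<partial>I)"
  unfolding test_def
  using inner_Pj_eq(1)[OF assms(3)] HPj_integrable(1)[OF assms(1,2)] \<kappa>(1) by simp

text \<open>The selection j is frozen along the sequence. The part linear in the derivative then
  converges by weak convergence, and the part in H by dominated convergence, since Y n t tends to x
  t and H t is jointly continuous.\<close>

lemma test_tendsto: "(\<lambda>n. \<integral>t. test P j (Y n) (U n) t \<partial>I) \<longlonglongrightarrow> (\<integral>t. test P j x u t \<partial>I)"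
proof -
  have "(\<lambda>n. \<integral>t. U n t \<bullet> P (j t) \<partial>I) \<longlonglongrightarrow> (\<integral>t. u t \<bullet> P (j t) \<partial>I)"
    unfolding inner_Pj_eq(2)[OF U] inner_Pj_eq(2)[OF u]
    by (intro tendsto_intros dominated_weak_convergence[OF U u m Uu level_sets])
  moreover have "(\<lambda>n. \<integral>t. H t (Y n t) (P (j t)) \<partial>I) \<longlonglongrightarrow> (\<integral>t. H t (x t) (P (j t)) \<partial>I)"
  proof (rule integral_dominated_convergence[where w = "\<lambda>t. \<kappa> t + c t * (1 + R) * (\<Sum>i\<le>N. norm (P i))"])
    show "(\<lambda>t. H t (x t) (P (j t))) \<in> borel_measurable I" by (rule H_compose_measurable[OF x(1) Pj_measurable])
    show "(\<lambda>t. H t (Y n t) (P (j t))) \<in> borel_measurable I" for n by (rule H_compose_measurable[OF Y(1) Pj_measurable])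
    show "integrable I (\<lambda>t. \<kappa> t + c t * (1 + R) * (\<Sum>i\<le>N. norm (P i)))" by (rule HPj_integrable(3)[OF x])
    show "AE t in I. (\<lambda>n. H t (Y n t) (P (j t))) \<longlonglongrightarrow> H t (x t) (P (j t))"
    proof (rule AE_I2)
      fix t assume "t \<in> space I"
      then have t: "t \<in> {a..b}" by simp
      have "(\<lambda>n. (\<lambda>(x, p). H t x p) (Y n t, P (j t))) \<longlonglongrightarrow> (\<lambda>(x, p). H t x p) (x t, P (j t))"
        by (rule continuous_on_tendsto_compose[OF H_cont[OF t]]) (auto intro!: tendsto_intros Yx[OF t])
      then show "(\<lambda>n. H t (Y n t) (P (j t))) \<longlonglongrightarrow> H t (x t) (P (j t))" by simp
    qed
    show "AE t in I. norm (H t (Y n t) (P (j t))) \<le> \<kappa> t + c t * (1 + R) * (\<Sum>i\<le>N. norm (P i))" for n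
      using HPj_integrable(2)[OF Y] by (intro AE_I2) simp
  qed
  moreover have "(\<integral>t. test P j (Y n) (U n) t \<partial>I)
      = (\<integral>t. U n t \<bullet> P (j t) \<partial>I) - (\<integral>t. H t (Y n t) (P (j t)) \<partial>I) + (\<integral>t. \<kappa> t \<partial>I)" for n
    by (rule test_integral_eq[OF Y U])
  moreover have "(\<integral>t. test P j x u t \<partial>I)
      = (\<integral>t. u t \<bullet> P (j t) \<partial>I) - (\<integral>t. H t (x t) (P (j t)) \<partial>I) + (\<integral>t. \<kappa> t \<partial>I)"
    by (rule test_integral_eq[OF x u])
  ultimately show ?thesis by (simp only:) (intro tendsto_intros)
qed

text \<open>j will be optimal for the limit pair (x, u), so along another pair (y, v) the test may
  be negative; its positive part still lies below the shifted conjugate, which is nonnegative after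
  \<open>e2ennreal\<close>.\<close>

lemma test_le_cost:
  assumes y: "y \<in> borel_measurable I" "\<And>t. t \<in> {a..b} \<Longrightarrow> norm (y t) \<le> R" and v: "integrable I v"
  shows "ereal (\<integral>t. test P j y v t \<partial>I) \<le> cost y v + ereal (\<integral>t. \<kappa> t \<partial>I)"
proof -
  note ti = test_integrable[OF y v]
  have "ereal (\<integral>t. test P j y v t \<partial>I) \<le> ereal (\<integral>t. max 0 (test P j y v t) \<partial>I)"
    using ti by (simp, intro integral_mono_AE) auto
  also have "\<dots> = enn2ereal (ennreal (\<integral>t. max 0 (test P j y v t) \<partial>I))"
    by (simp add: enn2ereal_ennreal integral_nonneg_AE)
  also have "ennreal (\<integral>t. max 0 (test P j y v t) \<partial>I) = (\<integral>\<^sup>+t. ennreal (max 0 (test P j y v t)) \<partial>I)"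
    using ti by (intro nn_integral_eq_integral[symmetric]) auto
  also have "enn2ereal \<dots> \<le> enn2ereal (\<integral>\<^sup>+t. e2ennreal (conj_H H t (y t) (v t) + ereal (\<kappa> t)) \<partial>I)"
    unfolding less_eq_ennreal.rep_eq[symmetric]
  proof (rule nn_integral_mono)
    fix t assume "t \<in> space I"
    have "ereal (test P j y v t) \<le> conj_H H t (y t) (v t) + ereal (\<kappa> t)"
      unfolding test_def using add_right_mono[OF conj_H_ge[of "v t" "P (j t)" H t "y t"], of "ereal (\<kappa> t)"] by simp
    then have "e2ennreal (ereal (test P j y v t)) \<le> e2ennreal (conj_H H t (y t) (v t) + ereal (\<kappa> t))"
      by (rule e2ennreal_mono)
    then show "ennreal (max 0 (test P j y v t)) \<le> e2ennreal (conj_H H t (y t) (v t) + ereal (\<kappa> t))"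
      by (simp add: e2ennreal_ereal max_def ennreal_neg)
  qed
  also have "\<dots> = cost y v + ereal (\<integral>t. \<kappa> t \<partial>I)"
    by (rule cost_shift[symmetric, OF y(1) borel_measurable_integrable[OF v] y(2) \<kappa>])
  finally show ?thesis .
qed

end

text \<open>The supremum over the first \<open>n\<close> test vectors is attained by a measurable selection \<open>argmx n\<close>,
  so monotone convergence reduces lower semicontinuity to the continuity of the tested integrals.\<close>

fun argmx :: "(nat \<Rightarrow> 'a) \<Rightarrow> nat \<Rightarrow> real \<Rightarrow> nat" where
  "argmx P 0 t = 0"
| "argmx P (Suc n) t = (if u t \<bullet> P (argmx P n t) - H t (x t) (P (argmx P n t)) < u t \<bullet> P (Suc n) - H t (x t) (P (Suc n))
     then Suc n else argmx P n t)"

lemma argmx_le: "argmx P n t \<le> n"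
  by (induction n) auto

lemma argmx_ge: "i \<le> n \<Longrightarrow> u t \<bullet> P i - H t (x t) (P i) \<le> u t \<bullet> P (argmx P n t) - H t (x t) (P (argmx P n t))"
  by (induction n) (auto simp: le_Suc_eq)

lemma argmx_measurable: "argmx P n \<in> measurable I (count_space UNIV)"
proof (induction n)
  case 0
  then show ?case by simp
next
  case (Suc n)
  have um: "u \<in> borel_measurable I" using u by simp
  have pm: "(\<lambda>t. P (argmx P n t)) \<in> borel_measurable I" using measurable_compose[OF Suc, of P borel] by simp
  have 1: "(\<lambda>t. u t \<bullet> P (argmx P n t) - H t (x t) (P (argmx P n t))) \<in> borel_measurable I"
    by (intro borel_measurable_diff borel_measurable_inner um pm H_compose_measurable x)
  have 2: "(\<lambda>t. u t \<bullet> P (Suc n) - H t (x t) (P (Suc n))) \<in> borel_measurable I"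
    by (intro borel_measurable_diff borel_measurable_inner um H_compose_measurable x borel_measurable_const)
  show ?case
    unfolding argmx.simps
    by (rule measurable_If[OF _ Suc borel_measurable_less[OF 1 2]]) simp
qed

text \<open>A value y below the cost of the limit is exceeded, after the shift, by a single tested
  integral. With its selection fixed, this integral is continuous along the sequence and bounds the
  shifted costs from below.\<close>

lemma cost_lsc: "cost x u \<le> liminf (\<lambda>n. cost (Y n) (U n))"
  unfolding le_Liminf_iff
proof (intro allI impI)
  fix y assume y: "y < cost x u"
  let ?K = "\<integral>t. \<kappa> t \<partial>I"
  obtain P :: "nat \<Rightarrow> 'a" where P0: "P 0 = 0"
    and P: "\<And>t x v. t \<in> {a..b} \<Longrightarrow> conj_H H t x v = (SUP n. ereal (v \<bullet> P n - H t x (P n)))"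
    using obtain_dense_sequence by metis
  let ?g = "\<lambda>n. test P (argmx P n) x u"
  have g_ge: "u t \<bullet> P i - H t (x t) (P i) + \<kappa> t \<le> ?g n t" if "i \<le> n" for i n t
    using argmx_ge[OF that, of t P] by (simp add: test_def)
  \<comment> \<open>The vector P 0 = 0 always competes, and - H t (x t) 0 + \<kappa> t is
    nonnegative.\<close>
  have g0: "0 \<le> ?g n t" if t: "t \<in> {a..b}" for n t
    using g_ge[of 0 n t] \<kappa>(3)[OF t x(2)[OF t]] by (simp add: P0 abs_le_iff)
  have gmono: "?g n t \<le> ?g n' t" if "n \<le> n'" for n n' t
    using g_ge[of "argmx P n t" n' t] argmx_le[of P n t] that by (simp add: test_def)
  have SUP: "e2ennreal (conj_H H t (x t) (u t) + ereal (\<kappa> t)) = (SUP n. ennreal (?g n t))" if t: "t \<in> {a..b}" for t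
  proof (rule antisym)
    show "(SUP n. ennreal (?g n t)) \<le> e2ennreal (conj_H H t (x t) (u t) + ereal (\<kappa> t))"
    proof (rule SUP_least)
      fix n
      have "ereal (?g n t) \<le> conj_H H t (x t) (u t) + ereal (\<kappa> t)"
        unfolding test_def using add_right_mono[OF conj_H_ge[of "u t" "P (argmx P n t)" H t "x t"], of "ereal (\<kappa> t)"] by simp
      then have "e2ennreal (ereal (?g n t)) \<le> e2ennreal (conj_H H t (x t) (u t) + ereal (\<kappa> t))" by (rule e2ennreal_mono)
      then show "ennreal (?g n t) \<le> e2ennreal (conj_H H t (x t) (u t) + ereal (\<kappa> t))" by (simp add: e2ennreal_ereal)
    qed
    have "conj_H H t (x t) (u t) + ereal (\<kappa> t) \<le> enn2ereal (SUP n. ennreal (?g n t))"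
    proof -
      define S where "S = enn2ereal (SUP n. ennreal (?g n t))"
      have "conj_H H t (x t) (u t) \<le> S - ereal (\<kappa> t)"
        unfolding P[OF t]
      proof (rule SUP_least)
        fix i
        have "ennreal (u t \<bullet> P i - H t (x t) (P i) + \<kappa> t) \<le> ennreal (?g i t)" by (intro ennreal_leI g_ge) simp
        also have "\<dots> \<le> (SUP n. ennreal (?g n t))" by (rule SUP_upper) simp
        finally have "enn2ereal (ennreal (u t \<bullet> P i - H t (x t) (P i) + \<kappa> t)) \<le> enn2ereal (SUP n. ennreal (?g n t))"
          by (simp add: less_eq_ennreal.rep_eq)
        moreover have "ereal (u t \<bullet> P i - H t (x t) (P i) + \<kappa> t) \<le> enn2ereal (ennreal (u t \<bullet> P i - H t (x t) (P i) + \<kappa> t))"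
          by (cases "0 \<le> u t \<bullet> P i - H t (x t) (P i) + \<kappa> t") (auto simp: enn2ereal_ennreal ennreal_neg zero_ennreal.rep_eq)
        ultimately have "ereal (u t \<bullet> P i - H t (x t) (P i) + \<kappa> t) \<le> S" unfolding S_def by (rule order_trans[rotated])
        then show "ereal (u t \<bullet> P i - H t (x t) (P i)) \<le> S - ereal (\<kappa> t)"
          by (cases S) auto
      qed
      then show ?thesis
        unfolding S_def[symmetric] by (cases S; cases "conj_H H t (x t) (u t)") auto
    qed
    then have "e2ennreal (conj_H H t (x t) (u t) + ereal (\<kappa> t)) \<le> e2ennreal (enn2ereal (SUP n. ennreal (?g n t)))"
      by (rule e2ennreal_mono)
    then show "e2ennreal (conj_H H t (x t) (u t) + ereal (\<kappa> t)) \<le> (SUP n. ennreal (?g n t))" by simp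
  qed
  have gi: "integrable I (?g n)" for n by (rule test_integrable[OF argmx_measurable argmx_le x u])
  have gm: "(\<lambda>t. ennreal (indicator {a..b} t * ?g n t)) \<in> borel_measurable I" for n
    using borel_measurable_integrable[OF gi[of n]] by (intro measurable_compose[OF _ measurable_ennreal] borel_measurable_times) (auto intro!: borel_measurable_indicator)
  have "(\<integral>\<^sup>+t. e2ennreal (conj_H H t (x t) (u t) + ereal (\<kappa> t)) \<partial>I)
      = (\<integral>\<^sup>+t. (SUP n. ennreal (indicator {a..b} t * ?g n t)) \<partial>I)"
    by (rule nn_integral_cong) (simp add: SUP)
  also have "\<dots> = (SUP n. (\<integral>\<^sup>+t. ennreal (indicator {a..b} t * ?g n t) \<partial>I))"
    by (rule nn_integral_monotone_convergence_SUP[OF _ gm])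
       (auto simp: incseq_def le_fun_def indicator_def intro!: ennreal_leI gmono)
  also have "\<dots> = (SUP n. ennreal (\<integral>t. ?g n t \<partial>I))"
  proof (rule SUP_cong[OF refl])
    fix n
    have "(\<integral>\<^sup>+t. ennreal (indicator {a..b} t * ?g n t) \<partial>I) = (\<integral>\<^sup>+t. ennreal (?g n t) \<partial>I)"
      by (rule nn_integral_cong) simp
    also have "\<dots> = ennreal (\<integral>t. ?g n t \<partial>I)"
      by (rule nn_integral_eq_integral[OF gi]) (use g0 in \<open>auto intro: AE_I2\<close>)
    finally show "(\<integral>\<^sup>+t. ennreal (indicator {a..b} t * ?g n t) \<partial>I) = ennreal (\<integral>t. ?g n t \<partial>I)" .
  qed
  finally have Q: "(\<integral>\<^sup>+t. e2ennreal (conj_H H t (x t) (u t) + ereal (\<kappa> t)) \<partial>I) = (SUP n. ennreal (\<integral>t. ?g n t \<partial>I))" .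
  have shift: "cost x u + ereal ?K = enn2ereal (SUP n. ennreal (\<integral>t. ?g n t \<partial>I))"
    unfolding Q[symmetric] by (rule cost_shift[OF x(1) borel_measurable_integrable[OF u] x(2) \<kappa>])
  have "\<exists>n. y + ereal ?K < ereal (\<integral>t. ?g n t \<partial>I)"
  proof (rule ccontr)
    assume "\<not> ?thesis"
    then have le: "ereal (\<integral>t. ?g n t \<partial>I) \<le> y + ereal ?K" for n by (auto simp: not_less)
    have nn: "0 \<le> (\<integral>t. ?g n t \<partial>I)" for n using g0 by (intro integral_nonneg_AE AE_I2) simp
    have y0: "0 \<le> y + ereal ?K" using le[of 0] nn[of 0] by (metis ereal_less_eq(5) order_trans)
    have "(SUP n. ennreal (\<integral>t. ?g n t \<partial>I)) \<le> e2ennreal (y + ereal ?K)"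
    proof (rule SUP_least)
      fix n
      show "ennreal (\<integral>t. ?g n t \<partial>I) \<le> e2ennreal (y + ereal ?K)"
        using e2ennreal_mono[OF le[of n]] by (simp add: e2ennreal_ereal)
    qed
    then have "enn2ereal (SUP n. ennreal (\<integral>t. ?g n t \<partial>I)) \<le> enn2ereal (e2ennreal (y + ereal ?K))"
      by (simp add: less_eq_ennreal.rep_eq)
    then have "cost x u + ereal ?K \<le> y + ereal ?K"
      using y0 by (simp add: shift enn2ereal_e2ennreal)
    then show False using y by (cases y; cases "cost x u") auto
  qed
  then obtain n where n: "y + ereal ?K < ereal (\<integral>t. ?g n t \<partial>I)" by blast
  have "(\<lambda>k. ereal (\<integral>t. test P (argmx P n) (Y k) (U k) t \<partial>I)) \<longlonglongrightarrow> ereal (\<integral>t. ?g n t \<partial>I)"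
    using test_tendsto[OF argmx_measurable argmx_le] by simp
  then have "eventually (\<lambda>k. y + ereal ?K < ereal (\<integral>t. test P (argmx P n) (Y k) (U k) t \<partial>I)) sequentially"
    using n by (rule order_tendstoD(1))
  then show "eventually (\<lambda>k. y < cost (Y k) (U k)) sequentially"
  proof eventually_elim
    case (elim k)
    also have "ereal (\<integral>t. test P (argmx P n) (Y k) (U k) t \<partial>I) \<le> cost (Y k) (U k) + ereal ?K"
      by (rule test_le_cost[OF argmx_measurable argmx_le Y U])
    finally show ?case by (cases y; cases "cost (Y k) (U k)") auto
  qed
qed

end

end

subsection \<open>Minimizers\<close>


text \<open>\<open>Liminf (at z)\<close> ignores the value at z, while a sequence may take its limit
  as a value; y < g l fills the gap and yields a full neighbourhood.\<close>

lemma lsc_sequentially: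
  assumes g: "lsc g" and z: "z \<longlonglongrightarrow> l"
  shows "g l \<le> liminf (\<lambda>n. g (z n))"
  unfolding le_Liminf_iff
proof (intro allI impI)
  fix y assume y: "y < g l"
  then have "y < Liminf (at l) g" using g unfolding lsc_def by (metis less_le_trans)
  then have "eventually (\<lambda>w. y < g w) (at l)" by (rule less_LiminfD)
  then have "eventually (\<lambda>w. y < g w) (nhds l)" using y by (simp add: eventually_nhds_conv_at)
  then show "eventually (\<lambda>n. y < g (z n)) sequentially" using z by (rule eventually_compose_filterlim)
qed

context hamiltonian
begin

text \<open>The minimum bounds one endpoint without saying which. Starting the Gronwall estimate
  there gives a bound in terms of M and c alone, common to a whole minimizing sequence.\<close>

lemma AC_norm_bound:
  assumes x: "abs_cont_on a b x" and fin: "cost x (deriv_on x) < \<infinity>"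
    and M: "min (norm (x a)) (norm (x b)) \<le> M" and t: "t \<in> {a..b}"
  shows "norm (x t) \<le> 2 * (1 + M) * exp (2 * C b)"
proof -
  obtain R where R: "0 \<le> R" "\<And>t. t \<in> {a..b} \<Longrightarrow> norm (x t) \<le> R" using abs_cont_on_bounded[OF x] by metis
  have "AE t in I. conj_H H t (x t) (deriv_on x t) < \<infinity>"
    by (rule cost_finiteD(1)[OF AC_regularity(1,2)[OF x] R fin])
  then have d: "AE t in I. norm (deriv_on x t) \<le> c t * (1 + norm (x t))"
    using AE_space by eventually_elim (simp add: conj_H_domain)
  obtain \<tau> where tau: "\<tau> = a \<or> \<tau> = b" "norm (x \<tau>) \<le> M" using M by (auto simp: min_def split: if_splits)
  have "1 + norm (x t) \<le> 2 * (1 + norm (x \<tau>)) * exp (2 * C b)"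
    by (rule Gronwall_abs_cont[OF x c_int c_nonneg d tau(1) t])
  also have "\<dots> \<le> 2 * (1 + M) * exp (2 * C b)" using tau(2) by (intro mult_right_mono mult_left_mono) auto
  finally show ?thesis by simp
qed

lemma AC_deriv_bound:
  assumes x: "abs_cont_on a b x" and fin: "cost x (deriv_on x) < \<infinity>"
    and R: "0 \<le> R" "\<And>t. t \<in> {a..b} \<Longrightarrow> norm (x t) \<le> R"
  shows "AE t in I. norm (deriv_on x t) \<le> c t * (1 + R)"
proof -
  have "AE t in I. conj_H H t (x t) (deriv_on x t) < \<infinity>"
    by (rule cost_finiteD(1)[OF AC_regularity(1,2)[OF x] R fin])
  then show ?thesis using AE_space
  proof eventually_elim
    case (elim t)
    then have t: "t \<in> {a..b}" by simp
    have "c t * (1 + norm (x t)) \<le> c t * (1 + R)" using R(2)[OF t] c_nonneg[OF t] by (intro mult_left_mono) auto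
    then show ?case using conj_H_domain[OF t elim(1)] by linarith
  qed
qed

text \<open>All derivatives are dominated by c t * (1 + R). Its indefinite integral is a common
  modulus of continuity for Arzela-Ascoli, and the increment bound survives in the limit, which
  makes x absolutely continuous.\<close>

lemma Tonelli_compactness:
  assumes y: "\<And>n. abs_cont_on a b (y n)" and fin: "\<And>n. cost (y n) (deriv_on (y n)) < \<infinity>"
    and R: "0 \<le> R" "\<And>n t. t \<in> {a..b} \<Longrightarrow> norm (y n t) \<le> R"
  obtains x r where "abs_cont_on a b x" "strict_mono (r :: nat \<Rightarrow> nat)"
    "\<And>t. t \<in> {a..b} \<Longrightarrow> (\<lambda>n. y (r n) t) \<longlonglongrightarrow> x t"
    "cost x (deriv_on x) \<le> liminf (\<lambda>n. cost (y (r n)) (deriv_on (y (r n))))"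
proof -
  let ?m = "\<lambda>t. c t * (1 + R)"
  have mint: "integrable I ?m" using c_int by simp
  have m0: "0 \<le> ?m t" if "t \<in> {a..b}" for t using c_nonneg[OF that] R by simp
  let ?Q = "\<lambda>t. 0 + integral {a..t} ?m"
  have dm: "AE t in I. norm (deriv_on (y n) t) \<le> ?m t" for n
    by (rule AC_deriv_bound[OF y fin R])
  have inc: "norm (y n t - y n s) \<le> integral {s..t} ?m" if st: "a \<le> s" "s \<le> t" "t \<le> b" for n s t
    unfolding abs_cont_on_ftc[OF y ab st]
    by (rule integral_norm_bound_interval[OF AC_regularity(3)[OF y] mint dm st(1,3)])
  have inc2: "norm (y n s - y n t) \<le> dist (?Q t) (?Q s)" if "s \<in> {a..b}" "t \<in> {a..b}" for n s t
  proof (cases "s \<le> t")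
    case True
    then show ?thesis using inc[of s t n] integral_diff_interval[OF mint, of s t] that
      by (simp add: norm_minus_commute dist_real_def)
  next
    case False
    then show ?thesis using inc[of t s n] integral_diff_interval[OF mint, of t s] that
      by (simp add: dist_real_def)
  qed
  have cQ: "continuous_on {a..b} ?Q" by (rule abs_cont_on_imp_continuous[OF abs_cont_on_indefinite_integral[OF mint]])
  have equi: "\<exists>d>0. \<forall>n t. t \<in> {a..b} \<and> norm (s - t) < d \<longrightarrow> norm (y n s - y n t) < e"
    if s: "s \<in> {a..b}" and e: "0 < e" for s e
  proof -
    obtain d where d: "d > 0" "\<And>t. t \<in> {a..b} \<Longrightarrow> dist t s < d \<Longrightarrow> dist (?Q t) (?Q s) < e"
      using cQ s e unfolding continuous_on_iff by metis
    have "norm (y n s - y n t) < e" if "t \<in> {a..b}" "norm (s - t) < d" for n t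
    proof -
      have "dist t s < d" using that(2) by (simp add: dist_norm norm_minus_commute)
      from d(2)[OF that(1) this] inc2[OF s that(1), of n] show ?thesis by linarith
    qed
    then show ?thesis using d(1) by blast
  qed
  obtain x and r :: "nat \<Rightarrow> nat" where r: "strict_mono r"
    and unif: "\<And>e. 0 < e \<Longrightarrow> \<exists>N. \<forall>n t. n \<ge> N \<and> t \<in> {a..b} \<longrightarrow> norm (y (r n) t - x t) < e"
    using Arzela_Ascoli[of "{a..b}" y R, OF compact_Icc R(2) equi] by metis
  have lim: "(\<lambda>n. y (r n) t) \<longlonglongrightarrow> x t" if "t \<in> {a..b}" for t
    unfolding LIMSEQ_iff using unif that by meson
  have xR: "norm (x t) \<le> R" if "t \<in> {a..b}" for t
    by (rule LIMSEQ_le_const2[OF tendsto_norm[OF lim[OF that]]]) (use R(2)[OF that] in auto)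
  have xac: "abs_cont_on a b x"
  proof (rule abs_cont_on_integral_bound[OF mint m0])
    fix s t assume st: "a \<le> s" "s \<le> t" "t \<le> b"
    have "(\<lambda>n. norm (y (r n) t - y (r n) s)) \<longlonglongrightarrow> norm (x t - x s)"
      using st by (intro tendsto_intros lim) auto
    then show "norm (x t - x s) \<le> integral {s..t} ?m"
      by (rule LIMSEQ_le_const2) (use inc[OF st] in auto)
  qed
  obtain \<kappa> where k: "integrable I \<kappa>" "\<And>t. t \<in> {a..b} \<Longrightarrow> 0 \<le> \<kappa> t"
    "\<And>t y. t \<in> {a..b} \<Longrightarrow> norm y \<le> R \<Longrightarrow> \<bar>H t y 0\<bar> \<le> \<kappa> t"
    using obtain_H_bound[OF R(1)] by metis
  have "cost x (deriv_on x) \<le> liminf (\<lambda>n. cost (y (r n)) (deriv_on (y (r n))))"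
  proof (rule cost_lsc[OF R(1) k AC_regularity(1)[OF y] R(2) AC_regularity(1)[OF xac] xR lim AC_regularity(3)[OF y] AC_regularity(3)[OF xac] mint dm])
    fix t assume t: "t \<in> {a..b}"
    \<comment> \<open>Weak convergence of derivatives is requested on initial intervals only, where
      it is convergence of increments of the trajectories.\<close>
    have "(\<lambda>n. y (r n) t - y (r n) a) \<longlonglongrightarrow> x t - x a" using t by (intro tendsto_intros lim) auto
    then show "(\<lambda>n. integral {a..t} (deriv_on (y (r n)))) \<longlonglongrightarrow> integral {a..t} (deriv_on x)"
      using abs_cont_on_ftc[OF y ab order_refl, of t] abs_cont_on_ftc[OF xac ab order_refl, of t] t by simp
  qed
  then show thesis using that xac r lim by blast
qed

context
  fixes \<phi> :: "'a \<times> 'a \<Rightarrow> ereal" and M :: real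
  assumes phi_proper: "proper_fun \<phi>" and phi_lsc: "lsc \<phi>"
    and M0: "0 \<le> M" and M: "\<And>z x. \<phi> (z, x) < \<infinity> \<Longrightarrow> min (norm z) (norm x) \<le> M"
begin

abbreviation "\<Gamma> x \<equiv> Gamma_fun H \<phi> a b x"
abbreviation "\<Lambda> xw \<equiv> Lambda_fun H \<phi> a b xw"

lemma Gamma_eq: "\<Gamma> x = \<phi> (x a, x b) + cost x (deriv_on x)"
  by (simp add: Gamma_fun_def)

lemma AC_cost_not_MInf:
  assumes "abs_cont_on a b x"
  shows "cost x (deriv_on x) \<noteq> -\<infinity>"
proof -
  obtain R where R: "0 \<le> R" "\<And>t. t \<in> {a..b} \<Longrightarrow> norm (x t) \<le> R" using abs_cont_on_bounded[OF assms] by metis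
  show ?thesis by (rule cost_not_MInf[OF AC_regularity(1,2)[OF assms] R])
qed

lemma phi_not_MInf: "\<phi> z \<noteq> -\<infinity>"
  using phi_proper unfolding proper_fun_def by blast

lemma Gamma_finiteD:
  assumes "abs_cont_on a b x" "\<Gamma> x < \<infinity>"
  shows "\<phi> (x a, x b) < \<infinity>" "cost x (deriv_on x) < \<infinity>"
  using assms(2) AC_cost_not_MInf[OF assms(1)] phi_not_MInf[of "(x a, x b)"] unfolding Gamma_eq by auto

lemma Gamma_le_Lambda: "(x, w) \<in> Lambda_adm H a b \<Longrightarrow> \<Gamma> x \<le> \<Lambda> (x, w)"
  using cost_le_Lambda[of x w] by (simp add: Gamma_eq Lambda_fun_def add_left_mono)

lemma Lambda_adm_AC: "xw \<in> Lambda_adm H a b \<Longrightarrow> fst xw \<in> AC_set a b"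
  by (auto simp: Lambda_adm_def AC_set_def)

lemma canonical_control_Lambda:
  assumes "abs_cont_on a b x" "\<Gamma> x < \<infinity>"
  defines "w \<equiv> \<lambda>t. (deriv_on x t, real_of_ereal (conj_H H t (x t) (deriv_on x t)))"
  shows "(x, w) \<in> Lambda_adm H a b" "\<Lambda> (x, w) = \<Gamma> x"
  using canonical_control[OF assms(1) Gamma_finiteD(2)[OF assms(1,2)]]
  by (simp_all add: w_def Gamma_eq Lambda_fun_def)

lemma Gamma_minimizer: "\<exists>x\<in>AC_set a b. \<forall>y\<in>AC_set a b. \<Gamma> x \<le> \<Gamma> y"
proof (cases "\<exists>y\<in>AC_set a b. \<Gamma> y < \<infinity>")
  case False
  \<comment> \<open>Here \<Gamma> is \<infinity> throughout, so every absolutely continuous function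
    is a minimizer.\<close>
  obtain x :: "real \<Rightarrow> 'a" where "abs_cont_on a b x" using exists_finite_cost by blast
  then show ?thesis using False by (intro bexI[of _ x]) (auto simp: AC_set_def not_less)
next
  case True
  let ?G = "\<Gamma> ` AC_set a b"
  have "?G \<noteq> {}" using True by blast
  then obtain f :: "nat \<Rightarrow> ereal" where f: "decseq f" "range f \<subseteq> ?G" "Inf ?G = (INF i. f i)"
    using Inf_countable_INF by metis
  obtain y0 where y0: "y0 \<in> AC_set a b" "\<Gamma> y0 < \<infinity>" using True by blast
  have "Inf ?G \<le> \<Gamma> y0" using y0(1) by (intro Inf_lower imageI)
  then have "Inf ?G < \<infinity>" using y0(2) by (rule le_less_trans)
  \<comment> \<open>The sequence may start with \<infinity>; shifting by n0 makes all costs finite,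
    as the a priori bounds require.\<close>
  then obtain n0 where "f n0 < \<infinity>" unfolding f(3) INF_less_iff by blast
  then have ffin: "f (n + n0) < \<infinity>" for n
    using decseqD[OF f(1), of n0 "n + n0"] by (metis le_add2 le_less_trans)
  have flim: "(\<lambda>n. f (n + n0)) \<longlonglongrightarrow> Inf ?G"
    unfolding f(3) by (rule LIMSEQ_ignore_initial_segment[OF LIMSEQ_INF[OF f(1)]])
  have "\<exists>y. abs_cont_on a b y \<and> \<Gamma> y = f (n + n0)" for n
  proof -
    have "f (n + n0) \<in> ?G" using f(2) by blast
    then obtain y where "f (n + n0) = \<Gamma> y" "y \<in> AC_set a b" by (rule imageE)
    then show ?thesis unfolding AC_set_def by auto
  qed
  then obtain y where y: "\<And>n. abs_cont_on a b (y n)" "\<And>n. \<Gamma> (y n) = f (n + n0)" by metis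
  note fin = Gamma_finiteD[OF y(1), unfolded y(2), OF ffin]
  define R where "R = 2 * (1 + M) * exp (2 * C b)"
  have R0: "0 \<le> R" using M0 by (simp add: R_def)
  have yR: "norm (y n t) \<le> R" if "t \<in> {a..b}" for n t
    unfolding R_def by (rule AC_norm_bound[OF y(1) fin(2) M[OF fin(1)] that])
  have "\<exists>x r. abs_cont_on a b x \<and> strict_mono (r :: nat \<Rightarrow> nat) \<and>
      (\<forall>t\<in>{a..b}. (\<lambda>n. y (r n) t) \<longlonglongrightarrow> x t) \<and>
      cost x (deriv_on x) \<le> liminf (\<lambda>n. cost (y (r n)) (deriv_on (y (r n))))"
    by (rule Tonelli_compactness[where y = y, OF y(1) fin(2) R0 yR]) blast+
  then obtain x r where x: "abs_cont_on a b x" and r: "strict_mono (r :: nat \<Rightarrow> nat)"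
    and lim: "\<And>t. t \<in> {a..b} \<Longrightarrow> (\<lambda>n. y (r n) t) \<longlonglongrightarrow> x t"
    and le: "cost x (deriv_on x) \<le> liminf (\<lambda>n. cost (y (r n)) (deriv_on (y (r n))))"
    by blast
  let ?ph = "\<lambda>n. \<phi> (y (r n) a, y (r n) b)" and ?co = "\<lambda>n. cost (y (r n)) (deriv_on (y (r n)))"
  have "(\<lambda>n. (y (r n) a, y (r n) b)) \<longlonglongrightarrow> (x a, x b)" using ab by (intro tendsto_Pair lim) auto
  then have ph: "\<phi> (x a, x b) \<le> liminf ?ph" by (rule lsc_sequentially[OF phi_lsc])
  have "\<Gamma> x \<le> liminf ?ph + liminf ?co" unfolding Gamma_eq by (rule add_mono[OF ph le])
  also have "\<dots> \<le> liminf (\<lambda>n. ?ph n + ?co n)"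
  proof (rule ereal_liminf_add_mono)
    \<comment> \<open>The sum of the lower limits must not be \<infinity> - \<infinity>. Both
      dominate the corresponding terms at the limit x, which are not -\<infinity>.\<close>
    have "liminf ?ph \<noteq> -\<infinity>" using ph phi_not_MInf[of "(x a, x b)"] by auto
    moreover have "liminf ?co \<noteq> -\<infinity>" using le AC_cost_not_MInf[OF x] by auto
    ultimately show "\<not> (liminf ?ph = \<infinity> \<and> liminf ?co = -\<infinity> \<or> liminf ?ph = -\<infinity> \<and> liminf ?co = \<infinity>)" by blast
  qed
  also have "\<dots> = liminf (\<lambda>n. f (r n + n0))" using y(2) by (simp add: Gamma_eq)
  also have "\<dots> = Inf ?G"
    using lim_imp_Liminf[OF trivial_limit_sequentially LIMSEQ_subseq_LIMSEQ[OF flim r]] by (simp add: o_def)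
  finally have "\<Gamma> x \<le> Inf ?G" .
  then show ?thesis using x by (intro bexI[of _ x]) (auto simp: AC_set_def le_Inf_iff)
qed

text \<open>Given \<Gamma> \<le> \<Lambda> along admissible pairs, everything follows from one
  minimizer of \<Gamma> and one admissible pair with the same value.\<close>

lemma equivalence:
  "(\<exists>x\<in>AC_set a b. \<Gamma> x = (INF y\<in>AC_set a b. \<Gamma> y))
   \<and> (\<exists>xa\<in>Lambda_adm H a b. \<Lambda> xa = (INF ya\<in>Lambda_adm H a b. \<Lambda> ya))
   \<and> (INF y\<in>AC_set a b. \<Gamma> y) = (INF ya\<in>Lambda_adm H a b. \<Lambda> ya)
   \<and> (\<forall>xb\<in>AC_set a b. (\<forall>y\<in>AC_set a b. \<Gamma> xb \<le> \<Gamma> y) \<and> \<Gamma> xb < \<infinity> \<longrightarrow>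
        (let w = (\<lambda>t. (deriv_on xb t, real_of_ereal (conj_H H t (xb t) (deriv_on xb t))))
         in (xb, w) \<in> Lambda_adm H a b \<and> (\<forall>ya\<in>Lambda_adm H a b. \<Lambda> (xb, w) \<le> \<Lambda> ya) \<and> \<Lambda> (xb, w) < \<infinity>))
   \<and> (\<forall>xw\<in>Lambda_adm H a b. (\<forall>ya\<in>Lambda_adm H a b. \<Lambda> xw \<le> \<Lambda> ya)
        \<longrightarrow> fst xw \<in> AC_set a b \<and> (\<forall>y\<in>AC_set a b. \<Gamma> (fst xw) \<le> \<Gamma> y))"
proof -
  have GL: "\<Gamma> (fst xw) \<le> \<Lambda> xw" if "xw \<in> Lambda_adm H a b" for xw
    using Gamma_le_Lambda[of "fst xw" "snd xw"] that by simp
  obtain x where x: "x \<in> AC_set a b" "\<And>y. y \<in> AC_set a b \<Longrightarrow> \<Gamma> x \<le> \<Gamma> y"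
    using Gamma_minimizer by blast
  have Gmin: "\<Gamma> x = (INF y\<in>AC_set a b. \<Gamma> y)"
    using x by (intro antisym INF_greatest INF_lower) auto
  have "\<exists>xw\<in>Lambda_adm H a b. \<Lambda> xw = \<Gamma> x"
  proof (cases "\<Gamma> x < \<infinity>")
    case True
    then show ?thesis using canonical_control_Lambda[of x] x(1) unfolding AC_set_def by blast
  next
    case False
    \<comment> \<open>If the minimum is \<infinity>, x may have no canonical control. A trajectory
      of finite integral cost has one; its \<Lambda> is at least \<Gamma> x = \<infinity>, hence
      equal to it.\<close>
    obtain y where y: "abs_cont_on a b y" "cost y (deriv_on y) < \<infinity>" using exists_finite_cost by blast
    let ?xw = "(y, \<lambda>t. (deriv_on y t, real_of_ereal (conj_H H t (y t) (deriv_on y t))))"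
    have adm: "?xw \<in> Lambda_adm H a b" by (rule canonical_control(1)[OF y])
    have "\<Gamma> x \<le> \<Lambda> ?xw" using x(2)[of y] GL[OF adm] y(1) by (auto simp: AC_set_def)
    then have "\<Lambda> ?xw = \<Gamma> x" using False by auto
    then show ?thesis using adm by blast
  qed
  then obtain xw where xw: "xw \<in> Lambda_adm H a b" "\<Lambda> xw = \<Gamma> x" by blast
  have Lge: "\<Gamma> x \<le> \<Lambda> ya" if "ya \<in> Lambda_adm H a b" for ya
    using GL[OF that] x(2)[OF Lambda_adm_AC[OF that]] by (rule order_trans[rotated])
  have Lmin: "\<Gamma> x = (INF ya\<in>Lambda_adm H a b. \<Lambda> ya)"
    using xw Lge by (intro antisym INF_greatest) (auto intro: INF_lower2)
  show ?thesis
  proof (intro conjI ballI impI)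
    show "\<exists>x\<in>AC_set a b. \<Gamma> x = (INF y\<in>AC_set a b. \<Gamma> y)" using x(1) Gmin by blast
    show "\<exists>xa\<in>Lambda_adm H a b. \<Lambda> xa = (INF ya\<in>Lambda_adm H a b. \<Lambda> ya)" using xw Lmin by metis
    show "(INF y\<in>AC_set a b. \<Gamma> y) = (INF ya\<in>Lambda_adm H a b. \<Lambda> ya)" using Gmin Lmin by simp
  next
    fix xb assume xb: "xb \<in> AC_set a b" and *: "(\<forall>y\<in>AC_set a b. \<Gamma> xb \<le> \<Gamma> y) \<and> \<Gamma> xb < \<infinity>"
    have eq: "\<Gamma> xb = \<Gamma> x" using * x xb by (intro antisym) auto
    have ac: "abs_cont_on a b xb" using xb by (simp add: AC_set_def)
    show "let w = (\<lambda>t. (deriv_on xb t, real_of_ereal (conj_H H t (xb t) (deriv_on xb t))))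
         in (xb, w) \<in> Lambda_adm H a b \<and> (\<forall>ya\<in>Lambda_adm H a b. \<Lambda> (xb, w) \<le> \<Lambda> ya) \<and> \<Lambda> (xb, w) < \<infinity>"
      unfolding Let_def using canonical_control_Lambda[OF ac] * Lge eq by simp
  next
    fix ya assume "ya \<in> Lambda_adm H a b"
    then show "fst ya \<in> AC_set a b" by (rule Lambda_adm_AC)
  next
    fix ya and y :: "real \<Rightarrow> 'a" assume ya: "ya \<in> Lambda_adm H a b" and min: "\<forall>yb\<in>Lambda_adm H a b. \<Lambda> ya \<le> \<Lambda> yb" and y: "y \<in> AC_set a b"
    have "\<Gamma> (fst ya) \<le> \<Lambda> ya" by (rule GL[OF ya])
    also have "\<dots> \<le> \<Gamma> x" using min xw by auto
    also have "\<dots> \<le> \<Gamma> y" by (rule x(2)[OF y])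
    finally show "\<Gamma> (fst ya) \<le> \<Gamma> y" .
  qed
qed

end

end

theorem theorem4p5:
  fixes H :: "real \<Rightarrow> 'a::euclidean_space \<Rightarrow> 'a \<Rightarrow> real"
    and c :: "real \<Rightarrow> real"
    and T t0 M :: real
    and \<phi> :: "'a \<times> 'a \<Rightarrow> ereal"
  assumes T: "0 \<le> T"
    and H1: "\<And>x p. (\<lambda>t. H t x p) \<in> borel_measurable (lebesgue_on {0..T})"
    and H2: "\<And>t. t \<in> {0..T} \<Longrightarrow> continuous_on UNIV (\<lambda>(x, p). H t x p)"
    and H3: "\<And>t x. t \<in> {0..T} \<Longrightarrow> convex_on UNIV (H t x)"
    and H4_c: "integrable (lebesgue_on {0..T}) c" "\<And>t. t \<in> {0..T} \<Longrightarrow> 0 \<le> c t"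
    and H4: "\<And>t x p q. t \<in> {0..T} \<Longrightarrow> \<bar>H t x p - H t x q\<bar> \<le> c t * (1 + norm x) * norm (p - q)"
    and HLC: "\<And>R. R > 0 \<Longrightarrow> \<exists>k. integrable (lebesgue_on {0..T}) k \<and> (\<forall>t\<in>{0..T}. 0 \<le> k t) \<and>
               (\<forall>t\<in>{0..T}. \<forall>x\<in>cball 0 R. \<forall>y\<in>cball 0 R. \<forall>p.
                  \<bar>H t x p - H t y p\<bar> \<le> k t * (1 + norm p) * norm (x - y))"
    and H00: "integrable (lebesgue_on {0..T}) (\<lambda>t. H t 0 0)"
    and t0: "t0 \<in> {0..T}"
    and phi_proper: "proper_fun \<phi>"
    and phi_lsc: "lsc \<phi>"
    and M: "0 \<le> M" "\<And>z x. \<phi> (z, x) < \<infinity> \<Longrightarrow> min (norm z) (norm x) \<le> M"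
  shows "(\<exists>x\<in>AC_set t0 T. Gamma_fun H \<phi> t0 T x = (INF y\<in>AC_set t0 T. Gamma_fun H \<phi> t0 T y))
       \<and> (\<exists>xa\<in>Lambda_adm H t0 T. Lambda_fun H \<phi> t0 T xa = (INF ya\<in>Lambda_adm H t0 T. Lambda_fun H \<phi> t0 T ya))
       \<and> (INF y\<in>AC_set t0 T. Gamma_fun H \<phi> t0 T y) = (INF ya\<in>Lambda_adm H t0 T. Lambda_fun H \<phi> t0 T ya)
       \<and> (\<forall>xb\<in>AC_set t0 T. (\<forall>y\<in>AC_set t0 T. Gamma_fun H \<phi> t0 T xb \<le> Gamma_fun H \<phi> t0 T y)
             \<and> Gamma_fun H \<phi> t0 T xb < \<infinity> \<longrightarrow>
             (let ab = (\<lambda>t. (vector_derivative xb (at t within {t0..T}),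
                         real_of_ereal (conj_H H t (xb t) (vector_derivative xb (at t within {t0..T})))))
              in (xb, ab) \<in> Lambda_adm H t0 T
                 \<and> (\<forall>ya\<in>Lambda_adm H t0 T. Lambda_fun H \<phi> t0 T (xb, ab) \<le> Lambda_fun H \<phi> t0 T ya)
                 \<and> Lambda_fun H \<phi> t0 T (xb, ab) < \<infinity>))
       \<and> (\<forall>xab\<in>Lambda_adm H t0 T. (\<forall>ya\<in>Lambda_adm H t0 T. Lambda_fun H \<phi> t0 T xab \<le> Lambda_fun H \<phi> t0 T ya)
             \<longrightarrow> fst xab \<in> AC_set t0 T \<and> (\<forall>y\<in>AC_set t0 T. Gamma_fun H \<phi> t0 T (fst xab) \<le> Gamma_fun H \<phi> t0 T y))"
proof -
  have sub: "t \<in> {0..T}" if "t \<in> {t0..T}" for t using that t0 by auto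
  have int: "integrable (lebesgue_on {t0..T}) f" if "integrable (lebesgue_on {0..T}) f" for f :: "real \<Rightarrow> real"
    using integrable_lebesgue_on_subinterval[OF that] t0 by simp
  interpret hamiltonian H c t0 T
  proof
    show "t0 \<le> T" using t0 by simp
    show "(\<lambda>t. H t x p) \<in> borel_measurable (lebesgue_on {t0..T})" for x p
      by (rule measurable_restrict_mono[OF H1]) (use t0 in auto)
    show "\<exists>k. integrable (lebesgue_on {t0..T}) k \<and> (\<forall>t\<in>{t0..T}. 0 \<le> k t) \<and>
               (\<forall>t\<in>{t0..T}. \<forall>x\<in>cball 0 R. \<forall>y\<in>cball 0 R. \<forall>p.
                  \<bar>H t x p - H t y p\<bar> \<le> k t * (1 + norm p) * norm (x - y))" if "R > 0" for R
      using HLC[OF that] int sub by meson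
  qed (use H2 H3 H4_c H4 H00 sub int in auto)
  show ?thesis by (rule equivalence[OF phi_proper phi_lsc M])
qed

end
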